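(* Let $k\ge0$ be an integer. If $k$ is odd, the space of modes of wavenumber $k$ of the Poincaré dodecahedral space $S^3/I^*$ is $\{0\}$. If $k$ is even, put $\tilde k=\lfloor\frac{k/2}{2}\rfloor+\lfloor\frac{k/2}{3}\rfloor+\lfloor\frac{k/2}{5}\rfloor-\frac k2$ (so $\tilde k\ge-1$). For $i=0,1,\dots,\tilde k$ let $$B_i=I_{12}^{\,5i+\mathrm{mod}(k/2,5)}\;I_{20}^{\,3(\tilde k-i)+\mathrm{mod}(k/2,3)}\;I_{30}^{\,\mathrm{mod}(k/2,2)},$$ a homogeneous polynomial of degree $k$ in $\alpha,\beta$. Then the $(\tilde k+1)(k+1)$ functions consisting of the siblings of $B_0,\dots,B_{\tilde k}$ (restricted to $S^3$) form a basis of the space of modes of wavenumber $k$ of $S^3/I^*$; in particular this space has dimension $(\tilde k+1)(k+1)$ (zero when $\tilde k=-1$).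
   Context: Identify $\mathbb R^4$ with $\mathbb C^2$ via $\alpha=x+iy$, $\beta=z+iw$, $S^3=\{|\alpha|^2+|\beta|^2=1\}$. Wirtinger derivatives $\frac{\partial}{\partial\alpha}=\frac12(\partial_x-i\partial_y)$, $\frac{\partial}{\partial\bar\alpha}=\frac12(\partial_x+i\partial_y)$, similarly for $\beta$ with $(z,w)$. $\mathrm{twist}_-=-\bar\beta\frac{\partial}{\partial\alpha}+\bar\alpha\frac{\partial}{\partial\beta}$. For a polynomial $f$ in $\alpha,\beta$ only, homogeneous of degree $k$, its siblings are $\mathrm{twist}_-^j f$, $j=0,\dots,k$. $\gamma\in SU(2)$ acts on $\mathbb C^2$ by $(\alpha,\beta)^T\mapsto\gamma(\alpha,\beta)^T$ and on functions by $(R_\gamma F)(x)=F(\gamma^{-1}x)$. For a finite subgroup $\Gamma\subset SU(2)$, the space of modes of wavenumber $k$ of $S^3/\Gamma$ is the complex vector space of $\Gamma$-invariant functions $F:S^3\to\mathbb C$ with $\Delta_{S^3}F=-k(k+2)F$. $\mathrm{mod}(m,n)$ is the remainder of $m$ upon division by $n$, $\lfloor\cdot\rfloor$ the floor. $I_{12}=\alpha^{11}\beta+11\alpha^6\beta^6-\alpha\beta^{11}$, $I_{20}=\alpha^{20}-228\alpha^{15}\beta^5+494\alpha^{10}\beta^{10}+228\alpha^5\beta^{15}+\beta^{20}$, $I_{30}=\alpha^{30}+522\alpha^{25}\beta^5-10005\alpha^{20}\beta^{10}-10005\alpha^{10}\beta^{20}-522\alpha^5\beta^{25}+\beta^{30}$.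 A matrix $\begin{pmatrix}a&b\\c&d\end{pmatrix}\in SU(2)$ induces the Möbius map $z\mapsto\frac{az+b}{cz+d}$ of $\mathbb C\cup\{\infty\}$. Let $V_I=\{0,\infty\}\cup\{z:z^{10}+11z^5-1=0\}$ (vertices of a regular icosahedron under stereographic projection), $I$ the order-60 group of such Möbius maps preserving $V_I$, and $I^*\subset SU(2)$ (order 120) the set of matrices inducing elements of $I$. *)

theory Defs
  imports "HOL-Analysis.Analysis"
begin

type_synonym C2pt = "complex \<times> complex"
(* a 2x2 complex matrix (a,b,c,d) = [[a,b],[c,d]] *)
type_synonym mat2 = "complex \<times> complex \<times> complex \<times> complex"

definition S3 :: "C2pt set" where
  "S3 = {p. (cmod (fst p))^2 + (cmod (snd p))^2 = 1}"

definition SU2 :: "mat2 set" where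
  "SU2 = {(a,b,c,d). (cmod a)^2 + (cmod c)^2 = 1 \<and> (cmod b)^2 + (cmod d)^2 = 1
            \<and> cnj a * b + cnj c * d = 0 \<and> a * d - b * c = 1}"

definition mat_act :: "mat2 \<Rightarrow> C2pt \<Rightarrow> C2pt" where
  "mat_act g p = (case g of (a,b,c,d) \<Rightarrow> (a * fst p + b * snd p, c * fst p + d * snd p))"

(* inverse of a 2x2 matrix of determinant 1 *)
definition mat_inv2 :: "mat2 \<Rightarrow> mat2" where
  "mat_inv2 g = (case g of (a,b,c,d) \<Rightarrow> (d, -b, -c, a))"

(* Moebius map on C \<union> {\<infinity>}, with None = \<infinity> *)
definition mobius :: "mat2 \<Rightarrow> complex option \<Rightarrow> complex option" where
  "mobius g z = (case g of (a,b,c,d) \<Rightarrow>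
     (case z of None \<Rightarrow> (if c = 0 then None else Some (a / c))
              | Some w \<Rightarrow> (if c * w + d = 0 then None else Some ((a * w + b) / (c * w + d)))))"

definition V_I :: "complex option set" where
  "V_I = {Some 0, None} \<union> Some ` {z. z^10 + 11 * z^5 - 1 = 0}"

definition Istar :: "mat2 set" where
  "Istar = {g \<in> SU2. mobius g ` V_I = V_I}"

definition dirderiv :: "(C2pt \<Rightarrow> complex) \<Rightarrow> C2pt \<Rightarrow> C2pt \<Rightarrow> complex" where
  "dirderiv G v x = vector_derivative (\<lambda>t::real. G (x + t *\<^sub>R v)) (at 0)"

definition lapR4 :: "(C2pt \<Rightarrow> complex) \<Rightarrow> C2pt \<Rightarrow> complex" where
  "lapR4 G x = (\<Sum>b\<in>(Basis :: C2pt set). dirderiv (\<lambda>y. dirderiv G b y) b x)"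

definition ext0 :: "(C2pt \<Rightarrow> complex) \<Rightarrow> C2pt \<Rightarrow> complex" where
  "ext0 F y = F (inverse (norm y) *\<^sub>R y)"

definition lapS3 :: "(C2pt \<Rightarrow> complex) \<Rightarrow> C2pt \<Rightarrow> complex" where
  "lapS3 F x = lapR4 (ext0 F) x"

definition C2_on :: "C2pt set \<Rightarrow> (C2pt \<Rightarrow> complex) \<Rightarrow> bool" where
  "C2_on U G \<longleftrightarrow> (\<exists>D1 D2.
      (\<forall>x\<in>U. (G has_derivative D1 x) (at x) \<and>
               (\<forall>v. ((\<lambda>y. D1 y v) has_derivative D2 x v) (at x))) \<and>
      (\<forall>v w. continuous_on U (\<lambda>x. D2 x v w)))"

(* functions on S^3 are represented by functions on C^2 vanishing off S^3 *)
definition restrS3 :: "(C2pt \<Rightarrow> complex) \<Rightarrow> C2pt \<Rightarrow> complex" where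
  "restrS3 f x = (if x \<in> S3 then f x else 0)"

definition modes :: "mat2 set \<Rightarrow> nat \<Rightarrow> (C2pt \<Rightarrow> complex) set" where
  "modes \<Gamma> k = {F. (\<forall>x. x \<notin> S3 \<longrightarrow> F x = 0)
      \<and> C2_on (- {0}) (ext0 F)
      \<and> (\<forall>x\<in>S3. lapS3 F x = - of_nat (k * (k + 2)) * F x)
      \<and> (\<forall>g\<in>\<Gamma>. \<forall>x\<in>S3. F (mat_act (mat_inv2 g) x) = F x)}"

(* Wirtinger derivatives; alpha = x + iy is the first coordinate, beta = z + iw the second *)
definition d_alpha :: "(C2pt \<Rightarrow> complex) \<Rightarrow> C2pt \<Rightarrow> complex" where
  "d_alpha f p = (dirderiv f (1, 0) p - \<i> * dirderiv f (\<i>, 0) p) / 2"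

definition d_beta :: "(C2pt \<Rightarrow> complex) \<Rightarrow> C2pt \<Rightarrow> complex" where
  "d_beta f p = (dirderiv f (0, 1) p - \<i> * dirderiv f (0, \<i>) p) / 2"

definition twist_minus :: "(C2pt \<Rightarrow> complex) \<Rightarrow> C2pt \<Rightarrow> complex" where
  "twist_minus f p = - cnj (snd p) * d_alpha f p + cnj (fst p) * d_beta f p"

definition I12 :: "C2pt \<Rightarrow> complex" where
  "I12 p = (let a = fst p; b = snd p in a^11 * b + 11 * a^6 * b^6 - a * b^11)"

definition I20 :: "C2pt \<Rightarrow> complex" where
  "I20 p = (let a = fst p; b = snd p in
     a^20 - 228 * a^15 * b^5 + 494 * a^10 * b^10 + 228 * a^5 * b^15 + b^20)"

definition I30 :: "C2pt \<Rightarrow> complex" where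
  "I30 p = (let a = fst p; b = snd p in
     a^30 + 522 * a^25 * b^5 - 10005 * a^20 * b^10 - 10005 * a^10 * b^20 - 522 * a^5 * b^25 + b^30)"

definition ktilde :: "nat \<Rightarrow> int" where
  "ktilde k = (let m = k div 2 in int (m div 2) + int (m div 3) + int (m div 5) - int m)"

(* B_i for even k, 0 \<le> i \<le> ktilde k *)
definition Bpoly :: "nat \<Rightarrow> nat \<Rightarrow> C2pt \<Rightarrow> complex" where
  "Bpoly k i p = (let m = k div 2 in
      I12 p ^ (5 * i + m mod 5) * I20 p ^ (3 * (nat (ktilde k) - i) + m mod 3) * I30 p ^ (m mod 2))"

definition sibling :: "nat \<Rightarrow> nat \<Rightarrow> nat \<Rightarrow> C2pt \<Rightarrow> complex" where
  "sibling k i j = restrS3 ((twist_minus ^^ j) (Bpoly k i))"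

end

theory Submission
  imports Defs "HOL-Computational_Algebra.Polynomial"
begin

text \<open>
  Write \<open>J (\<alpha>, \<beta>) = (- cnj \<beta>, cnj \<alpha>)\<close>. On binary forms \<open>twist_minus\<close> is the parameter derivative
  of \<open>f (p + t J p)\<close>, so the siblings of \<open>f\<close> are, up to factorials, the coefficients of this
  polynomial in \<open>t\<close>. For the monomials \<open>\<alpha> ^ a * \<beta> ^ b\<close> they are the matrix coefficients \<open>wig a b j\<close>
  of \<open>SU(2)\<close>. These are harmonic, they span all polynomials on the sphere, and for fixed \<open>a + b\<close>
  they are separated by the characters of the torus. Green's formula makes eigenfunctions with
  different eigenvalues orthogonal, so by the Stone--Weierstrass theorem every eigenfunction of
  wavenumber \<open>k\<close> is a unique sum over \<open>j\<close> of \<open>j\<close>-th siblings of forms of degree \<open>k\<close>. As \<open>J\<close> commutes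
  with \<open>SU(2)\<close>, an invariant mode is a sum of siblings of invariant forms.

  An invariant form that vanishes at one vertex of the icosahedron is divisible by \<open>I12\<close>. A form
  that does not vanish there has degree \<open>10 n\<close> with \<open>n \<noteq> 1\<close>, and subtracting a multiple of some
  \<open>I20 ^ b * I30 ^ c\<close> with \<open>n = 2 b + 3 c\<close> makes it vanish. Hence the forms \<open>I12 ^ a * I20 ^ b * I30 ^ c\<close>
  with \<open>c \<le> 1\<close> span the invariants. They are invariant because \<open>I20\<close> and \<open>I30\<close> are covariants of \<open>I12\<close>,
  and the syzygy between the three forms forces the character by which \<open>I12\<close> transforms to be trivial.
\<close>

text \<open>A mode is only a C2 function, so completeness concerns functions not known in advance to
  be polynomials; hence the detour through Green's formula and density. The generating polynomial in
  \<open>t\<close> keeps the rest algebraic: its coordinates \<open>xi\<close> and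
  \<open>eta\<close> satisfy the null relations that make every coefficient harmonic, d/dt is the
  twist, and the torus merely rescales \<open>t\<close>. The group enters through two facts. Each
  element permutes the zeros of \<open>I12\<close>, which fixes \<open>I12\<close> up to a scalar
  and leads to invariance. Conversely, three sorts of explicit elements lie in \<open>Istar\<close>:
  rotations about the axis through 0 and \<infinity>, the flip w \<mapsto> -1/w, and the half-turn
  \<open>sgen\<close>. They carry \<infinity> to every vertex, and they restrict the degree of a
  form that does not vanish there. The case n = 1 has to be excluded because 1 is the only natural
  number not of the form 2b + 3c; a sign at the image of \<infinity> under \<open>sgen\<close>
  excludes it. Invariance passes from a mode to its forms by uniqueness of the expansion, not by
  averaging over the group.\<close>

section \<open>Second-order jets and the Laplacian of R^4\<close>

lemma S3_iff_norm: "p \<in> S3 \<longleftrightarrow> norm p = 1"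
  by (cases p) (simp add: S3_def norm_Pair real_sqrt_eq_1_iff)

lemma sum_Basis_C2:
  fixes f :: "C2pt \<Rightarrow> 'a::comm_monoid_add"
  shows "(\<Sum>b\<in>Basis. f b) = f (1, 0) + f (\<i>, 0) + f (0, 1) + f (0, \<i>)"
proof -
  have "(Basis :: C2pt set) = (\<lambda>u. (u, 0)) ` {1, \<i>} \<union> (\<lambda>u. (0, u)) ` {1, \<i>}"
    by (simp only: Basis_prod_def Basis_complex_def)
  also have "\<dots> = {(1, 0), (\<i>, 0), (0, 1), (0, \<i>)}"
    by auto
  finally have B: "(Basis :: C2pt set) = {(1, 0), (\<i>, 0), (0, 1), (0, \<i>)}" .
  show ?thesis
    unfolding B by (simp add: add.assoc complex_eq_iff)
qed

text \<open>\<open>C2_on\<close> hides its derivatives behind an existential. With the derivatives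
  as parameters, the product rule yields explicit second derivatives whose trace can be
  computed.\<close>

definition has_jet ::
  "(C2pt \<Rightarrow> complex) \<Rightarrow> (C2pt \<Rightarrow> C2pt \<Rightarrow> complex) \<Rightarrow> (C2pt \<Rightarrow> C2pt \<Rightarrow> C2pt \<Rightarrow> complex) \<Rightarrow> C2pt set \<Rightarrow> bool"
  where "has_jet G D1 D2 U \<longleftrightarrow>
    (\<forall>x\<in>U. (G has_derivative D1 x) (at x) \<and> (\<forall>v. ((\<lambda>y. D1 y v) has_derivative D2 x v) (at x))) \<and>
    (\<forall>v w. continuous_on U (\<lambda>x. D2 x v w))"

lemma C2_on_iff_jet: "C2_on U G \<longleftrightarrow> (\<exists>D1 D2. has_jet G D1 D2 U)"
  by (simp add: C2_on_def has_jet_def)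

lemma has_jetD:
  assumes "has_jet G D1 D2 U"
  shows "x \<in> U \<Longrightarrow> (G has_derivative D1 x) (at x)"
    and "x \<in> U \<Longrightarrow> ((\<lambda>y. D1 y v) has_derivative D2 x v) (at x)"
    and "continuous_on U (\<lambda>x. D2 x v w)"
    and "continuous_on U (\<lambda>x. D1 x v)"
    and "continuous_on U G"
proof -
  show 1: "(G has_derivative D1 x) (at x)" if "x \<in> U" for x
    using assms that unfolding has_jet_def by blast
  show 2: "((\<lambda>y. D1 y v) has_derivative D2 x v) (at x)" if "x \<in> U" for x v
    using assms that unfolding has_jet_def by blast
  show "continuous_on U (\<lambda>x. D2 x v w)"
    using assms unfolding has_jet_def by blast
  show "continuous_on U (\<lambda>x. D1 x v)" "continuous_on U G"
    using 1 2 by (meson continuous_at_imp_continuous_on has_derivative_continuous)+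
qed

lemma has_jet_cong:
  assumes "has_jet G D1 D2 U" "open U" "\<And>x. x \<in> U \<Longrightarrow> G x = H x"
  shows "has_jet H D1 D2 U"
  using assms unfolding has_jet_def
  by (metis has_derivative_transform_within_open)

lemma has_jet_mult:
  assumes f: "has_jet f f1 f2 U" and g: "has_jet g g1 g2 U"
  shows "has_jet (\<lambda>x. f x * g x) (\<lambda>x v. f x * g1 x v + f1 x v * g x)
    (\<lambda>x v w. (f x * g2 x v w + f1 x w * g1 x v) + (f1 x v * g1 x w + f2 x v w * g x)) U"
  unfolding has_jet_def
proof (intro conjI ballI allI)
  fix x assume x: "x \<in> U"
  show "((\<lambda>x. f x * g x) has_derivative (\<lambda>v. f x * g1 x v + f1 x v * g x)) (at x)"
    by (intro has_derivative_mult has_jetD(1)[OF f x] has_jetD(1)[OF g x])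
  show "((\<lambda>y. f y * g1 y v + f1 y v * g y) has_derivative
     (\<lambda>w. (f x * g2 x v w + f1 x w * g1 x v) + (f1 x v * g1 x w + f2 x v w * g x))) (at x)" for v
    by (intro has_derivative_add has_derivative_mult has_jetD(1)[OF f x] has_jetD(1)[OF g x]
        has_jetD(2)[OF f x] has_jetD(2)[OF g x])
next
  fix v w
  show "continuous_on U (\<lambda>x. (f x * g2 x v w + f1 x w * g1 x v) + (f1 x v * g1 x w + f2 x v w * g x))"
    by (intro continuous_intros has_jetD(3-5)[OF f] has_jetD(3-5)[OF g])
qed

lemma has_jet_add:
  assumes f: "has_jet f f1 f2 U" and g: "has_jet g g1 g2 U"
  shows "has_jet (\<lambda>x. f x + g x) (\<lambda>x v. f1 x v + g1 x v) (\<lambda>x v w. f2 x v w + g2 x v w) U"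
  unfolding has_jet_def
  by (auto intro!: has_derivative_add continuous_intros has_jetD[OF f] has_jetD[OF g])

lemma has_jet_scale:
  assumes f: "has_jet f f1 f2 U"
  shows "has_jet (\<lambda>x. c * f x) (\<lambda>x v. c * f1 x v) (\<lambda>x v w. c * f2 x v w) U"
  unfolding has_jet_def
  by (auto intro!: has_derivative_mult_right continuous_intros has_jetD[OF f])

lemma has_jet_cnj:
  assumes f: "has_jet f f1 f2 U"
  shows "has_jet (\<lambda>x. cnj (f x)) (\<lambda>x v. cnj (f1 x v)) (\<lambda>x v w. cnj (f2 x v w)) U"
  unfolding has_jet_def
  by (auto intro!: bounded_linear.has_derivative[OF bounded_linear_cnj] continuous_intros has_jetD[OF f])

lemma dirderiv_eq:
  assumes "(G has_derivative D) (at x)"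
  shows "dirderiv G v x = D v"
proof -
  have "((\<lambda>t::real. x + t *\<^sub>R v) has_derivative (\<lambda>t. t *\<^sub>R v)) (at 0)"
    by (auto intro!: derivative_eq_intros)
  moreover have "(G has_derivative D) (at (x + 0 *\<^sub>R v))"
    using assms by simp
  ultimately have "((\<lambda>t::real. G (x + t *\<^sub>R v)) has_derivative (\<lambda>t. D (t *\<^sub>R v))) (at 0)"
    by (rule has_derivative_compose)
  moreover have "(\<lambda>t. D (t *\<^sub>R v)) = (\<lambda>t. t *\<^sub>R D v)"
    using assms by (simp add: has_derivative_bounded_linear bounded_linear.linear linear_scale)
  ultimately show ?thesis
    unfolding dirderiv_def by (simp add: has_vector_derivative_def vector_derivative_at)
qed

text \<open>\<open>dirderiv G b\<close> agrees with \<open>D1\<close> only on \<open>U\<close>;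
  openness makes this an identity near \<open>x\<close>, so that it can be differentiated once
  more.\<close>

lemma lapR4_eq_jet:
  assumes "has_jet G D1 D2 U" "open U" "x \<in> U"
  shows "lapR4 G x = (\<Sum>b\<in>Basis. D2 x b b)"
  unfolding lapR4_def
proof (rule sum.cong[OF refl])
  fix b :: C2pt
  have "((\<lambda>y. D1 y b) has_derivative D2 x b) (at x)"
    using has_jetD(2)[OF assms(1,3)] .
  then have "((\<lambda>y. dirderiv G b y) has_derivative D2 x b) (at x)"
    using assms(2,3)
    by (rule has_derivative_transform_within_open)
      (simp add: dirderiv_eq[OF has_jetD(1)[OF assms(1)]])
  then show "dirderiv (dirderiv G b) b x = D2 x b b"
    by (rule dirderiv_eq)
qed

subsection \<open>Matrix coefficients\<close>

text \<open>\<open>xi p\<close> and \<open>eta p\<close> are the coordinates of \<open>p + t J p\<close> as polynomials in \<open>t\<close>.\<close>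

definition xi :: "C2pt \<Rightarrow> complex poly" where "xi p = [:fst p, - cnj (snd p):]"
definition eta :: "C2pt \<Rightarrow> complex poly" where "eta p = [:snd p, cnj (fst p):]"
definition PE :: "nat \<Rightarrow> nat \<Rightarrow> C2pt \<Rightarrow> complex poly" where "PE a b p = xi p ^ a * eta p ^ b"
definition wig :: "nat \<Rightarrow> nat \<Rightarrow> nat \<Rightarrow> C2pt \<Rightarrow> complex" where "wig a b j p = coeff (PE a b p) j"

text \<open>\<open>xi\<close> and \<open>eta\<close> are real-linear, hence their own derivatives.
  The truncated exponents \<open>a - 1\<close> and \<open>b - 1\<close> are harmless at 0, where the
  factor \<open>of_nat a\<close> or \<open>of_nat b\<close> vanishes.\<close>

definition dPE :: "nat \<Rightarrow> nat \<Rightarrow> C2pt \<Rightarrow> C2pt \<Rightarrow> complex poly" where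
  "dPE a b x v = of_nat a * xi v * PE (a - 1) b x + of_nat b * eta v * PE a (b - 1) x"

definition d2PE :: "nat \<Rightarrow> nat \<Rightarrow> C2pt \<Rightarrow> C2pt \<Rightarrow> C2pt \<Rightarrow> complex poly" where
  "d2PE a b x v w = of_nat a * xi v * dPE (a - 1) b x w + of_nat b * eta v * dPE a (b - 1) x w"

text \<open>Polynomials carry no topology in the library, hence derivatives are taken coefficientwise.\<close>

definition coeff_deriv :: "(C2pt \<Rightarrow> complex poly) \<Rightarrow> (C2pt \<Rightarrow> complex poly) \<Rightarrow> C2pt \<Rightarrow> bool" where
  "coeff_deriv P P' x \<longleftrightarrow> (\<forall>j. ((\<lambda>y. coeff (P y) j) has_derivative (\<lambda>v. coeff (P' v) j)) (at x))"

lemma coeff_deriv_mult: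
  assumes "coeff_deriv P P' x" "coeff_deriv Q Q' x"
  shows "coeff_deriv (\<lambda>y. P y * Q y) (\<lambda>v. P x * Q' v + P' v * Q x) x"
  unfolding coeff_deriv_def
proof
  fix j
  have "((\<lambda>y. \<Sum>i\<le>j. coeff (P y) i * coeff (Q y) (j - i)) has_derivative
     (\<lambda>v. \<Sum>i\<le>j. coeff (P x) i * coeff (Q' v) (j - i) + coeff (P' v) i * coeff (Q x) (j - i))) (at x)"
    using assms by (intro has_derivative_sum has_derivative_mult) (auto simp: coeff_deriv_def)
  then show "((\<lambda>y. coeff (P y * Q y) j) has_derivative
     (\<lambda>v. coeff (P x * Q' v + P' v * Q x) j)) (at x)"
    by (simp add: coeff_mult sum.distrib)
qed

lemma coeff_deriv_const: "coeff_deriv (\<lambda>y. c) (\<lambda>v. 0) x"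
  by (simp add: coeff_deriv_def)

lemma coeff_deriv_add:
  "coeff_deriv P P' x \<Longrightarrow> coeff_deriv Q Q' x \<Longrightarrow> coeff_deriv (\<lambda>y. P y + Q y) (\<lambda>v. P' v + Q' v) x"
  by (auto simp: coeff_deriv_def intro!: has_derivative_add)

lemma coeff_deriv_power:
  assumes "coeff_deriv P P' x"
  shows "coeff_deriv (\<lambda>y. P y ^ n) (\<lambda>v. of_nat n * P' v * P x ^ (n - 1)) x"
proof (induction n)
  case (Suc n)
  have "(\<lambda>v. P x * (of_nat n * P' v * P x ^ (n - 1)) + P' v * P x ^ n)
      = (\<lambda>v. of_nat (Suc n) * P' v * P x ^ (Suc n - 1))"
    by (cases n) (auto simp: algebra_simps)
  then show ?case
    using coeff_deriv_mult[OF assms Suc.IH] by simp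
qed (simp add: coeff_deriv_const)

lemma coeff_deriv_xi: "coeff_deriv xi xi x"
proof -
  have "((\<lambda>y. coeff (xi y) j) has_derivative (\<lambda>v. coeff (xi v) j)) (at x)" for j
    by (cases j rule: nat.exhaust; cases "j - 1" rule: nat.exhaust)
      (auto simp: xi_def coeff_pCons intro!: derivative_intros bounded_linear.has_derivative[OF bounded_linear_cnj])
  then show ?thesis
    by (simp add: coeff_deriv_def)
qed

lemma coeff_deriv_eta: "coeff_deriv eta eta x"
proof -
  have "((\<lambda>y. coeff (eta y) j) has_derivative (\<lambda>v. coeff (eta v) j)) (at x)" for j
    by (cases j rule: nat.exhaust; cases "j - 1" rule: nat.exhaust)
      (auto simp: eta_def coeff_pCons intro!: derivative_intros bounded_linear.has_derivative[OF bounded_linear_cnj])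
  then show ?thesis
    by (simp add: coeff_deriv_def)
qed

lemma coeff_deriv_PE: "coeff_deriv (PE a b) (dPE a b x) x"
  using coeff_deriv_mult[OF coeff_deriv_power[OF coeff_deriv_xi, of a]
      coeff_deriv_power[OF coeff_deriv_eta, of b], of x]
  by (simp add: PE_def[abs_def] dPE_def[abs_def] algebra_simps)

lemma coeff_deriv_dPE: "coeff_deriv (\<lambda>y. dPE a b y v) (d2PE a b x v) x"
proof -
  have "coeff_deriv (\<lambda>y. c * PE a b y) (\<lambda>v. c * dPE a b x v) x" for c a b
    using coeff_deriv_mult[OF coeff_deriv_const coeff_deriv_PE] by simp
  from coeff_deriv_add[OF this this] show ?thesis
    unfolding dPE_def[of a b _ v] d2PE_def[abs_def] .
qed

lemma continuous_coeff_mult: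
  fixes P Q :: "C2pt \<Rightarrow> complex poly"
  assumes "\<And>j. continuous_on U (\<lambda>x. coeff (P x) j)" "\<And>j. continuous_on U (\<lambda>x. coeff (Q x) j)"
  shows "continuous_on U (\<lambda>x. coeff (P x * Q x) j)"
  unfolding coeff_mult by (intro continuous_on_sum continuous_on_mult assms)

lemma has_jet_wig:
  "has_jet (wig a b j) (\<lambda>x v. coeff (dPE a b x v) j) (\<lambda>x v w. coeff (d2PE a b x v w) j) UNIV"
proof -
  have 1: "(wig a b j has_derivative (\<lambda>v. coeff (dPE a b x v) j)) (at x)" for a b j x
    using coeff_deriv_PE[of a b x] by (simp add: coeff_deriv_def wig_def[abs_def])
  have 2: "continuous_on UNIV (\<lambda>x. coeff (dPE a b x v) j)" for a b j v
    using coeff_deriv_dPE[of a b v]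
    by (metis coeff_deriv_def continuous_at_imp_continuous_on has_derivative_continuous)
  have 3: "continuous_on UNIV (\<lambda>x. coeff (d2PE a b x v w) j)" for v w
    unfolding d2PE_def coeff_add
    by (intro continuous_intros continuous_coeff_mult 2)
  show ?thesis
    unfolding has_jet_def using 1 3 coeff_deriv_dPE by (auto simp: coeff_deriv_def)
qed

text \<open>Over the four real basis vectors the sums of \<open>xi v * xi v\<close>,
  \<open>xi v * eta v\<close> and \<open>eta v * eta v\<close> all vanish, and the trace of the
  second derivative is a combination of these three.\<close>

lemma lap_wig: "(\<Sum>v\<in>Basis. coeff (d2PE a b x v v) j) = 0"
proof -
  let ?t = "[:0, 1::complex:]" and ?I = "[:\<i>:]"
  have b: "xi (1,0) = 1" "xi (\<i>,0) = ?I" "xi (0,1) = - ?t" "xi (0,\<i>) = ?I * ?t"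
    "eta (1,0) = ?t" "eta (\<i>,0) = - ?I * ?t" "eta (0,1) = 1" "eta (0,\<i>) = ?I"
    by (auto simp: xi_def eta_def one_pCons)
  have I: "?I * ?I = - 1" "?I * (?I * y) = - y" for y
    by (simp_all add: one_pCons)
  have "(\<Sum>v\<in>Basis. d2PE a b x v v) = 0"
    unfolding sum_Basis_C2 d2PE_def dPE_def b
    by (simp only: algebra_simps I) (simp add: algebra_simps I)
  then have "coeff (\<Sum>v\<in>Basis. d2PE a b x v v) j = 0"
    by simp
  then show ?thesis
    by (simp add: coeff_sum)
qed

lemma euler_wig: "coeff (dPE a b x x) j = of_nat (a + b) * wig a b j x"
proof -
  have "dPE a b x x = of_nat (a + b) * PE a b x"
    unfolding dPE_def PE_def by (cases a; cases b) (auto simp: algebra_simps)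
  then show ?thesis
    by (simp add: wig_def of_nat_poly)
qed

section \<open>Eigenvalues of the matrix coefficients on the sphere\<close>

lemma has_derivative_inverse_norm_power:
  fixes x :: "'a::real_inner"
  assumes "x \<noteq> 0"
  shows "((\<lambda>y. inverse (norm y) ^ m) has_derivative
    (\<lambda>v. - real m * (x \<bullet> v) * inverse (norm x) ^ (m + 2))) (at x)"
proof -
  have norm': "(norm has_derivative (\<lambda>v. sgn x \<bullet> v)) (at x)"
    using has_derivative_norm[OF assms] by (simp add: inner_commute)
  have "((\<lambda>y. inverse (norm y) ^ m) has_derivative
    (\<lambda>v. real m * (- (inverse (norm x) * (sgn x \<bullet> v) * inverse (norm x))) * inverse (norm x) ^ (m - 1))) (at x)"
    using assms norm' by (auto intro!: derivative_eq_intros simp: fun_eq_iff)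
  also have "(\<lambda>v. real m * (- (inverse (norm x) * (sgn x \<bullet> v) * inverse (norm x))) * inverse (norm x) ^ (m - 1))
     = (\<lambda>v. - real m * (x \<bullet> v) * inverse (norm x) ^ (m + 2))"
    by (cases m) (auto simp: fun_eq_iff sgn_div_norm inner_commute divide_inverse algebra_simps)
  finally show ?thesis .
qed

lemma has_jet_inverse_norm_power:
  "has_jet (\<lambda>y. of_real (inverse (norm y) ^ k))
     (\<lambda>x v. of_real (- real k * (x \<bullet> v) * inverse (norm x) ^ (k + 2)))
     (\<lambda>x v w. of_real (- real k * ((w \<bullet> v) * inverse (norm x) ^ (k + 2)
        - (x \<bullet> v) * (real (k + 2) * (x \<bullet> w) * inverse (norm x) ^ (k + 4))))) (- {0})"
  unfolding has_jet_def
proof (intro conjI ballI allI)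
  fix x :: C2pt assume "x \<in> - {0}"
  then have x: "x \<noteq> 0" by simp
  show "((\<lambda>y. of_real (inverse (norm y) ^ k)) has_derivative
     (\<lambda>v. of_real (- real k * (x \<bullet> v) * inverse (norm x) ^ (k + 2)))) (at x)"
    by (intro has_derivative_of_real has_derivative_inverse_norm_power x)
  show "((\<lambda>y. of_real (- real k * (y \<bullet> v) * inverse (norm y) ^ (k + 2))) has_derivative
     (\<lambda>w. of_real (- real k * ((w \<bullet> v) * inverse (norm x) ^ (k + 2)
        - (x \<bullet> v) * (real (k + 2) * (x \<bullet> w) * inverse (norm x) ^ (k + 4)))))) (at x)" for v
  proof (rule has_derivative_of_real)
    have "((\<lambda>y. - real k * (y \<bullet> v)) has_derivative (\<lambda>w. - real k * (w \<bullet> v))) (at x)"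
      by (auto intro!: derivative_eq_intros)
    from has_derivative_mult[OF this has_derivative_inverse_norm_power[OF x, of "k + 2"]]
    show "((\<lambda>y. - real k * (y \<bullet> v) * inverse (norm y) ^ (k + 2)) has_derivative
       (\<lambda>w. - real k * ((w \<bullet> v) * inverse (norm x) ^ (k + 2)
        - (x \<bullet> v) * (real (k + 2) * (x \<bullet> w) * inverse (norm x) ^ (k + 4))))) (at x)"
      by (rule has_derivative_eq_rhs) (simp add: fun_eq_iff algebra_simps numeral_eq_Suc)
  qed
next
  fix v w :: C2pt
  show "continuous_on (- {0}) (\<lambda>x. of_real (- real k * ((w \<bullet> v) * inverse (norm x) ^ (k + 2)
        - (x \<bullet> v) * (real (k + 2) * (x \<bullet> w) * inverse (norm x) ^ (k + 4)))) :: complex)"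
    by (intro continuous_intros) auto
qed

lemma xi_scaleR: "xi (r *\<^sub>R p) = smult (of_real r) (xi p)"
  by (simp add: xi_def scaleR_conv_of_real)

lemma eta_scaleR: "eta (r *\<^sub>R p) = smult (of_real r) (eta p)"
  by (simp add: eta_def scaleR_conv_of_real)

lemma wig_scaleR: "wig a b j (r *\<^sub>R p) = of_real (r ^ (a + b)) * wig a b j p"
  by (simp add: wig_def PE_def xi_scaleR eta_scaleR smult_power power_add)

lemma normalize_in_S3: "y \<noteq> 0 \<Longrightarrow> inverse (norm y) *\<^sub>R y \<in> S3"
  by (simp add: S3_iff_norm)

lemma ext0_wig:
  assumes "y \<noteq> 0"
  shows "ext0 (restrS3 (wig a b j)) y = of_real (inverse (norm y) ^ (a + b)) * wig a b j y"
  using normalize_in_S3[OF assms] by (simp add: ext0_def restrS3_def wig_scaleR)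

lemma inner_Basis_sum_deriv:
  fixes D :: "'a::euclidean_space \<Rightarrow> complex"
  assumes "linear D"
  shows "(\<Sum>b\<in>Basis. of_real (x \<bullet> b) * D b) = D x"
proof -
  have "D x = D (\<Sum>b\<in>Basis. (x \<bullet> b) *\<^sub>R b)"
    by (simp add: euclidean_representation)
  also have "\<dots> = (\<Sum>b\<in>Basis. (x \<bullet> b) *\<^sub>R D b)"
    using assms by (simp add: linear_sum linear_scale)
  finally show ?thesis
    by (simp add: scaleR_conv_of_real)
qed

lemma has_jet_subset: "has_jet G D1 D2 U \<Longrightarrow> V \<subseteq> U \<Longrightarrow> has_jet G D1 D2 V"
  unfolding has_jet_def by (meson continuous_on_subset subset_iff)

text \<open>The degree-0 extension is r^(-k) h with h harmonic and homogeneous of degree k. At r = 1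
  the cross term of the Laplacian gives -2k^2 h by Euler's identity, and the Laplacian of r^(-k)
  gives k(k+2) - 4k; together this is -k(k+2) h.\<close>

lemma modes_wig:
  shows C2_on_ext0_wig: "C2_on (- {0}) (ext0 (restrS3 (wig a b j)))"
    and lapS3_wig: "x \<in> S3 \<Longrightarrow>
      lapS3 (restrS3 (wig a b j)) x = - of_nat ((a + b) * (a + b + 2)) * wig a b j x"
proof -
  define k where "k = a + b"
  have E: "has_jet (wig a b j) (\<lambda>x v. coeff (dPE a b x v) j) (\<lambda>x v w. coeff (d2PE a b x v w) j) (- {0})"
    using has_jet_wig by (rule has_jet_subset) simp
  note J0 = has_jet_cong[OF has_jet_mult[OF has_jet_inverse_norm_power[of k] E] open_Compl[OF closed_singleton],
      of "ext0 (restrS3 (wig a b j))"]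
  have J: "has_jet (ext0 (restrS3 (wig a b j)))
     (\<lambda>x v. of_real (inverse (norm x) ^ k) * coeff (dPE a b x v) j +
        of_real (- real k * (x \<bullet> v) * inverse (norm x) ^ (k + 2)) * wig a b j x)
     (\<lambda>x v w. (of_real (inverse (norm x) ^ k) * coeff (d2PE a b x v w) j
        + of_real (- real k * (x \<bullet> w) * inverse (norm x) ^ (k + 2)) * coeff (dPE a b x v) j)
      + (of_real (- real k * (x \<bullet> v) * inverse (norm x) ^ (k + 2)) * coeff (dPE a b x w) j
        + of_real (- real k * ((w \<bullet> v) * inverse (norm x) ^ (k + 2)
          - (x \<bullet> v) * (real (k + 2) * (x \<bullet> w) * inverse (norm x) ^ (k + 4)))) * wig a b j x)) (- {0})"
    by (rule J0) (auto simp: ext0_wig k_def)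
  then show "C2_on (- {0}) (ext0 (restrS3 (wig a b j)))"
    unfolding C2_on_iff_jet by blast
  assume "x \<in> S3"
  then have nx: "norm x = 1" by (simp add: S3_iff_norm)
  then have x: "x \<in> - {0}" by auto
  have lin: "linear (\<lambda>v. coeff (dPE a b x v) j)"
    using has_jetD(1)[OF E x] by (simp add: has_derivative_bounded_linear bounded_linear.linear)
  have s1: "(\<Sum>v\<in>Basis. of_real (x \<bullet> v) * coeff (dPE a b x v) j) = of_nat k * wig a b j x"
    using inner_Basis_sum_deriv[OF lin, of x] by (simp add: euler_wig k_def)
  have s2: "(\<Sum>v\<in>Basis. of_real ((x \<bullet> v) * (x \<bullet> v)) :: complex) = 1"
  proof -
    have "(\<Sum>v\<in>Basis. (x \<bullet> v) * (x \<bullet> v)) = 1"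
      using nx by (simp flip: euclidean_inner add: dot_square_norm)
    then show ?thesis
      by (simp only: flip: of_real_sum) simp
  qed
  have s3: "(\<Sum>v\<in>(Basis::C2pt set). of_real (v \<bullet> v) :: complex) = 4"
    by (simp add: sum_Basis_C2 inner_prod_def)
  have "lapS3 (restrS3 (wig a b j)) x = (\<Sum>v\<in>Basis. coeff (d2PE a b x v v) j)
     - 2 * of_nat k * (\<Sum>v\<in>Basis. of_real (x \<bullet> v) * coeff (dPE a b x v) j)
     - of_nat k * wig a b j x * (\<Sum>v\<in>(Basis::C2pt set). of_real (v \<bullet> v))
     + of_nat k * of_nat (k + 2) * wig a b j x * (\<Sum>v\<in>Basis. of_real ((x \<bullet> v) * (x \<bullet> v)))"
    unfolding lapS3_def lapR4_eq_jet[OF J open_Compl[OF closed_singleton] x] nx sum_Basis_C2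
    by (simp add: algebra_simps)
  also have "\<dots> = - of_nat (k * (k + 2)) * wig a b j x"
    unfolding lap_wig s1 s2 s3 by (simp add: algebra_simps)
  finally show "lapS3 (restrS3 (wig a b j)) x = - of_nat ((a + b) * (a + b + 2)) * wig a b j x"
    by (simp add: k_def)
qed

section \<open>The twist as derivative in the parameter\<close>

lemma pderiv_PE:
  "pderiv (PE a b p) = [:- cnj (snd p):] * (of_nat a * PE (a - 1) b p) + [:cnj (fst p):] * (of_nat b * PE a (b - 1) p)"
proof -
  have "pderiv (xi p) = [:- cnj (snd p):]" "pderiv (eta p) = [:cnj (fst p):]"
    by (simp_all add: xi_def eta_def pderiv_pCons)
  then show ?thesis
    unfolding PE_def
    by (cases a; cases b) (simp_all add: pderiv_mult pderiv_power_Suc of_nat_poly algebra_simps del: power_Suc)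
qed

text \<open>The Wirtinger derivative in \<alpha> sends \<open>xi\<close> to 1 and \<open>eta\<close>
  to 0, that in \<beta> does the reverse, although both polynomials contain conjugates. Hence
  \<open>twist_minus\<close> acts on \<open>PE\<close> as \<open>pderiv\<close>, and the factor
  \<open>Suc j\<close> is the one in \<open>coeff_pderiv\<close>.\<close>

lemma twist_minus_sum_wig:
  assumes "finite A"
  shows "twist_minus (\<lambda>p. \<Sum>a\<in>A. c a * wig a (k - a) j p) p = of_nat (Suc j) * (\<Sum>a\<in>A. c a * wig a (k - a) (Suc j) p)"
proof -
  have d: "dirderiv (\<lambda>p. \<Sum>a\<in>A. c a * wig a (k - a) j p) v p = (\<Sum>a\<in>A. c a * coeff (dPE a (k - a) p v) j)" for v
    by (intro dirderiv_eq has_derivative_sum has_derivative_mult_right has_jetD(1)[OF has_jet_wig]) simp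
  let ?t = "[:0, 1::complex:]" and ?I = "[:\<i>:]"
  have b: "xi (1,0) = 1" "xi (\<i>,0) = ?I" "xi (0,1) = - ?t" "xi (0,\<i>) = ?I * ?t"
    "eta (1,0) = ?t" "eta (\<i>,0) = - ?I * ?t" "eta (0,1) = 1" "eta (0,\<i>) = ?I"
    by (auto simp: xi_def eta_def one_pCons)
  have I: "?I * (?I * y) = - y" for y
    by (simp add: one_pCons)
  have two: "smult 2 P = P + P" for P :: "complex poly"
    by (simp only: one_add_one[symmetric] smult_add_left smult_1_left)
  have 1: "(coeff (dPE a b p (1,0)) j - \<i> * coeff (dPE a b p (\<i>,0)) j) / 2 = coeff (of_nat a * PE (a - 1) b p) j" for a b
  proof -
    have "dPE a b p (1,0) - ?I * dPE a b p (\<i>,0) = smult 2 (of_nat a * PE (a - 1) b p)"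
      unfolding dPE_def b two by (simp only: algebra_simps I) (simp add: algebra_simps I)
    from arg_cong[OF this, of "\<lambda>P. coeff P j"] show ?thesis
      by simp
  qed
  have 2: "(coeff (dPE a b p (0,1)) j - \<i> * coeff (dPE a b p (0,\<i>)) j) / 2 = coeff (of_nat b * PE a (b - 1) p) j" for a b
  proof -
    have "dPE a b p (0,1) - ?I * dPE a b p (0,\<i>) = smult 2 (of_nat b * PE a (b - 1) p)"
      unfolding dPE_def b two by (simp only: algebra_simps I) (simp add: algebra_simps I)
    from arg_cong[OF this, of "\<lambda>P. coeff P j"] show ?thesis
      by simp
  qed
  have "d_alpha (\<lambda>p. \<Sum>a\<in>A. c a * wig a (k - a) j p) p = (\<Sum>a\<in>A. c a * coeff (of_nat a * PE (a - 1) (k - a) p) j)"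
    unfolding d_alpha_def d 1[symmetric]
    by (simp add: sum_distrib_left sum_subtractf sum_divide_distrib algebra_simps diff_divide_distrib)
  moreover have "d_beta (\<lambda>p. \<Sum>a\<in>A. c a * wig a (k - a) j p) p = (\<Sum>a\<in>A. c a * coeff (of_nat (k - a) * PE a (k - a - 1) p) j)"
    unfolding d_beta_def d 2[symmetric]
    by (simp add: sum_distrib_left sum_subtractf sum_divide_distrib algebra_simps diff_divide_distrib)
  ultimately have "twist_minus (\<lambda>p. \<Sum>a\<in>A. c a * wig a (k - a) j p) p
      = (\<Sum>a\<in>A. c a * coeff (pderiv (PE a (k - a) p)) j)"
    unfolding twist_minus_def pderiv_PE
    by (simp add: sum_distrib_left sum_negf algebra_simps flip: sum.distrib)
  then show ?thesis
    by (simp add: coeff_pderiv wig_def sum_distrib_left algebra_simps)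
qed

lemma twist_minus_funpow_sum_wig:
  assumes "finite A"
  shows "(twist_minus ^^ j) (\<lambda>p. \<Sum>a\<in>A. c a * wig a (k - a) 0 p) = (\<lambda>p. fact j * (\<Sum>a\<in>A. c a * wig a (k - a) j p))"
proof (induction j)
  case (Suc j)
  have "(twist_minus ^^ Suc j) (\<lambda>p. \<Sum>a\<in>A. c a * wig a (k - a) 0 p)
     = twist_minus (\<lambda>p. \<Sum>a\<in>A. (fact j * c a) * wig a (k - a) j p)"
    using Suc.IH by (simp add: sum_distrib_left mult.assoc)
  also have "\<dots> = (\<lambda>p. fact (Suc j) * (\<Sum>a\<in>A. c a * wig a (k - a) (Suc j) p))"
    by (rule ext) (simp only: twist_minus_sum_wig[OF assms], simp add: sum_distrib_left algebra_simps)
  finally show ?case .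
qed simp

subsection \<open>Green's formula\<close>

lemma integrable_continuous_compact_support:
  fixes w :: "'a::euclidean_space \<Rightarrow> 'b::{banach, second_countable_topology}"
  assumes "continuous_on UNIV w" "\<And>x. R \<le> norm x \<Longrightarrow> w x = 0"
  shows "integrable lborel w"
proof -
  have "integrable lborel (\<lambda>x. indicator (cball 0 R) x *\<^sub>R w x)"
    using assms(1) by (intro borel_integrable_compact) (auto intro: continuous_on_subset)
  also have "(\<lambda>x. indicator (cball 0 R) x *\<^sub>R w x) = w"
    using assms(2) by (auto simp: fun_eq_iff indicator_def)
  finally show ?thesis .
qed

text \<open>By translation invariance every difference quotient has integral 0, and dominated
  convergence passes to the derivative. Steps of length at most \<open>norm b\<close> keep all
  quotients supported in the ball of radius \<open>R + norm b\<close>.\<close>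

lemma integral_dirderiv_compact_support:
  fixes w :: "'a::euclidean_space \<Rightarrow> 'b::{banach, second_countable_topology}"
  assumes D: "\<And>x. (w has_derivative D x) (at x)"
    and cont: "continuous_on UNIV (\<lambda>x. D x b)"
    and supp: "\<And>x. R \<le> norm x \<Longrightarrow> w x = 0"
  shows "(\<integral>x. D x b \<partial>lborel) = 0"
proof -
  have contw: "continuous_on UNIV w"
    using D by (meson continuous_at_imp_continuous_on has_derivative_continuous)
  have lin: "D x (r *\<^sub>R v) = r *\<^sub>R D x v" for x r v
    by (rule linear_scale[OF has_derivative_linear[OF D]])
  have D0: "D x b = 0" if "R < norm x" for x
  proof -
    have "(w has_derivative (\<lambda>_. 0)) (at x)"
    proof (rule has_derivative_transform_within_open)
      show "((\<lambda>_. 0) has_derivative (\<lambda>_. 0)) (at x)" by simp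
      show "open {x :: 'a. R < norm x}"
        by (intro open_Collect_less continuous_intros)
    qed (use that supp in auto)
    then show ?thesis
      using fun_cong[OF has_derivative_unique[OF D]] by simp
  qed
  have "bounded ((\<lambda>x. D x b) ` cball 0 R)"
    using cont by (intro compact_imp_bounded compact_continuous_image) (auto intro: continuous_on_subset)
  then obtain M where M: "\<And>x. x \<in> cball 0 R \<Longrightarrow> norm (D x b) \<le> M"
    unfolding bounded_iff by (metis imageI)
  define B where "B = max M 0"
  have B: "norm (D x b) \<le> B" for x
    using M[of x] D0[of x] by (cases "norm x \<le> R") (auto simp: B_def)
  have B0: "B \<ge> 0" by (simp add: B_def)
  have iw: "integrable lborel w"
    using contw supp by (rule integrable_continuous_compact_support)
  have it: "integrable lborel (\<lambda>x. w (c + x))" and tr: "(\<integral>x. w (c + x) \<partial>lborel) = (\<integral>x. w x \<partial>lborel)" for c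
  proof -
    have m: "w \<in> borel_measurable borel"
      using contw by (rule borel_measurable_continuous_onI)
    show "integrable lborel (\<lambda>x. w (c + x))"
      using integrable_distr_eq[of "(+) c" lborel borel w] iw m by (simp add: lborel_distr_plus)
    show "(\<integral>x. w (c + x) \<partial>lborel) = (\<integral>x. w x \<partial>lborel)"
      using integral_distr[of "(+) c" lborel borel w] m by (simp add: lborel_distr_plus)
  qed
  define h where "h n = inverse (real (Suc n))" for n
  have h: "0 < h n" "h n \<le> 1" for n
    by (auto simp: h_def inverse_le_1_iff)
  define s where "s n x = inverse (h n) *\<^sub>R (w (h n *\<^sub>R b + x) - w x)" for n x
  have s0: "(\<integral>x. s n x \<partial>lborel) = 0" for n
    unfolding s_def using it iw tr by simp
  have lip: "norm (w (h n *\<^sub>R b + x) - w x) \<le> B * h n" for n x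
  proof -
    have "norm ((\<lambda>t. w (t *\<^sub>R b + x)) (h n) - (\<lambda>t. w (t *\<^sub>R b + x)) 0) \<le> B * norm (h n - 0)"
    proof (rule differentiable_bound[of "{0..h n}" _ "\<lambda>t r. r *\<^sub>R D (t *\<^sub>R b + x) b"])
      fix t
      have "((\<lambda>t. w (t *\<^sub>R b + x)) has_derivative (\<lambda>r. D (t *\<^sub>R b + x) (r *\<^sub>R b))) (at t)"
        by (rule has_derivative_compose[OF _ D]) (auto intro!: derivative_eq_intros)
      then show "((\<lambda>t. w (t *\<^sub>R b + x)) has_derivative (\<lambda>r. r *\<^sub>R D (t *\<^sub>R b + x) b)) (at t within {0..h n})"
        by (simp add: has_derivative_at_withinI lin)
      show "onorm (\<lambda>r. r *\<^sub>R D (t *\<^sub>R b + x) b) \<le> B"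
      proof (rule onorm_le)
        fix r :: real
        show "norm (r *\<^sub>R D (t *\<^sub>R b + x) b) \<le> B * norm r"
          using mult_left_mono[OF B, of "\<bar>r\<bar>" "t *\<^sub>R b + x"] by (simp add: mult.commute)
      qed
    qed (use h(1)[of n] in auto)
    then show ?thesis using h(1)[of n] by simp
  qed
  have "(\<lambda>n. \<integral>x. s n x \<partial>lborel) \<longlonglongrightarrow> (\<integral>x. D x b \<partial>lborel)"
  proof (rule integral_dominated_convergence[where w = "\<lambda>x. B * indicator (cball (0::'a) (R + norm b)) x"])
    show "(\<lambda>x. D x b) \<in> borel_measurable lborel"
      using cont by (simp add: borel_measurable_continuous_onI)
    show "s n \<in> borel_measurable lborel" for n
    proof -
      have "integrable lborel (\<lambda>x. inverse (h n) *\<^sub>R (w (h n *\<^sub>R b + x) - w x))"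
        using it[of "h n *\<^sub>R b"] iw by (intro integrable_scaleR_right Bochner_Integration.integrable_diff)
      then show ?thesis
        unfolding s_def[abs_def] by (rule borel_measurable_integrable)
    qed
    show "integrable lborel (\<lambda>x. B * indicator (cball (0::'a) (R + norm b)) x)"
      using emeasure_bounded_finite[OF bounded_cball, of "0::'a" "R + norm b"]
      by (intro integrable_mult_right integrable_real_indicator) simp_all
    show "AE x in lborel. (\<lambda>n. s n x) \<longlonglongrightarrow> D x b"
    proof (rule AE_I2)
      fix x
      have "((\<lambda>t. w (t *\<^sub>R b + x)) has_derivative (\<lambda>r. D x (r *\<^sub>R b))) (at 0)"
      proof (rule has_derivative_compose[where f = "\<lambda>t. t *\<^sub>R b + x"])
        show "((\<lambda>t. t *\<^sub>R b + x) has_derivative (\<lambda>r. r *\<^sub>R b)) (at 0)"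
          by (auto intro!: derivative_eq_intros)
        show "(w has_derivative D x) (at (0 *\<^sub>R b + x))"
          using D[of x] by simp
      qed
      then have "((\<lambda>t. (w (t *\<^sub>R b + x) - w x - t *\<^sub>R D x b) /\<^sub>R norm t) \<longlongrightarrow> 0) (at 0)"
        by (simp add: has_derivative_at_within lin)
      moreover have "filterlim h (at 0) sequentially"
        unfolding filterlim_at h_def
        by (intro conjI always_eventually allI LIMSEQ_inverse_real_of_nat) auto
      ultimately have "(\<lambda>n. (w (h n *\<^sub>R b + x) - w x - h n *\<^sub>R D x b) /\<^sub>R norm (h n)) \<longlonglongrightarrow> 0"
        by (rule filterlim_compose)
      moreover have "(w (h n *\<^sub>R b + x) - w x - h n *\<^sub>R D x b) /\<^sub>R norm (h n) = s n x - D x b" for n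
        using h(1)[of n] by (simp add: s_def scaleR_diff_right)
      ultimately show "(\<lambda>n. s n x) \<longlonglongrightarrow> D x b"
        by (simp add: LIM_zero_iff)
    qed
    show "AE x in lborel. norm (s n x) \<le> B * indicator (cball (0::'a) (R + norm b)) x" for n
    proof (rule AE_I2)
      fix x
      show "norm (s n x) \<le> B * indicator (cball (0::'a) (R + norm b)) x"
      proof (cases "norm x \<le> R + norm b")
        case True
        then show ?thesis
          using lip[of n x] h(1)[of n]
          by (simp add: s_def divide_inverse_commute[symmetric] pos_divide_le_eq)
      next
        case False
        have "norm (h n *\<^sub>R b) \<le> norm b"
          using h[of n] by (simp add: mult_left_le_one_le)
        moreover have "norm x \<le> norm (h n *\<^sub>R b + x) + norm (h n *\<^sub>R b)"
          using norm_triangle_ineq4[of "h n *\<^sub>R b + x" "h n *\<^sub>R b"] by simp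
        ultimately have "R \<le> norm (h n *\<^sub>R b + x)" "R \<le> norm x"
          using False norm_ge_zero[of b] by linarith+
        then show ?thesis
          using supp B0 by (simp add: s_def)
      qed
    qed
  qed
  then show ?thesis
    by (simp add: s0 LIMSEQ_const_iff)
qed

lemma has_real_derivative_max_0_square:
  "((\<lambda>x::real. (max 0 x)\<^sup>2) has_real_derivative 2 * max 0 x) (at x)"
proof -
  consider "x > 0" | "x < 0" | "x = 0" by linarith
  then show ?thesis
  proof cases
    case 1
    have "((\<lambda>x::real. x\<^sup>2) has_real_derivative 2 * max 0 x) (at x)"
      using 1 by (auto intro!: derivative_eq_intros)
    then show ?thesis
      by (rule has_field_derivative_transform_within_open[where S = "{0<..}"]) (use 1 in auto)
  next
    case 2
    have "((\<lambda>x::real. 0) has_real_derivative 2 * max 0 x) (at x)"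
      using 2 by (auto intro!: derivative_eq_intros)
    then show ?thesis
      by (rule has_field_derivative_transform_within_open[where S = "{..<0}"]) (use 2 in auto)
  next
    case 3
    have "((\<lambda>y::real. (max 0 y)\<^sup>2 / y) \<longlongrightarrow> 0) (at 0)"
    proof (rule Lim_null_comparison)
      show "\<forall>\<^sub>F y in at 0. norm ((max 0 y)\<^sup>2 / y) \<le> \<bar>y\<bar>"
        by (intro always_eventually) (auto simp: max_def power2_eq_square)
      show "((\<lambda>y::real. \<bar>y\<bar>) \<longlongrightarrow> 0) (at 0)"
        by (intro tendsto_eq_intros) auto
    qed
    then show ?thesis
      using 3 by (simp add: has_field_derivative_iff)
  qed
qed

text \<open>A weight living on the shell 1 < r < 2. The square of the positive part is continuously
  differentiable, which suffices because Green's formula differentiates the weight once.\<close>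

definition cutoff :: "C2pt \<Rightarrow> real" where
  "cutoff y = (max 0 ((y \<bullet> y - 1) * (4 - y \<bullet> y)))\<^sup>2"

text \<open>The gradient of \<open>cutoff\<close> at \<open>y\<close> is \<open>cutoff' y\<close>
  times \<open>y\<close>: it is radial.\<close>

definition cutoff' :: "C2pt \<Rightarrow> real" where
  "cutoff' y = 4 * max 0 ((y \<bullet> y - 1) * (4 - y \<bullet> y)) * (5 - 2 * (y \<bullet> y))"

lemma has_derivative_cutoff: "(cutoff has_derivative (\<lambda>v. cutoff' y * (y \<bullet> v))) (at y)"
proof -
  have "((\<lambda>y. (y \<bullet> y - 1) * (4 - y \<bullet> y)) has_derivative (\<lambda>v. 2 * (5 - 2 * (y \<bullet> y)) * (y \<bullet> v))) (at y)"
    by (auto intro!: derivative_eq_intros simp: fun_eq_iff inner_commute algebra_simps)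
  from has_derivative_compose[OF this has_real_derivative_max_0_square[unfolded has_field_derivative_def]]
  show ?thesis
    unfolding cutoff_def[abs_def] by (rule has_derivative_eq_rhs) (simp add: cutoff'_def fun_eq_iff)
qed

lemma shell_neg:
  fixes y :: C2pt
  assumes "norm y \<le> 1 \<or> 2 \<le> norm y"
  shows "(y \<bullet> y - 1) * (4 - y \<bullet> y) \<le> 0"
proof -
  have "norm y ^ 2 \<le> 1 \<or> 4 \<le> norm y ^ 2"
    using assms power_mono[of "norm y" 1 2] power_mono[of 2 "norm y" 2] by auto
  moreover have "norm y ^ 2 \<ge> 0" by simp
  ultimately show ?thesis
    unfolding dot_square_norm by (auto simp: mult_le_0_iff)
qed

lemma cutoff_eq_0: "norm y \<le> 1 \<or> 2 \<le> norm y \<Longrightarrow> cutoff y = 0"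
  and cutoff'_eq_0: "norm y \<le> 1 \<or> 2 \<le> norm y \<Longrightarrow> cutoff' y = 0"
  using shell_neg[of y] by (auto simp: cutoff_def cutoff'_def)

lemma cutoff_nonneg: "cutoff y \<ge> 0"
  by (simp add: cutoff_def)

lemma cutoff_pos:
  assumes "1 < norm y" "norm y < 2"
  shows "cutoff y > 0"
proof -
  have "1 < norm y ^ 2" "norm y ^ 2 < 2 ^ 2"
    using assms power_strict_mono[of 1 "norm y" 2] power_strict_mono[of "norm y" 2 2] by auto
  then show ?thesis
    by (simp add: cutoff_def dot_square_norm max_def not_le)
qed

lemma continuous_cutoff: "continuous_on S cutoff" "continuous_on S cutoff'"
  unfolding cutoff_def[abs_def] cutoff'_def[abs_def] by (intro continuous_intros)+

text \<open>Degree-0 extensions are in general singular at the origin; the weight removes a whole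
  ball around it.\<close>

lemma continuous_on_cutoff_extend:
  fixes f :: "C2pt \<Rightarrow> complex"
  assumes "continuous_on (- {0}) f" "\<And>y. norm y \<le> 1 \<Longrightarrow> f y = 0"
  shows "continuous_on UNIV f"
proof -
  have "continuous_on (ball 0 1) f"
    using continuous_on_const[of "ball 0 1" 0] by (rule continuous_on_eq) (use assms in auto)
  then have "continuous_on (- {0} \<union> ball 0 1) f"
    using assms(1) by (intro continuous_on_open_Un) auto
  moreover have "- {0} \<union> ball 0 1 = (UNIV :: C2pt set)"
    by auto
  ultimately show ?thesis by simp
qed

text \<open>The field \<open>cutoff * (u grad v - v grad u)\<close> has compact support, so its
  divergence integrates to 0. In the divergence the mixed first-order terms cancel, the gradient of
  the weight meets only radial derivatives, which vanish, and what remains is \<nu> - \<mu> times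
  the integrand.\<close>

lemma green_orthogonality:
  assumes u: "has_jet u u1 u2 (- {0})" and v: "has_jet v v1 v2 (- {0})"
    and ru: "\<And>y. y \<noteq> 0 \<Longrightarrow> u1 y y = 0" and rv: "\<And>y. y \<noteq> 0 \<Longrightarrow> v1 y y = 0"
    and lu: "\<And>y. y \<noteq> 0 \<Longrightarrow> (\<Sum>b\<in>Basis. u2 y b b) = \<mu> * of_real (inverse (norm y) ^ 2) * u y"
    and lv: "\<And>y. y \<noteq> 0 \<Longrightarrow> (\<Sum>b\<in>Basis. v2 y b b) = \<nu> * of_real (inverse (norm y) ^ 2) * v y"
    and "\<mu> \<noteq> \<nu>"
  shows "(\<integral>y. of_real (cutoff y * inverse (norm y) ^ 2) * (u y * v y) \<partial>lborel) = 0"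
proof -
  define w where "w b y = of_real (cutoff y) * (u y * v1 y b - v y * u1 y b)" for b y
  define D where "D b y h = of_real (cutoff y) *
      ((u y * v2 y b h + u1 y h * v1 y b) - (v y * u2 y b h + v1 y h * u1 y b))
     + of_real (cutoff' y * (y \<bullet> h)) * (u y * v1 y b - v y * u1 y b)" for b y h
  have D: "(w b has_derivative D b y) (at y)" for b y
  proof (cases "y = 0")
    case True
    have "(w b has_derivative (\<lambda>_. 0)) (at y)"
    proof (rule has_derivative_transform_within_open)
      show "((\<lambda>_. 0) has_derivative (\<lambda>_. 0)) (at y)" by simp
      show "open (ball 0 1 :: C2pt set)" by simp
    qed (use True in \<open>auto simp: w_def cutoff_eq_0\<close>)
    moreover have "D b y = (\<lambda>_. 0)"
      using True by (simp add: D_def fun_eq_iff cutoff_eq_0)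
    ultimately show ?thesis by simp
  next
    case False
    then have y: "y \<in> - {0}" by simp
    show ?thesis
      unfolding w_def D_def
      by (intro has_derivative_mult has_derivative_diff has_derivative_of_real has_derivative_cutoff
          has_jetD(1,2)[OF u y] has_jetD(1,2)[OF v y])
  qed
  have cD: "continuous_on UNIV (\<lambda>y. D b y b)" for b
  proof (rule continuous_on_cutoff_extend)
    show "continuous_on (- {0}) (\<lambda>y. D b y b)"
      unfolding D_def
      by (intro continuous_intros continuous_cutoff has_jetD(3-5)[OF u] has_jetD(3-5)[OF v])
  qed (simp add: D_def cutoff_eq_0 cutoff'_eq_0)
  have int: "integrable lborel (\<lambda>y. D b y b)" for b
    using cD by (rule integrable_continuous_compact_support[where R = 2])
      (simp add: D_def cutoff_eq_0 cutoff'_eq_0)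
  have int0: "(\<integral>y. D b y b \<partial>lborel) = 0" for b
    using D cD by (rule integral_dirderiv_compact_support[where R = 2]) (simp add: w_def cutoff_eq_0)
  have sumD: "(\<Sum>b\<in>Basis. D b y b) = (\<nu> - \<mu>) * (of_real (cutoff y * inverse (norm y) ^ 2) * (u y * v y))" for y
  proof (cases "y = 0")
    case True
    then show ?thesis by (simp add: D_def cutoff_eq_0)
  next
    case False
    then have y: "y \<in> - {0}" by simp
    have "(\<Sum>b\<in>Basis. D b y b) = of_real (cutoff y) *
        (u y * (\<Sum>b\<in>Basis. v2 y b b) - v y * (\<Sum>b\<in>Basis. u2 y b b))
       + of_real (cutoff' y) * (u y * (\<Sum>b\<in>Basis. of_real (y \<bullet> b) * v1 y b)
            - v y * (\<Sum>b\<in>Basis. of_real (y \<bullet> b) * u1 y b))"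
      unfolding D_def sum_Basis_C2 by (simp add: algebra_simps)
    also have "(\<Sum>b\<in>Basis. of_real (y \<bullet> b) * v1 y b) = 0"
      using inner_Basis_sum_deriv[OF has_derivative_linear[OF has_jetD(1)[OF v y]]] rv False by simp
    also have "(\<Sum>b\<in>Basis. of_real (y \<bullet> b) * u1 y b) = 0"
      using inner_Basis_sum_deriv[OF has_derivative_linear[OF has_jetD(1)[OF u y]]] ru False by simp
    finally show ?thesis
      using False by (simp add: lu lv algebra_simps)
  qed
  have "0 = (\<Sum>b\<in>Basis. \<integral>y. D b y b \<partial>lborel)"
    by (simp add: int0)
  also have "\<dots> = (\<integral>y. (\<Sum>b\<in>Basis. D b y b) \<partial>lborel)"
    by (rule Bochner_Integration.integral_sum[symmetric]) (rule int)
  also have "\<dots> = (\<nu> - \<mu>) * (\<integral>y. of_real (cutoff y * inverse (norm y) ^ 2) * (u y * v y) \<partial>lborel)"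
    unfolding sumD by (rule integral_mult_right_zero)
  finally show ?thesis
    using assms(7) by simp
qed

subsection \<open>Laplace eigenfunctions on the sphere\<close>

definition eigenfun :: "nat \<Rightarrow> (C2pt \<Rightarrow> complex) \<Rightarrow> bool" where
  "eigenfun k F \<longleftrightarrow> C2_on (- {0}) (ext0 F) \<and> (\<forall>x\<in>S3. lapS3 F x = - of_nat (k * (k + 2)) * F x)"

lemma ext0_scaleR: "r > 0 \<Longrightarrow> ext0 F (r *\<^sub>R y) = ext0 F y"
  by (simp add: ext0_def field_simps)

lemma ext0_S3: "x \<in> S3 \<Longrightarrow> ext0 F x = F x"
  by (simp add: ext0_def S3_iff_norm)

text \<open>The extension is homogeneous of degree 0, so its first and second derivatives have
  degrees -1 and -2. This carries the equation from the sphere along each ray, at the price of the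
  factor r^(-2), and makes the radial derivative vanish.\<close>

lemma eigenfun_radial_jet:
  assumes "eigenfun k F"
  obtains u1 u2 where "has_jet (ext0 F) u1 u2 (- {0})" "\<And>y. y \<noteq> 0 \<Longrightarrow> u1 y y = 0"
    "\<And>y. y \<noteq> 0 \<Longrightarrow> (\<Sum>b\<in>Basis. u2 y b b) = - of_nat (k * (k + 2)) * of_real (inverse (norm y) ^ 2) * ext0 F y"
proof -
  obtain u1 u2 where J: "has_jet (ext0 F) u1 u2 (- {0})"
    using assms unfolding eigenfun_def C2_on_iff_jet by blast
  note o = open_Compl[OF closed_singleton]
  have scl: "((\<lambda>z::C2pt. r *\<^sub>R z) has_derivative (\<lambda>h. r *\<^sub>R h)) (at y)" for r y
    by (auto intro!: derivative_eq_intros)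
  have s1: "u1 (r *\<^sub>R y) v = u1 y v / of_real r" if "r > 0" "y \<noteq> 0" for r y v
  proof -
    have "(ext0 F has_derivative (\<lambda>h. u1 (r *\<^sub>R y) (r *\<^sub>R h))) (at y)"
      using has_derivative_compose[OF scl has_jetD(1)[OF J, of "r *\<^sub>R y"]] that
      by (simp add: ext0_scaleR)
    from fun_cong[OF has_derivative_unique[OF this has_jetD(1)[OF J]], of v] that
    have "u1 (r *\<^sub>R y) (r *\<^sub>R v) = u1 y v" by simp
    moreover have "u1 (r *\<^sub>R y) (r *\<^sub>R v) = r *\<^sub>R u1 (r *\<^sub>R y) v"
      using that by (intro linear_scale has_derivative_linear[OF has_jetD(1)[OF J]]) auto
    ultimately show ?thesis
      using that by (simp add: scaleR_conv_of_real field_simps)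
  qed
  have s2: "u2 (r *\<^sub>R y) v w = of_real (inverse r ^ 2) * u2 y v w" if "r > 0" "y \<noteq> 0" for r y v w
  proof -
    have "((\<lambda>z. u1 (r *\<^sub>R z) v) has_derivative (\<lambda>h. u2 (r *\<^sub>R y) v (r *\<^sub>R h))) (at y)"
      using has_derivative_compose[OF scl has_jetD(2)[OF J, of "r *\<^sub>R y"]] that by simp
    then have "((\<lambda>z. u1 z v / of_real r) has_derivative (\<lambda>h. u2 (r *\<^sub>R y) v (r *\<^sub>R h))) (at y)"
    proof (rule has_derivative_transform_within_open[OF _ o])
      show "u1 (r *\<^sub>R z) v = u1 z v / of_real r" if "z \<in> - {0}" for z
        using s1[OF \<open>r > 0\<close>, of z v] that by simp
    qed (use that in simp)
    moreover have "((\<lambda>z. u1 z v / of_real r) has_derivative (\<lambda>h. u2 y v h / of_real r)) (at y)"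
      using has_derivative_mult_right[OF has_jetD(2)[OF J, of y], of "inverse (of_real r)" v] that
      by (simp add: field_simps)
    ultimately have "u2 (r *\<^sub>R y) v (r *\<^sub>R w) = u2 y v w / of_real r"
      using has_derivative_unique by (metis (no_types, lifting))
    moreover have "u2 (r *\<^sub>R y) v (r *\<^sub>R w) = r *\<^sub>R u2 (r *\<^sub>R y) v w"
      using that by (intro linear_scale has_derivative_linear[OF has_jetD(2)[OF J]]) auto
    ultimately show ?thesis
      using that by (simp add: scaleR_conv_of_real field_simps power2_eq_square)
  qed
  have r0: "u1 y y = 0" if "y \<noteq> 0" for y
  proof -
    have "((\<lambda>t::real. ext0 F (t *\<^sub>R y)) has_derivative (\<lambda>t. u1 (1 *\<^sub>R y) (t *\<^sub>R y))) (at 1)"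
      by (rule has_derivative_compose[OF _ has_jetD(1)[OF J]]) (use that in \<open>auto intro!: derivative_eq_intros\<close>)
    moreover have "((\<lambda>t::real. ext0 F (t *\<^sub>R y)) has_derivative (\<lambda>t. 0)) (at 1)"
      by (rule has_derivative_transform_within_open[of "\<lambda>t. ext0 F y" _ _ _ "{0<..}"]) (auto simp: ext0_scaleR)
    ultimately have "u1 (1 *\<^sub>R y) (1 *\<^sub>R y) = 0"
      using has_derivative_unique by (metis (no_types, lifting))
    then show ?thesis by simp
  qed
  have lap: "(\<Sum>b\<in>Basis. u2 y b b) = - of_nat (k * (k + 2)) * of_real (inverse (norm y) ^ 2) * ext0 F y"
    if "y \<noteq> 0" for y
  proof -
    define x where "x = inverse (norm y) *\<^sub>R y"
    have x: "x \<in> S3" "x \<noteq> 0" and y: "y = norm y *\<^sub>R x"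
      using that normalize_in_S3[OF that] by (auto simp: x_def)
    have "(\<Sum>b\<in>Basis. u2 x b b) = lapS3 F x"
      unfolding lapS3_def by (rule lapR4_eq_jet[OF J o, symmetric]) (use x in simp)
    also have "\<dots> = - of_nat (k * (k + 2)) * F x"
      using assms x by (simp add: eigenfun_def)
    finally have "(\<Sum>b\<in>Basis. u2 x b b) = - of_nat (k * (k + 2)) * ext0 F y"
      by (simp add: ext0_def x_def)
    moreover have "(\<Sum>b\<in>Basis. u2 y b b) = of_real (inverse (norm y) ^ 2) * (\<Sum>b\<in>Basis. u2 x b b)"
      using that x unfolding sum_distrib_left
      by (subst (1) y) (simp add: s2)
    ultimately show ?thesis by simp
  qed
  show ?thesis
    using that J r0 lap by blast
qed

text \<open>Integrating degree-0 extensions over a shell in \<open>\<real>\<^sup>4\<close> with a radial weight replaces the surface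
  measure of the sphere; the weight \<open>1 / norm y ^ 2\<close> absorbs the homogeneity of the Laplacian.\<close>

definition ip :: "(C2pt \<Rightarrow> complex) \<Rightarrow> (C2pt \<Rightarrow> complex) \<Rightarrow> complex" where
  "ip F G = (\<integral>y. of_real (cutoff y * inverse (norm y) ^ 2) * (ext0 F y * cnj (ext0 G y)) \<partial>lborel)"

text \<open>k(k+2) is strictly increasing, so the eigenvalues differ; they are real, so the
  conjugate of \<open>G\<close> solves the same equation as \<open>G\<close>.\<close>

lemma ip_eigenfun_orthogonal:
  assumes "eigenfun k F" "eigenfun l G" "k \<noteq> l"
  shows "ip F G = 0"
proof -
  obtain u1 u2 where u: "has_jet (ext0 F) u1 u2 (- {0})" "\<And>y. y \<noteq> 0 \<Longrightarrow> u1 y y = 0"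
    "\<And>y. y \<noteq> 0 \<Longrightarrow> (\<Sum>b\<in>Basis. u2 y b b) = - of_nat (k * (k + 2)) * of_real (inverse (norm y) ^ 2) * ext0 F y"
    using eigenfun_radial_jet[OF assms(1)] by blast
  obtain v1 v2 where v: "has_jet (ext0 G) v1 v2 (- {0})" "\<And>y. y \<noteq> 0 \<Longrightarrow> v1 y y = 0"
    "\<And>y. y \<noteq> 0 \<Longrightarrow> (\<Sum>b\<in>Basis. v2 y b b) = - of_nat (l * (l + 2)) * of_real (inverse (norm y) ^ 2) * ext0 G y"
    using eigenfun_radial_jet[OF assms(2)] by blast
  have "m * (m + 2) < n * (n + 2)" if "m < n" for m n :: nat
    using that by (intro mult_strict_mono) auto
  then have "k * (k + 2) \<noteq> l * (l + 2)"
    using assms(3) by (metis less_irrefl nat_neq_iff)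
  then have ne: "- of_nat (k * (k + 2)) \<noteq> (- of_nat (l * (l + 2)) :: complex)"
    by (metis neg_equal_iff_equal of_nat_eq_iff)
  have lv: "(\<Sum>b\<in>Basis. cnj (v2 y b b)) = - of_nat (l * (l + 2)) * of_real (inverse (norm y) ^ 2) * cnj (ext0 G y)"
    if "y \<noteq> 0" for y
    using arg_cong[OF v(3)[OF that], of cnj] by simp
  show ?thesis
    unfolding ip_def
    by (rule green_orthogonality[OF u(1) has_jet_cnj[OF v(1)] u(2) _ u(3) lv ne]) (simp_all add: v(2))
qed

lemma eigenfun_wig: "eigenfun (a + b) (restrS3 (wig a b j))"
  using C2_on_ext0_wig[of a b j] lapS3_wig[of _ a b j] by (simp add: eigenfun_def restrS3_def)

lemma continuous_on_ext0:
  assumes "continuous_on S3 F"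
  shows "continuous_on (- {0}) (ext0 F)"
  unfolding ext0_def[abs_def]
proof (rule continuous_on_compose2[OF assms])
  show "continuous_on (- {0}) (\<lambda>y::C2pt. inverse (norm y) *\<^sub>R y)"
    by (intro continuous_intros) simp
qed (use normalize_in_S3 in blast)

lemma eigenfun_continuous:
  assumes "eigenfun k F"
  shows "continuous_on S3 F"
proof -
  have "continuous_on (- {0}) (ext0 F)"
    using assms has_jetD(5) unfolding eigenfun_def C2_on_iff_jet by blast
  then have "continuous_on S3 (ext0 F)"
    by (rule continuous_on_subset) (auto simp: S3_iff_norm)
  then show ?thesis
    by (rule continuous_on_eq) (simp add: ext0_S3)
qed

lemma integrable_ip:
  assumes "continuous_on S3 F" "continuous_on S3 G"
  shows "integrable lborel (\<lambda>y. of_real (cutoff y * inverse (norm y) ^ 2) * (ext0 F y * cnj (ext0 G y)))"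
proof (rule integrable_continuous_compact_support[where R = 2])
  show "continuous_on UNIV (\<lambda>y. of_real (cutoff y * inverse (norm y) ^ 2) * (ext0 F y * cnj (ext0 G y)))"
  proof (rule continuous_on_cutoff_extend)
    show "continuous_on (- {0}) (\<lambda>y. of_real (cutoff y * inverse (norm y) ^ 2) * (ext0 F y * cnj (ext0 G y)))"
      by (intro continuous_intros continuous_cutoff continuous_on_ext0 assms) auto
  qed (simp add: cutoff_eq_0)
qed (simp add: cutoff_eq_0)

lemma ip_add:
  assumes "continuous_on S3 F" "continuous_on S3 F'" "continuous_on S3 G"
  shows "ip (\<lambda>x. F x + F' x) G = ip F G + ip F' G"
proof -
  have "ip (\<lambda>x. F x + F' x) G = (\<integral>y. of_real (cutoff y * inverse (norm y) ^ 2) * (ext0 F y * cnj (ext0 G y))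
      + of_real (cutoff y * inverse (norm y) ^ 2) * (ext0 F' y * cnj (ext0 G y)) \<partial>lborel)"
    unfolding ip_def by (simp add: ext0_def algebra_simps)
  then show ?thesis
    unfolding ip_def using integrable_ip assms by simp
qed

lemma ip_scale: "ip (\<lambda>x. c * F x) G = c * ip F G"
proof -
  have "ip (\<lambda>x. c * F x) G = (\<integral>y. c * (of_real (cutoff y * inverse (norm y) ^ 2) * (ext0 F y * cnj (ext0 G y))) \<partial>lborel)"
    unfolding ip_def by (simp add: ext0_def algebra_simps)
  then show ?thesis
    unfolding ip_def by (simp only: integral_mult_right_zero)
qed

lemma ip_cnj: "cnj (ip F G) = ip G F"
proof -
  have "cnj (ip F G) = (\<integral>y. cnj (of_real (cutoff y * inverse (norm y) ^ 2) * (ext0 F y * cnj (ext0 G y))) \<partial>lborel)"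
    unfolding ip_def by (rule Bochner_Integration.integral_cnj[symmetric])
  also have "\<dots> = ip G F"
    unfolding ip_def by (rule Bochner_Integration.integral_cong[OF refl]) (simp add: mult.commute)
  finally show ?thesis .
qed

lemma ip_cong:
  assumes "\<And>x. x \<in> S3 \<Longrightarrow> F x = F' x" "\<And>x. x \<in> S3 \<Longrightarrow> G x = G' x"
  shows "ip F G = ip F' G'"
  unfolding ip_def
proof (rule Bochner_Integration.integral_cong[OF refl])
  fix y
  show "of_real (cutoff y * inverse (norm y) ^ 2) * (ext0 F y * cnj (ext0 G y)) =
        of_real (cutoff y * inverse (norm y) ^ 2) * (ext0 F' y * cnj (ext0 G' y))"
    using assms normalize_in_S3[of y] by (cases "y = 0") (auto simp: ext0_def cutoff_eq_0)
qed

text \<open>Continuity of \<open>ip\<close> in the uniform norm, as required by uniform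
  approximation. The constant is the total mass of the weight on the shell.\<close>

lemma ip_bound:
  obtains C where "C \<ge> 0" "\<And>F G M \<epsilon>. continuous_on S3 F \<Longrightarrow> continuous_on S3 G \<Longrightarrow>
     (\<And>x. x \<in> S3 \<Longrightarrow> cmod (F x) \<le> M) \<Longrightarrow> (\<And>x. x \<in> S3 \<Longrightarrow> cmod (G x) \<le> \<epsilon>) \<Longrightarrow> cmod (ip F G) \<le> C * (M * \<epsilon>)"
proof -
  let ?r = "\<lambda>y. cutoff y * inverse (norm y) ^ 2"
  have "integrable lborel (\<lambda>y. of_real (?r y) * (ext0 (\<lambda>_. 1) y * cnj (ext0 (\<lambda>_. 1) y)))"
    by (rule integrable_ip) auto
  then have "integrable lborel (\<lambda>y. norm (complex_of_real (?r y)))"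
    by (intro integrable_norm) (simp add: ext0_def)
  then have ir: "integrable lborel ?r"
    unfolding norm_of_real using cutoff_nonneg by (simp add: abs_mult)
  define C where "C = (\<integral>y. ?r y \<partial>lborel)"
  have r0: "?r y \<ge> 0" for y using cutoff_nonneg by simp
  have C0: "C \<ge> 0"
    unfolding C_def using r0 by (intro Bochner_Integration.integral_nonneg) auto
  show ?thesis
  proof
    show "C \<ge> 0" by fact
    fix F G :: "C2pt \<Rightarrow> complex" and M \<epsilon> :: real
    assume c: "continuous_on S3 F" "continuous_on S3 G"
      and M: "\<And>x. x \<in> S3 \<Longrightarrow> cmod (F x) \<le> M" and e: "\<And>x. x \<in> S3 \<Longrightarrow> cmod (G x) \<le> \<epsilon>"
    have pt: "cmod (of_real (?r y) * (ext0 F y * cnj (ext0 G y))) \<le> ?r y * (M * \<epsilon>)" for y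
    proof (cases "y = 0")
      case False
      have "cmod (ext0 F y * cnj (ext0 G y)) \<le> M * \<epsilon>"
        unfolding norm_mult complex_mod_cnj ext0_def
        using M[OF normalize_in_S3[OF False]] e[OF normalize_in_S3[OF False]] norm_ge_zero
        by (intro mult_mono) (auto intro: order_trans[OF norm_ge_zero])
      then show ?thesis
        unfolding norm_mult[of "of_real (?r y)"] norm_of_real using r0[of y]
        by (simp add: mult_left_mono del: norm_mult)
    qed (simp add: cutoff_eq_0)
    have "cmod (ip F G) \<le> (\<integral>y. cmod (of_real (?r y) * (ext0 F y * cnj (ext0 G y))) \<partial>lborel)"
      unfolding ip_def by (rule integral_norm_bound)
    also have "\<dots> \<le> (\<integral>y. ?r y * (M * \<epsilon>) \<partial>lborel)"
      using pt ir integrable_ip[OF c] by (intro integral_mono integrable_norm) auto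
    also have "\<dots> = C * (M * \<epsilon>)"
      by (simp add: C_def)
    finally show "cmod (ip F G) \<le> C * (M * \<epsilon>)" .
  qed
qed

lemma ip_self_eq_0:
  assumes c: "continuous_on S3 F" and 0: "ip F F = 0" and x: "x \<in> S3"
  shows "F x = 0"
proof (rule ccontr)
  assume nz: "F x \<noteq> 0"
  let ?g = "\<lambda>y. cutoff y * inverse (norm y) ^ 2 * (cmod (ext0 F y))\<^sup>2"
  have eq: "of_real (cutoff y * inverse (norm y) ^ 2) * (ext0 F y * cnj (ext0 F y)) = complex_of_real (?g y)" for y
    by (simp only: complex_norm_square[symmetric] of_real_power[symmetric] of_real_mult[symmetric])
  have int: "integrable lborel (\<lambda>y. complex_of_real (?g y))"
    using integrable_ip[OF c c] unfolding eq .
  have int': "integrable lborel ?g"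
    using integrable_Re[OF int] by (simp only: Re_complex_of_real)
  have "complex_of_real (\<integral>y. ?g y \<partial>lborel) = 0"
    using 0 unfolding ip_def eq by (simp only: integral_complex_of_real)
  then have "(\<integral>y. ?g y \<partial>lborel) = 0" by (simp only: of_real_eq_0_iff)
  then have ae: "AE y in lborel. ?g y = 0"
    using integral_nonneg_eq_0_iff_AE[OF int'] cutoff_nonneg by simp
  define U where "U = (- {0} \<inter> ext0 F -` (- {0})) \<inter> {y. 1 < norm y \<and> norm y < 2}"
  have gU: "y \<in> U \<Longrightarrow> ?g y \<noteq> 0" for y
    using cutoff_pos[of y] by (auto simp: U_def)
  have AE: "AE y in lborel. y \<notin> U"
    using ae by (rule eventually_mono) (use gU in blast)
  have "open (- {0} \<inter> ext0 F -` (- {0}))"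
    by (intro continuous_open_preimage continuous_on_ext0 c open_Compl closed_singleton)
  moreover have "open {y :: C2pt. 1 < norm y \<and> norm y < 2}"
    by (intro open_Collect_conj open_Collect_less continuous_intros)
  ultimately have oU: "open U"
    unfolding U_def by (rule open_Int)
  \<comment> \<open>The extension is constant on rays, so a nonzero value at \<open>x\<close>
    persists inside the shell; 3/2 is a radius strictly between 1 and 2.\<close>
  have "(3 / 2) *\<^sub>R x \<in> U"
    using x nz by (auto simp: U_def S3_iff_norm ext0_scaleR ext0_S3)
  then have "U \<noteq> {}" by auto
  moreover have "U \<in> null_sets lborel"
    using AE oU by (subst AE_iff_null_sets) auto
  ultimately show False
    using open_not_negligible[OF oU] null_sets_completionI unfolding negligible_iff_null_sets by blast
qed

subsection \<open>Density of the matrix coefficients\<close>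

text \<open>The rule \<open>cong\<close> identifies functions that agree on the sphere: the
  identities for multiplication by conjugate coordinates hold only there.\<close>

inductive_set wspan :: "(C2pt \<Rightarrow> complex) set" where
  wig: "wig a b j \<in> wspan"
| add: "f \<in> wspan \<Longrightarrow> g \<in> wspan \<Longrightarrow> (\<lambda>x. f x + g x) \<in> wspan"
| scale: "f \<in> wspan \<Longrightarrow> (\<lambda>x. c * f x) \<in> wspan"
| cong: "f \<in> wspan \<Longrightarrow> (\<forall>x\<in>S3. f x = g x) \<Longrightarrow> g \<in> wspan"

text \<open>These functions form an algebra. Once it contains the coordinates and their conjugates
  it contains all polynomials, and applying them to the constant \<open>wig 0 0 0\<close> places
  them in \<open>wspan\<close>.\<close>

definition multiplier :: "(C2pt \<Rightarrow> complex) \<Rightarrow> bool" where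
  "multiplier m \<longleftrightarrow> (\<forall>f\<in>wspan. (\<lambda>x. m x * f x) \<in> wspan)"

lemma multiplierI:
  assumes "\<And>a b j. (\<lambda>x. m x * wig a b j x) \<in> wspan"
  shows "multiplier m"
  unfolding multiplier_def
proof
  fix f assume "f \<in> wspan"
  then show "(\<lambda>x. m x * f x) \<in> wspan"
  proof induction
    case (wig a b j)
    then show ?case by (rule assms)
  next
    case (add f g)
    from wspan.add[OF add.IH] show ?case by (simp add: distrib_left)
  next
    case (scale f c)
    from wspan.scale[OF scale.IH, of c] show ?case by (simp add: mult.left_commute)
  next
    case (cong f g)
    from cong.IH cong.hyps show ?case by (elim wspan.cong) simp
  qed
qed

lemma multiplier_add: "multiplier f \<Longrightarrow> multiplier g \<Longrightarrow> multiplier (\<lambda>x. f x + g x)"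
  unfolding multiplier_def by (auto simp: distrib_right intro: wspan.add)

lemma multiplier_mult: "multiplier f \<Longrightarrow> multiplier g \<Longrightarrow> multiplier (\<lambda>x. f x * g x)"
  unfolding multiplier_def by (auto simp: mult.assoc)

lemma multiplier_const: "multiplier (\<lambda>x. c)"
  unfolding multiplier_def by (auto intro: wspan.scale)

lemma S3_cnj: "p \<in> S3 \<Longrightarrow> cnj (fst p) * fst p + cnj (snd p) * snd p = 1"
proof -
  assume "p \<in> S3"
  then have "complex_of_real ((cmod (fst p))^2 + (cmod (snd p))^2) = 1"
    by (simp add: S3_def)
  then show ?thesis
    by (simp only: of_real_add complex_norm_square mult.commute)
qed

lemma xi_eta_unit: "p \<in> S3 \<Longrightarrow> [:cnj (fst p):] * xi p + [:cnj (snd p):] * eta p = 1"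
  using S3_cnj[of p] by (simp add: xi_def eta_def one_pCons algebra_simps)

lemma PE_Suc: "PE (Suc a) b p = xi p * PE a b p" "PE a (Suc b) p = eta p * PE a b p"
  by (simp_all add: PE_def mult_ac)

text \<open>Both identities combine the Leibniz rule for the parameter derivative of
  \<open>xi ^ a * eta ^ b\<close> with \<open>cnj \<alpha> * xi + cnj \<beta> * eta = 1\<close>.\<close>

lemma cnj_snd_wig:
  assumes "p \<in> S3"
  shows "of_nat (a + b + 1) * (cnj (snd p) * wig a b j p)
    = of_nat b * wig a (b - 1) j p - of_nat (Suc j) * wig (Suc a) b (Suc j) p"
proof -
  let ?A = "[:cnj (fst p):]" and ?B = "[:cnj (snd p):]"
  have d: "pderiv (PE (Suc a) b p) = ?A * (of_nat b * PE (Suc a) (b - 1) p) - ?B * (of_nat (Suc a) * PE a b p)"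
    by (simp add: pderiv_PE)
  have "of_nat b * PE a (b - 1) p = of_nat b * ((?A * xi p + ?B * eta p) * PE a (b - 1) p)"
    using xi_eta_unit[OF assms] by simp
  also have "\<dots> = of_nat b * (?A * PE (Suc a) (b - 1) p) + of_nat b * (?B * PE a b p)"
    by (cases b) (simp_all add: PE_Suc distrib_left distrib_right mult_ac)
  finally have "of_nat (a + b + 1) * (?B * PE a b p) = of_nat b * PE a (b - 1) p - pderiv (PE (Suc a) b p)"
    unfolding d by (simp add: algebra_simps smult_add_right)
  from arg_cong[OF this, of "\<lambda>P. coeff P j"] show ?thesis
    by (simp add: wig_def coeff_pderiv of_nat_poly mult_ac)
qed

lemma cnj_fst_wig:
  assumes "p \<in> S3"
  shows "of_nat (a + b + 1) * (cnj (fst p) * wig a b j p)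
    = of_nat a * wig (a - 1) b j p + of_nat (Suc j) * wig a (Suc b) (Suc j) p"
proof -
  let ?A = "[:cnj (fst p):]" and ?B = "[:cnj (snd p):]"
  have d: "pderiv (PE a (Suc b) p) = ?A * (of_nat (Suc b) * PE a b p) - ?B * (of_nat a * PE (a - 1) (Suc b) p)"
    by (simp add: pderiv_PE)
  have "of_nat a * PE (a - 1) b p = of_nat a * ((?A * xi p + ?B * eta p) * PE (a - 1) b p)"
    using xi_eta_unit[OF assms] by simp
  also have "\<dots> = of_nat a * (?A * PE a b p) + of_nat a * (?B * PE (a - 1) (Suc b) p)"
    by (cases a) (simp_all add: PE_Suc distrib_left distrib_right mult_ac)
  finally have "of_nat (a + b + 1) * (?A * PE a b p) = of_nat a * PE (a - 1) b p + pderiv (PE a (Suc b) p)"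
    unfolding d by (simp add: algebra_simps smult_add_right)
  from arg_cong[OF this, of "\<lambda>P. coeff P j"] show ?thesis
    by (simp add: wig_def coeff_pderiv of_nat_poly mult_ac)
qed

lemma wig_Suc:
  "wig (Suc a) b 0 p = fst p * wig a b 0 p"
  "wig (Suc a) b (Suc j) p = fst p * wig a b (Suc j) p - cnj (snd p) * wig a b j p"
  "wig a (Suc b) 0 p = snd p * wig a b 0 p"
  "wig a (Suc b) (Suc j) p = snd p * wig a b (Suc j) p + cnj (fst p) * wig a b j p"
  by (simp_all add: wig_def PE_Suc xi_def eta_def)

text \<open>The conjugate coordinates come first: solving \<open>wig_Suc\<close> for
  \<open>fst p\<close> or \<open>snd p\<close> times a coefficient leaves a conjugate coordinate
  times another coefficient.\<close>

lemma multiplier_coordinates: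
  "multiplier (\<lambda>p. cnj (snd p))" "multiplier (\<lambda>p. cnj (fst p))"
  "multiplier fst" "multiplier snd"
proof -
  have B: "(\<lambda>x. cnj (snd x) * wig a b j x) \<in> wspan" for a b j
  proof (rule wspan.cong)
    show "(\<lambda>x. (of_nat b / of_nat (a + b + 1)) * wig a (b - 1) j x
        + (- of_nat (Suc j) / of_nat (a + b + 1)) * wig (Suc a) b (Suc j) x) \<in> wspan"
      by (rule wspan.add[OF wspan.scale[OF wspan.wig] wspan.scale[OF wspan.wig]])
    have "of_nat (a + b + 1) \<noteq> (0::complex)" by (metis of_nat_eq_0_iff add_is_0 one_neq_zero)
    then show "\<forall>x\<in>S3. (of_nat b / of_nat (a + b + 1)) * wig a (b - 1) j x
        + (- of_nat (Suc j) / of_nat (a + b + 1)) * wig (Suc a) b (Suc j) x = cnj (snd x) * wig a b j x"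
      using cnj_snd_wig[of _ a b j] by (auto simp: divide_simps mult_ac simp del: of_nat_Suc of_nat_add)
  qed
  have A: "(\<lambda>x. cnj (fst x) * wig a b j x) \<in> wspan" for a b j
  proof (rule wspan.cong)
    show "(\<lambda>x. (of_nat a / of_nat (a + b + 1)) * wig (a - 1) b j x
        + (of_nat (Suc j) / of_nat (a + b + 1)) * wig a (Suc b) (Suc j) x) \<in> wspan"
      by (rule wspan.add[OF wspan.scale[OF wspan.wig] wspan.scale[OF wspan.wig]])
    have "of_nat (a + b + 1) \<noteq> (0::complex)" by (metis of_nat_eq_0_iff add_is_0 one_neq_zero)
    then show "\<forall>x\<in>S3. (of_nat a / of_nat (a + b + 1)) * wig (a - 1) b j x
        + (of_nat (Suc j) / of_nat (a + b + 1)) * wig a (Suc b) (Suc j) x = cnj (fst x) * wig a b j x"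
      using cnj_fst_wig[of _ a b j] by (auto simp: divide_simps mult_ac simp del: of_nat_Suc of_nat_add)
  qed
  show "multiplier (\<lambda>p. cnj (snd p))" "multiplier (\<lambda>p. cnj (fst p))"
    using A B by (auto intro: multiplierI)
  show "multiplier fst"
  proof (rule multiplierI)
    fix a b j
    show "(\<lambda>x. fst x * wig a b j x) \<in> wspan"
    proof (cases j)
      case 0
      then show ?thesis
        using wspan.wig[of "Suc a" b 0] by (simp add: wig_Suc(1)[abs_def])
    next
      case (Suc i)
      have "(\<lambda>x. wig (Suc a) b (Suc i) x + cnj (snd x) * wig a b i x) \<in> wspan"
        by (intro wspan.add wspan.wig B)
      then show ?thesis using Suc by (simp add: wig_Suc)
    qed
  qed
  show "multiplier snd"
  proof (rule multiplierI)
    fix a b j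
    show "(\<lambda>x. snd x * wig a b j x) \<in> wspan"
    proof (cases j)
      case 0
      then show ?thesis
        using wspan.wig[of a "Suc b" 0] by (simp add: wig_Suc(3)[abs_def])
    next
      case (Suc i)
      have "(\<lambda>x. wig a (Suc b) (Suc i) x + (- 1) * (cnj (fst x) * wig a b i x)) \<in> wspan"
        by (rule wspan.add[OF wspan.wig wspan.scale[OF A]])
      then show ?thesis using Suc by (simp add: wig_Suc)
    qed
  qed
qed

lemma multiplier_real_polynomial:
  fixes f :: "C2pt \<Rightarrow> real"
  assumes "real_polynomial_function f"
  shows "multiplier (\<lambda>x. of_real (f x))"
  using assms
proof induction
  case (linear f)
  have rep: "f x = (\<Sum>b\<in>Basis. (x \<bullet> b) * f b)" for x
  proof -
    have "f x = f (\<Sum>b\<in>Basis. (x \<bullet> b) *\<^sub>R b)"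
      by (simp add: euclidean_representation)
    also have "\<dots> = (\<Sum>b\<in>Basis. (x \<bullet> b) * f b)"
      using bounded_linear.linear[OF linear] by (simp add: linear_sum linear_scale)
    finally show ?thesis .
  qed
  have f: "f x = Re (fst x) * f (1,0) + Im (fst x) * f (\<i>,0) + Re (snd x) * f (0,1) + Im (snd x) * f (0,\<i>)" for x
    by (subst rep) (simp add: sum_Basis_C2 inner_prod_def)
  have coord: "z + cnj z = 2 * of_real (Re z)" "z + - 1 * cnj z = 2 * \<i> * of_real (Im z)" for z
    by (simp_all add: complex_eq_iff)
  have eq: "(\<lambda>x. complex_of_real (f x)) = (\<lambda>x. of_real (f (1,0)) / 2 * (fst x + cnj (fst x))
     + (of_real (f (\<i>,0)) / (2 * \<i>) * (fst x + - 1 * cnj (fst x))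
     + (of_real (f (0,1)) / 2 * (snd x + cnj (snd x))
     + of_real (f (0,\<i>)) / (2 * \<i>) * (snd x + - 1 * cnj (snd x)))))"
    unfolding coord by (rule ext, subst f) (simp add: complex_eq_iff)
  show ?case
    by (subst eq) (intro multiplier_add multiplier_mult multiplier_const multiplier_coordinates)
next
  case (const c)
  then show ?case by (rule multiplier_const)
next
  case (add f g)
  then show ?case by (simp add: multiplier_add)
next
  case (mult f g)
  then show ?case by (simp add: multiplier_mult)
qed

lemma polynomial_in_wspan:
  fixes g :: "C2pt \<Rightarrow> complex"
  assumes "polynomial_function g"
  shows "g \<in> wspan"
proof -
  have "real_polynomial_function (Re \<circ> g)" "real_polynomial_function (Im \<circ> g)"
    using assms bounded_linear_Re bounded_linear_Im unfolding polynomial_function_def by blast+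
  then have "multiplier (\<lambda>x. of_real (Re (g x)) + \<i> * of_real (Im (g x)))"
    using multiplier_real_polynomial
    by (intro multiplier_add multiplier_mult multiplier_const) fastforce+
  then have "multiplier g" by (simp flip: complex_eq)
  moreover have "wig 0 0 0 = (\<lambda>_. 1)"
    by (simp add: wig_def PE_def fun_eq_iff)
  ultimately show ?thesis
    using wspan.wig[of 0 0 0] unfolding multiplier_def by fastforce
qed

subsection \<open>Completeness\<close>

lemma continuous_sum_scale:
  "(\<And>i. i \<in> A \<Longrightarrow> continuous_on S (\<phi> i)) \<Longrightarrow> continuous_on S (\<lambda>x. \<Sum>i\<in>A. c i * \<phi> i x :: complex)"
  by (intro continuous_intros)

lemma ip_sum:
  assumes "\<And>i. i \<in> A \<Longrightarrow> continuous_on S3 (\<phi> i)" "continuous_on S3 G"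
  shows "ip (\<lambda>x. \<Sum>i\<in>A. c i * \<phi> i x) G = (\<Sum>i\<in>A. c i * ip (\<phi> i) G)"
  using assms(1)
proof (induction A rule: infinite_finite_induct)
  case (insert i A)
  have "ip (\<lambda>x. c i * \<phi> i x + (\<Sum>i\<in>A. c i * \<phi> i x)) G = c i * ip (\<phi> i) G + (\<Sum>i\<in>A. c i * ip (\<phi> i) G)"
    using insert by (subst ip_add) (auto intro!: continuous_intros assms(2) simp: ip_scale)
  then show ?case using insert.hyps by simp
qed (simp_all add: ip_def ext0_def)

lemma ip_diff:
  assumes "continuous_on S3 F" "continuous_on S3 F'" "continuous_on S3 G"
  shows "ip (\<lambda>x. F x - F' x) G = ip F G - ip F' G"
  using ip_add[OF assms(1) _ assms(3), of "\<lambda>x. - 1 * F' x"] ip_scale[of "- 1" F' G] assms(2)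
  by (simp add: continuous_on_minus)

text \<open>Gram-Schmidt by induction, for a family that may be dependent: \<open>v\<close> is the
  part of the new function orthogonal to the old ones, and \<open>F0\<close> is corrected along
  \<open>v\<close>.\<close>

lemma ip_projection:
  fixes \<phi> :: "'i \<Rightarrow> C2pt \<Rightarrow> complex"
  assumes "finite A" "\<And>i. i \<in> A \<Longrightarrow> continuous_on S3 (\<phi> i)" "continuous_on S3 F"
  shows "\<exists>c. \<forall>i\<in>A. ip (\<lambda>x. F x - (\<Sum>i\<in>A. c i * \<phi> i x)) (\<phi> i) = 0"
  using assms
proof (induction A arbitrary: F rule: finite_induct)
  case (insert i A)
  have ci: "continuous_on S3 (\<phi> i)" and cA: "\<And>i. i \<in> A \<Longrightarrow> continuous_on S3 (\<phi> i)"
    using insert.prems by auto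
  note cs = continuous_sum_scale[of A S3 \<phi>, OF cA]
  obtain d where d: "\<forall>l\<in>A. ip (\<lambda>x. \<phi> i x - (\<Sum>i\<in>A. d i * \<phi> i x)) (\<phi> l) = 0"
    using insert.IH[OF cA ci] by blast
  obtain e where e: "\<forall>l\<in>A. ip (\<lambda>x. F x - (\<Sum>i\<in>A. e i * \<phi> i x)) (\<phi> l) = 0"
    using insert.IH[OF cA insert.prems(2)] by blast
  define v where "v x = \<phi> i x - (\<Sum>i\<in>A. d i * \<phi> i x)" for x
  define F0 where "F0 x = F x - (\<Sum>i\<in>A. e i * \<phi> i x)" for x
  have cv: "continuous_on S3 v" and cF0: "continuous_on S3 F0"
    unfolding v_def F0_def by (intro continuous_intros ci cA insert.prems(2); simp)+
  have dv: "ip v (\<phi> l) = 0" if "l \<in> A" for l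
    using d that unfolding v_def by blast
  have eF: "ip F0 (\<phi> l) = 0" if "l \<in> A" for l
    using e that unfolding F0_def by blast
  \<comment> \<open>If \<open>ip v v\<close> is 0, then \<open>v\<close> vanishes on the sphere and
    division by zero gives \<open>t = 0\<close>, so the equation \<open>Ft\<close> still
    holds.\<close>
  define t where "t = ip F0 v / ip v v"
  have Ft: "ip F0 v = t * ip v v"
  proof (cases "ip v v = 0")
    case True
    then have "ip F0 v = ip F0 (\<lambda>_. 0)"
      using ip_self_eq_0[OF cv] by (intro ip_cong) auto
    then show ?thesis using True by (simp add: ip_def ext0_def)
  qed (simp add: t_def)
  define G where "G x = F0 x - t * v x" for x
  have cG: "continuous_on S3 G" unfolding G_def by (intro continuous_intros cv cF0)
  have ipG: "ip G H = ip F0 H - t * ip v H" if "continuous_on S3 H" for H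
    unfolding G_def using ip_diff[OF cF0 _ that, of "\<lambda>x. t * v x"] cv by (simp add: ip_scale continuous_on_mult_left)
  have GA: "ip G (\<phi> l) = 0" if "l \<in> A" for l
    using dv eF cA that by (simp add: ipG)
  have "ip (\<phi> i) G = ip (\<lambda>x. v x + (\<Sum>i\<in>A. d i * \<phi> i x)) G"
    by (simp add: v_def)
  also have "\<dots> = ip v G + (\<Sum>i\<in>A. d i * ip (\<phi> i) G)"
    using cs cv cG cA by (simp add: ip_add ip_sum)
  also have "ip v G = 0"
    using ip_cnj[of G v] ipG[OF cv] Ft by simp
  also have "(\<Sum>i\<in>A. d i * ip (\<phi> i) G) = 0"
  proof (rule sum.neutral, rule ballI)
    fix l assume "l \<in> A"
    then show "d l * ip (\<phi> l) G = 0"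
      using ip_cnj[of G "\<phi> l"] GA by simp
  qed
  finally have Gi: "ip G (\<phi> i) = 0"
    using ip_cnj[of "\<phi> i" G] by simp
  define c where "c l = (if l = i then t else e l - t * d l)" for l
  have "G = (\<lambda>x. F x - (\<Sum>l\<in>insert i A. c l * \<phi> l x))"
  proof
    fix x
    have "(\<Sum>l\<in>A. c l * \<phi> l x) = (\<Sum>l\<in>A. e l * \<phi> l x) - t * (\<Sum>l\<in>A. d l * \<phi> l x)"
      unfolding sum_distrib_left sum_subtractf[symmetric]
      using insert.hyps by (intro sum.cong) (auto simp: c_def algebra_simps)
    then show "G x = F x - (\<Sum>l\<in>insert i A. c l * \<phi> l x)"
      using insert.hyps by (simp add: G_def F0_def v_def c_def algebra_simps)
  qed
  then show ?case
    using GA Gi by (intro exI[of _ c]) auto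
qed simp

lemma degree_PE: "degree (PE a b p) \<le> a + b"
proof -
  have "degree (xi p) \<le> 1" "degree (eta p) \<le> 1"
    by (simp_all add: xi_def eta_def)
  then have "degree (xi p) * a \<le> a" "degree (eta p) * b \<le> b"
    by (metis mult_1 mult_le_mono1)+
  then show ?thesis
    unfolding PE_def using degree_mult_le[of "xi p ^ a" "eta p ^ b"] degree_power_le[of "xi p" a] degree_power_le[of "eta p" b]
    by linarith
qed

lemma wig_eq_0: "a + b < j \<Longrightarrow> wig a b j p = 0"
  unfolding wig_def using degree_PE[of a b p] by (intro coeff_eq_0) simp

lemma continuous_wig: "continuous_on S (wig a b j)"
  using has_jetD(5)[OF has_jet_wig] by (rule continuous_on_subset) simp

lemma compact_S3: "compact S3"
proof -
  have eq: "S3 = sphere 0 1" by (rule set_eqI) (simp add: S3_iff_norm)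
  show ?thesis unfolding eq by (rule compact_sphere)
qed

text \<open>The residual \<open>H\<close> of the projection onto degree \<open>k\<close> is
  orthogonal to every coefficient: for another degree by the eigenvalues, for degree
  \<open>k\<close> by construction, and for \<open>j > k\<close> because the coefficient is 0. So it
  is orthogonal to all polynomials, and these approximate \<open>H\<close> itself.\<close>

theorem eigenfun_expansion:
  assumes F: "eigenfun k F"
  shows "\<exists>c. \<forall>x\<in>S3. F x = (\<Sum>a\<le>k. \<Sum>j\<le>k. c a j * wig a (k - a) j x)"
proof -
  have cF: "continuous_on S3 F" by (rule eigenfun_continuous[OF F])
  define \<phi> where "\<phi> = (\<lambda>(a, j). restrS3 (wig a (k - a) j))"
  have c\<phi>: "continuous_on S3 (\<phi> i)" for i
    by (rule continuous_on_eq[OF continuous_wig[of S3 "fst i" "k - fst i" "snd i"]])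
      (auto simp: \<phi>_def restrS3_def split: prod.splits)
  let ?A = "{..k} \<times> {..k}"
  obtain c where c: "\<forall>i\<in>?A. ip (\<lambda>x. F x - (\<Sum>i\<in>?A. c i * \<phi> i x)) (\<phi> i) = 0"
    using ip_projection[of ?A \<phi> F] c\<phi> cF by auto
  define H where "H x = F x - (\<Sum>i\<in>?A. c i * \<phi> i x)" for x
  have cH: "continuous_on S3 H" unfolding H_def by (intro continuous_intros cF c\<phi>)
  have wigH: "ip H (wig a b j) = 0" for a b j
  proof -
    have eq: "ip H (wig a b j) = ip H (restrS3 (wig a b j))"
      by (rule ip_cong) (auto simp: restrS3_def)
    consider "a + b \<noteq> k" | "a + b = k" "j \<le> k" | "a + b = k" "k < j" by linarith
    then show ?thesis
    proof cases
      case 1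
      have c': "continuous_on S3 (restrS3 (wig a b j))"
        by (rule eigenfun_continuous[OF eigenfun_wig])
      have "ip (\<phi> i) (restrS3 (wig a b j)) = 0" if "i \<in> ?A" for i
        using that 1 ip_eigenfun_orthogonal[OF eigenfun_wig eigenfun_wig, of "fst i" "k - fst i" a b]
        by (auto simp: \<phi>_def)
      moreover have "ip F (restrS3 (wig a b j)) = 0"
        using 1 ip_eigenfun_orthogonal[OF F eigenfun_wig, of a b j] by auto
      moreover have "ip H (restrS3 (wig a b j)) = ip F (restrS3 (wig a b j))
         - (\<Sum>i\<in>?A. c i * ip (\<phi> i) (restrS3 (wig a b j)))"
        unfolding H_def
        by (subst ip_diff[OF cF continuous_sum_scale[OF c\<phi>] c']) (simp add: ip_sum[OF c\<phi> c'])
      ultimately show ?thesis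
        unfolding eq by simp
    next
      case 2
      then have "ip H (\<phi> (a, j)) = 0" and "b = k - a"
        using c unfolding H_def by auto
      then show ?thesis unfolding eq by (simp add: \<phi>_def)
    next
      case 3
      then have "ip H (wig a b j) = ip H (\<lambda>_. 0)"
        by (intro ip_cong) (auto simp: wig_eq_0)
      then show ?thesis by (simp add: ip_def ext0_def)
    qed
  qed
  have spanH: "continuous_on S3 f \<and> ip f H = 0" if "f \<in> wspan" for f
    using that
  proof induction
    case (wig a b j)
    then show ?case using wigH ip_cnj[of H "wig a b j"] continuous_wig by simp
  next
    case (add f g)
    then show ?case using cH by (simp add: ip_add continuous_on_add)
  next
    case (scale f c)
    then show ?case by (simp add: ip_scale continuous_on_mult_left)
  next
    case (cong f g)
    then have "ip f H = ip g H" by (intro ip_cong) auto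
    then show ?case using cong by (auto intro: continuous_on_eq)
  qed
  have "bounded (H ` S3)"
    using compact_S3 cH by (intro compact_imp_bounded compact_continuous_image)
  then obtain M where M: "M > 0" "\<And>x. x \<in> S3 \<Longrightarrow> cmod (H x) \<le> M"
    unfolding bounded_pos by auto
  obtain C where C: "C \<ge> 0" "\<And>F G M \<epsilon>. continuous_on S3 F \<Longrightarrow> continuous_on S3 G \<Longrightarrow>
     (\<And>x. x \<in> S3 \<Longrightarrow> cmod (F x) \<le> M) \<Longrightarrow> (\<And>x. x \<in> S3 \<Longrightarrow> cmod (G x) \<le> \<epsilon>) \<Longrightarrow> cmod (ip F G) \<le> C * (M * \<epsilon>)"
    using ip_bound by blast
  have small: "cmod (ip H H) \<le> C * (\<epsilon> * M)" if e: "\<epsilon> > 0" for \<epsilon>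
  proof -
    obtain g where g: "polynomial_function g" "\<forall>x\<in>S3. cmod (H x - g x) < \<epsilon>"
      using Stone_Weierstrass_polynomial_function[OF compact_S3 cH e] by blast
    have gH: "continuous_on S3 g" "ip g H = 0"
      using spanH[OF polynomial_in_wspan[OF g(1)]] by auto
    have "ip H H = ip (\<lambda>x. H x - g x) H"
      using ip_diff[OF cH gH(1) cH] gH(2) by simp
    also have "cmod \<dots> \<le> C * (\<epsilon> * M)"
      using g(2) M by (intro C(2) continuous_intros cH gH) (auto intro: less_imp_le)
    finally show ?thesis .
  qed
  have "ip H H = 0"
  proof (rule ccontr)
    assume "ip H H \<noteq> 0"
    \<comment> \<open>Chosen to make the bound at most half of \<open>cmod (ip H H)\<close>;
      \<open>C + 1\<close> replaces \<open>C\<close>, which might be 0.\<close>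
    define \<epsilon> where "\<epsilon> = cmod (ip H H) / (2 * (C + 1) * M)"
    have e: "\<epsilon> > 0" using \<open>ip H H \<noteq> 0\<close> M C by (simp add: \<epsilon>_def)
    have "C * (\<epsilon> * M) \<le> (C + 1) * (\<epsilon> * M)"
      using e M by (intro mult_right_mono) auto
    also have "\<dots> = cmod (ip H H) / 2"
    proof -
      have *: "D * (y / (2 * D * M) * M) = y / 2" if "D \<noteq> 0" for D y
        using that M(1) by simp
      show ?thesis unfolding \<epsilon>_def by (rule *) (use C(1) in simp)
    qed
    finally show False
      using small[OF e] zero_less_norm_iff[THEN iffD2, OF \<open>ip H H \<noteq> 0\<close>] by linarith
  qed
  then have H0: "H x = 0" if "x \<in> S3" for x
    using ip_self_eq_0[OF cH _ that] by blast
  show ?thesis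
  proof (intro exI ballI)
    fix x assume x: "x \<in> S3"
    have "F x = (\<Sum>i\<in>?A. c i * \<phi> i x)"
      using H0[OF x] by (simp add: H_def)
    also have "\<dots> = (\<Sum>a\<le>k. \<Sum>j\<le>k. c (a, j) * wig a (k - a) j x)"
      using x by (simp add: sum.cartesian_product \<phi>_def restrS3_def split_def)
    finally show "F x = (\<Sum>a\<le>k. \<Sum>j\<le>k. c (a, j) * wig a (k - a) j x)" .
  qed
qed

subsection \<open>Linear independence\<close>

lemma infinite_unit_circle: "infinite {z. cmod z = 1}"
proof
  assume fin: "finite {z. cmod z = 1}"
  define n where "n = Suc (card {z. cmod z = 1})"
  have "{z::complex. z ^ n = 1} \<subseteq> {z. cmod z = 1}"
  proof
    fix z :: complex assume "z \<in> {z. z ^ n = 1}"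
    then have "cmod (z ^ n) = 1" by simp
    then have "cmod z ^ n = 1" by (simp only: norm_power)
    then show "z \<in> {z. cmod z = 1}"
      using power_eq_1_iff[of "cmod z" n] by (auto simp: n_def)
  qed
  from card_mono[OF fin this] show False
    using card_nth_roots[of 1 n] by (simp add: n_def)
qed

lemma poly_eq_0_on_infinite:
  fixes p :: "complex poly"
  assumes "infinite S" "\<And>z. z \<in> S \<Longrightarrow> poly p z = 0"
  shows "p = 0"
  using poly_roots_finite[of p] assms finite_subset[of S "{x. poly p x = 0}"] by auto

text \<open>As \<open>cnj t = s * cnj (s * t)\<close> and \<open>cnj s = t * cnj (s * t)\<close>,
  the torus multiplies \<open>xi\<close> by s and \<open>eta\<close> by t after rescaling the
  parameter by \<open>cnj (s * t)\<close>.\<close>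

lemma wig_torus:
  assumes "cmod s = 1" "cmod t = 1"
  shows "wig a b j (s * fst p, t * snd p) = s ^ a * t ^ b * cnj (s * t) ^ j * wig a b j p"
proof -
  let ?L = "[:0, cnj (s * t):]"
  have s: "cnj s * s = 1" "cnj t * t = 1"
    using assms by (simp_all add: mult.commute[of "cnj _"] complex_norm_square[symmetric])
  have "xi (s * fst p, t * snd p) = smult s (pcompose (xi p) ?L)"
    using s by (simp add: xi_def pcompose_pCons algebra_simps)
  moreover have "eta (s * fst p, t * snd p) = smult t (pcompose (eta p) ?L)"
    using s by (simp add: eta_def pcompose_pCons algebra_simps)
  moreover have pow: "pcompose P ?L ^ n = pcompose (P ^ n) ?L" for P :: "complex poly" and n
    by (induction n) (simp_all add: pcompose_mult pcompose_1)
  ultimately have "PE a b (s * fst p, t * snd p) = smult (s ^ a * t ^ b) (pcompose (PE a b p) ?L)"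
    by (simp add: PE_def smult_power pcompose_mult mult.commute)
  then show ?thesis
    by (simp add: wig_def coeff_pcompose_linear mult.assoc)
qed

text \<open>On the points (1, y) with y real the coefficient is a polynomial in y. Its terms with
  nonzero binomials have strictly increasing exponents \<open>e i\<close>, so nothing cancels;
  homogeneity then moves the point to the sphere.\<close>

lemma wig_nonzero:
  assumes "j \<le> a + b"
  obtains x where "x \<in> S3" "wig a b j x \<noteq> 0"
proof -
  define d where "d i = (of_nat (a choose i) * of_nat (b choose (j - i)) * (- 1) ^ i :: complex)" for i
  define e where "e i = b + i - (j - i)" for i
  define Q where "Q = (\<Sum>i\<le>j. monom (d i) (e i))"
  have val: "wig a b j (1, of_real y) = poly Q (of_real y)" for y :: real
  proof -
    have xi: "coeff ([:1, - of_real y:] ^ a :: complex poly) i = of_nat (a choose i) * (- of_real y) ^ i" for i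
      by (cases "i \<le> a") (auto simp: coeff_linear_poly_power binomial_eq_0 coeff_eq_0 degree_linear_power
          intro!: coeff_eq_0 le_less_trans[OF degree_power_le])
    have eta: "coeff ([:of_real y, 1:] ^ b :: complex poly) i = of_nat (b choose i) * of_real y ^ (b - i)" for i
      by (cases "i \<le> b") (auto simp: coeff_linear_poly_power binomial_eq_0
          intro!: coeff_eq_0 le_less_trans[OF degree_power_le])
    have "wig a b j (1, of_real y) = (\<Sum>i\<le>j. of_nat (a choose i) * (- of_real y) ^ i
        * (of_nat (b choose (j - i)) * of_real y ^ (b - (j - i))))"
      by (simp add: wig_def PE_def xi_def eta_def coeff_mult xi eta)
    also have "\<dots> = (\<Sum>i\<le>j. d i * of_real y ^ e i)"
    proof (rule sum.cong[OF refl])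
      fix i
      show "of_nat (a choose i) * (- of_real y) ^ i * (of_nat (b choose (j - i)) * of_real y ^ (b - (j - i)))
          = d i * complex_of_real y ^ e i"
      proof (cases "j - i \<le> b")
        case True
        then have "e i = i + (b - (j - i))" by (simp add: e_def)
        then show ?thesis
          by (simp add: d_def power_add power_minus[of "of_real y"])
      qed (simp add: d_def binomial_eq_0)
    qed
    finally show ?thesis
      by (simp add: Q_def poly_sum poly_monom)
  qed
  \<comment> \<open>The least \<open>i\<close> for which \<open>b choose (j - i)\<close> is nonzero;
    \<open>j \<le> a + b\<close> makes \<open>a choose i0\<close> nonzero as well.\<close>
  define i0 where "i0 = j - b"
  have i0: "i0 \<le> j" "i0 \<le> a" "j - i0 \<le> b"
    using assms by (auto simp: i0_def)
  have "coeff Q (e i0) = (\<Sum>i\<le>j. if i = i0 then d i0 else 0)"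
    unfolding Q_def coeff_sum coeff_monom
  proof (rule sum.cong[OF refl])
    fix i assume "i \<in> {..j}"
    show "(if e i = e i0 then d i else 0) = (if i = i0 then d i0 else 0)"
    proof (cases "i = i0")
      case False
      have "e i \<noteq> e i0" if "j - i \<le> b"
        using that False i0 \<open>i \<in> {..j}\<close> by (auto simp: e_def)
      moreover have "d i = 0" if "\<not> j - i \<le> b"
        using that by (simp add: d_def binomial_eq_0)
      ultimately show ?thesis using False by auto
    qed simp
  qed
  also have "\<dots> = d i0" using i0 by simp
  also have "\<dots> \<noteq> 0" using i0 by (simp add: d_def)
  finally have "Q \<noteq> 0" by auto
  have "infinite (range complex_of_real)"
    by (simp add: finite_image_iff inj_of_real infinite_UNIV_char_0)
  then obtain y :: real where y: "poly Q (of_real y) \<noteq> 0"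
    using poly_eq_0_on_infinite[of "range complex_of_real" Q] \<open>Q \<noteq> 0\<close> by auto
  define p where "p = (1 :: complex, complex_of_real y)"
  have p: "p \<noteq> 0" by (simp add: p_def zero_prod_def)
  have "wig a b j p \<noteq> 0" using y val by (simp add: p_def)
  then show ?thesis
    using that[OF normalize_in_S3[OF p]] p by (simp add: wig_scaleR)
qed

text \<open>Restricted to the one-parameter subgroup (z^k, z^(k+2)) of the torus, the coefficient
  with indices a, j has the character z^(k(k+2)) w^(a+(k+1)j), where w = z^(-2). These exponents of
  w differ for all pairs a, j up to k, so a vanishing sum is a polynomial in w that vanishes on the
  unit circle.\<close>

theorem wig_independent:
  assumes zero: "\<And>x. x \<in> S3 \<Longrightarrow> (\<Sum>a\<le>k. \<Sum>j\<le>k. c a j * wig a (k - a) j x) = 0"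
    and "a0 \<le> k" "j0 \<le> k"
  shows "c a0 j0 = 0"
proof -
  obtain x where x: "x \<in> S3" "wig a0 (k - a0) j0 x \<noteq> 0"
    using wig_nonzero[of j0 a0 "k - a0"] assms(2,3) by auto
  \<comment> \<open>The number with digits a and j in base k + 1.\<close>
  define n where "n a j = a + (k + 1) * j" for a j :: nat
  define Q where "Q = (\<Sum>a\<le>k. \<Sum>j\<le>k. monom (c a j * wig a (k - a) j x) (n a j))"
  have "poly Q w = 0" if w: "cmod w = 1" for w
  proof -
    \<comment> \<open>Every w on the circle is reached: z is chosen so that
      \<open>cnj z ^ 2 = w\<close>.\<close>
    define z where "z = csqrt (cnj w)"
    have z2: "cnj z ^ 2 = w"
      by (simp add: z_def flip: complex_cnj_power)
    have "cmod z ^ 2 = 1"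
      using w z2 by (metis complex_mod_cnj norm_power)
    then have z1: "cmod z = 1"
      by (simp add: power2_eq_1_iff) (smt (verit) norm_ge_zero)
    then have zz: "cnj z * z = 1"
      by (simp add: mult.commute[of "cnj _"] complex_norm_square[symmetric])
    have "wig a (k - a) j (z ^ k * fst x, z ^ (k + 2) * snd x)
        = z ^ (k * (k + 2)) * (w ^ n a j * wig a (k - a) j x)" if "a \<le> k" for a j
    proof -
      have e: "k * (k + 2) = k * a + (k + 2) * (k - a) + 2 * a"
      proof -
        obtain b where "k = a + b"
          using le_Suc_ex[OF \<open>a \<le> k\<close>] by blast
        then show ?thesis by (simp only: add_diff_cancel_left') (simp add: algebra_simps)
      qed
      have "z ^ (k * a + (k + 2) * (k - a)) = z ^ (k * a + (k + 2) * (k - a)) * (cnj z * z) ^ (2 * a)"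
        by (simp add: zz)
      also have "\<dots> = z ^ (k * (k + 2)) * w ^ a"
        unfolding e power_mult_distrib power_add z2[symmetric] power_mult[symmetric] by (simp add: mult_ac)
      finally have h1: "(z ^ k) ^ a * (z ^ (k + 2)) ^ (k - a) = z ^ (k * (k + 2)) * w ^ a"
        by (simp only: power_mult[symmetric] power_add[symmetric])
      have h2: "cnj (z ^ k * z ^ (k + 2)) ^ j = w ^ ((k + 1) * j)"
      proof -
        have "z ^ k * z ^ (k + 2) = z ^ (2 * (k + 1))"
          by (simp flip: power_add add: mult_2)
        then show ?thesis
          by (simp only: complex_cnj_power power_mult z2)
      qed
      have u: "cmod (z ^ k) = 1" "cmod (z ^ (k + 2)) = 1"
        by (simp_all only: norm_power z1 power_one)
      have "wig a (k - a) j (z ^ k * fst x, z ^ (k + 2) * snd x)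
          = z ^ (k * (k + 2)) * w ^ a * w ^ ((k + 1) * j) * wig a (k - a) j x"
        unfolding wig_torus[OF u] h1 h2 ..
      then show ?thesis
        by (simp only: n_def power_add[of w] mult.assoc)
    qed
    then have e1: "(\<Sum>a\<le>k. \<Sum>j\<le>k. c a j * wig a (k - a) j (z ^ k * fst x, z ^ (k + 2) * snd x))
       = z ^ (k * (k + 2)) * poly Q w"
      by (simp add: Q_def poly_sum poly_monom sum_distrib_left mult_ac)
    have e2: "(z ^ k * fst x, z ^ (k + 2) * snd x) \<in> S3"
      using x(1) z1 by (simp add: S3_def norm_mult norm_power)
    have "z ^ (k * (k + 2)) * poly Q w = 0"
      by (rule trans[OF e1[symmetric] zero[OF e2]])
    moreover have "z \<noteq> 0" using z1 by auto
    ultimately show ?thesis by simp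
  qed
  then have Q0: "Q = 0"
    using poly_eq_0_on_infinite[OF infinite_unit_circle] by blast
  have "coeff Q (n a0 j0) = (\<Sum>a\<le>k. \<Sum>j\<le>k. if a = a0 \<and> j = j0 then c a j * wig a (k - a) j x else 0)"
    unfolding Q_def coeff_sum coeff_monom
  proof (intro sum.cong refl)
    fix a j assume "a \<in> {..k}" "j \<in> {..k}"
    moreover have "n a j mod (k + 1) = a" "n a j div (k + 1) = j" if "a \<le> k" for a j
    proof -
      have "(a + K * j) mod K = a" "(a + K * j) div K = j" if "a < K" for K
        using that by simp_all
      then show "n a j mod (k + 1) = a" "n a j div (k + 1) = j"
        using that unfolding n_def by (metis Suc_eq_plus1 le_imp_less_Suc)+
    qed
    ultimately have "n a j = n a0 j0 \<longleftrightarrow> a = a0 \<and> j = j0"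
      using assms(2) by (metis atMost_iff)
    then show "(if n a j = n a0 j0 then c a j * wig a (k - a) j x else 0)
       = (if a = a0 \<and> j = j0 then c a j * wig a (k - a) j x else 0)" by simp
  qed
  also have "\<dots> = (\<Sum>a\<le>k. if a = a0 then \<Sum>j\<le>k. if j = j0 then c a j * wig a (k - a) j x else 0 else 0)"
    by (intro sum.cong) auto
  also have "\<dots> = c a0 j0 * wig a0 (k - a0) j0 x"
    using assms(2,3) by simp
  finally show ?thesis using x(2) Q0 by simp
qed

subsection \<open>Binary forms\<close>

text \<open>A binary form is stored as its restriction to \<beta> = 1 together with its degree
  \<open>k\<close>. A zero at \<infinity>, the point (1, 0), shows up as
  \<open>degree q < k\<close>.\<close>

definition hom :: "complex poly \<Rightarrow> nat \<Rightarrow> C2pt \<Rightarrow> complex" where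
  "hom q k p = (\<Sum>i\<le>k. coeff q i * (fst p ^ i * snd p ^ (k - i)))"

lemma hom_add: "hom (q + r) k p = hom q k p + hom r k p"
  by (simp add: hom_def algebra_simps sum.distrib)

lemma hom_smult: "hom (smult c q) k p = c * hom q k p"
  by (simp add: hom_def algebra_simps sum_distrib_left)

lemma hom_diff: "hom (q - r) k p = hom q k p - hom r k p"
  by (simp add: hom_def algebra_simps sum_subtractf)

lemma hom_sum: "hom (\<Sum>i\<in>A. q i) k p = (\<Sum>i\<in>A. hom (q i) k p)"
  by (induction A rule: infinite_finite_induct) (simp_all add: hom_add, simp_all add: hom_def)

lemma hom_monom: "i \<le> k \<Longrightarrow> hom (monom c i) k p = c * (fst p ^ i * snd p ^ (k - i))"
  by (simp add: hom_def if_distrib[of "\<lambda>x. x * _"] cong: if_cong)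

lemma hom_1_0: "hom q k (1, 0) = coeff q k"
proof -
  have "hom q k (1, 0) = (\<Sum>i\<le>k. if i = k then coeff q k else 0)"
    unfolding hom_def by (intro sum.cong) auto
  then show ?thesis by simp
qed

lemma hom_at_1:
  assumes "degree q \<le> k"
  shows "hom q k (z, 1) = poly q z"
proof -
  have "poly q z = (\<Sum>i\<le>k. coeff q i * z ^ i)"
    unfolding poly_altdef using assms
    by (intro sum.mono_neutral_left) (auto simp: coeff_eq_0)
  then show ?thesis by (simp add: hom_def)
qed

lemma hom_inj:
  assumes "degree q \<le> k" "degree r \<le> k" "\<And>p. hom q k p = hom r k p"
  shows "q = r"
  using assms hom_at_1 by (metis poly_eq_poly_eq_iff ext)

lemma hom_scale: "hom q k (c * fst p, c * snd p) = c ^ k * hom q k p"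
  unfolding hom_def sum_distrib_left
  by (intro sum.cong) (auto simp: power_mult_distrib mult_ac simp flip: power_add)

lemma continuous_hom: "continuous_on S (hom q k)"
  unfolding hom_def[abs_def] by (intro continuous_intros)

text \<open>Points with nonzero second coordinate are dense; on them homogeneity reduces identities
  between forms to identities between univariate polynomials.\<close>

lemma eq_by_continuity:
  fixes f g :: "C2pt \<Rightarrow> complex"
  assumes "continuous_on UNIV f" "continuous_on UNIV g" "\<And>p. snd p \<noteq> 0 \<Longrightarrow> f p = g p"
  shows "f p = g p"
proof -
  let ?s = "\<lambda>n. (fst p, snd p + (if snd p = 0 then of_real (inverse (real (Suc n))) else 0))"
  have "(\<lambda>n. if snd p = 0 then complex_of_real (inverse (real (Suc n))) else 0) \<longlonglongrightarrow> 0"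
    using tendsto_of_real[OF LIMSEQ_inverse_real_of_nat, where 'a = complex] by (cases "snd p = 0") simp_all
  then have "?s \<longlonglongrightarrow> (fst p, snd p + 0)"
    by (intro tendsto_intros)
  then have s: "?s \<longlonglongrightarrow> p" by simp
  have "isCont f p" "isCont g p"
    using assms(1,2) continuous_on_eq_continuous_at[OF open_UNIV] by blast+
  then have "(\<lambda>n. f (?s n)) \<longlonglongrightarrow> f p" "(\<lambda>n. g (?s n)) \<longlonglongrightarrow> g p"
    using s by (auto intro: isCont_tendsto_compose)
  moreover have "f (?s n) = g (?s n)" for n
    by (rule assms(3)) (simp del: of_nat_Suc of_real_inverse)
  ultimately show ?thesis
    using LIMSEQ_unique by (metis (no_types, lifting) ext)
qed

lemma hom_mult:
  assumes "degree q \<le> k" "degree r \<le> l"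
  shows "hom (q * r) (k + l) p = hom q k p * hom r l p"
proof (rule eq_by_continuity)
  fix p :: C2pt assume p: "snd p \<noteq> 0"
  define z where "z = fst p / snd p"
  have e: "hom q n p = snd p ^ n * poly q z" if "degree q \<le> n" for q n
    using hom_scale[of q n "snd p" "(z, 1)"] hom_at_1[OF that, of z] p by (simp add: z_def)
  show "hom (q * r) (k + l) p = hom q k p * hom r l p"
    using assms degree_mult_le[of q r] by (simp add: e power_add)
qed (intro continuous_intros continuous_hom)+

lemma hom_1: "hom 1 0 p = 1"
  by (simp add: hom_def)

lemma degree_power_le': "degree q \<le> k \<Longrightarrow> degree (q ^ n) \<le> k * n"
  using degree_power_le[of q n] by (meson le_trans mult_le_mono1)

lemma hom_power:
  assumes "degree q \<le> k"
  shows "hom (q ^ n) (k * n) p = hom q k p ^ n"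
proof (induction n)
  case (Suc n)
  then show ?case
    using hom_mult[OF assms degree_power_le'[OF assms, of n], of p] by simp
qed (simp add: hom_1)

lemma hom_mat_act:
  assumes "degree q \<le> k"
  obtains q' where "degree q' \<le> k" "\<And>p. hom q' k p = hom q k (mat_act g p)"
proof -
  obtain a b c d where g: "g = (a, b, c, d)" by (cases g) auto
  \<comment> \<open>\<open>[:b, a:]\<close> and \<open>[:d, c:]\<close> are the linear forms
    \<open>a * \<alpha> + b * \<beta>\<close> and \<open>c * \<alpha> + d * \<beta>\<close> at
    \<beta> = 1.\<close>
  define m where "m i = [:b, a:] ^ i * [:d, c:] ^ (k - i)" for i
  have d1: "degree [:b, a:] \<le> 1" "degree [:d, c:] \<le> 1" by simp_all
  have dm: "degree (m i) \<le> k" if "i \<le> k" for i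
    using degree_mult_le[of "[:b, a:] ^ i" "[:d, c:] ^ (k - i)"]
      degree_power_le'[OF d1(1), of i] degree_power_le'[OF d1(2), of "k - i"] that
    by (simp add: m_def)
  have hm: "hom (m i) k p = fst (mat_act g p) ^ i * snd (mat_act g p) ^ (k - i)" if "i \<le> k" for i p
  proof -
    have "hom [:b, a:] 1 p = a * fst p + b * snd p" "hom [:d, c:] 1 p = c * fst p + d * snd p"
      by (simp_all add: hom_def)
    then show ?thesis
      using hom_mult[OF degree_power_le'[OF d1(1), of i] degree_power_le'[OF d1(2), of "k - i"], of p]
        hom_power[OF d1(1), of i p] hom_power[OF d1(2), of "k - i" p] that
      by (simp add: m_def g mat_act_def)
  qed
  show ?thesis
  proof (rule that)
    show "degree (\<Sum>i\<le>k. smult (coeff q i) (m i)) \<le> k"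
      by (intro degree_sum_le) (auto intro: order_trans[OF degree_smult_le] dm)
    show "hom (\<Sum>i\<le>k. smult (coeff q i) (m i)) k p = hom q k (mat_act g p)" for p
      by (simp add: hom_sum hom_smult hm) (simp add: hom_def)
  qed
qed

subsection \<open>The icosahedral forms\<close>

text \<open>The icosahedral forms at \<beta> = 1. \<open>K12\<close> has degree 11 only, since the
  twelfth zero of \<open>I12\<close> lies at \<infinity>.\<close>

definition K12 :: "complex poly" where "K12 = monom 1 11 + monom 11 6 - monom 1 1"
definition K20 :: "complex poly" where
  "K20 = monom 1 20 - monom 228 15 + monom 494 10 + monom 228 5 + monom 1 0"
definition K30 :: "complex poly" where
  "K30 = monom 1 30 + monom 522 25 - monom 10005 20 - monom 10005 10 - monom 522 5 + monom 1 0"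

lemma I_hom: "I12 p = hom K12 12 p" "I20 p = hom K20 20 p" "I30 p = hom K30 30 p"
  unfolding I12_def I20_def I30_def K12_def K20_def K30_def hom_add hom_diff
  by (simp_all add: hom_monom Let_def algebra_simps del: monom_0 monom_eq_1)

lemma degree_K: "degree K12 \<le> 12" "degree K20 \<le> 20" "degree K30 \<le> 30"
  unfolding K12_def K20_def K30_def
  by (intro degree_add_le degree_diff_le order_trans[OF degree_monom_le]; simp)+

lemma poly_K12: "poly K12 z = z * (z ^ 10 + 11 * z ^ 5 - 1)"
  by (simp add: K12_def poly_monom algebra_simps numeral_eq_Suc)

lemma degree_K12: "degree K12 = 11"
proof (rule antisym)
  show "degree K12 \<le> 11"
    unfolding K12_def by (intro degree_add_le degree_diff_le order_trans[OF degree_monom_le]) auto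
  show "11 \<le> degree K12"
    by (rule le_degree) (simp add: K12_def)
qed

lemma card_roots_K12: "card {z. poly K12 z = 0} = 11" "finite {z. poly K12 z = 0}"
proof -
  \<comment> \<open>The two roots of X^2 + 11 X - 1, the polynomial satisfied by X = z^5.\<close>
  define u v where "u = complex_of_real ((- 11 + 5 * sqrt 5) / 2)" and "v = complex_of_real ((- 11 - 5 * sqrt 5) / 2)"
  have uv: "u + v = - 11" "u * v = - 1"
    unfolding u_def v_def of_real_add[symmetric] of_real_mult[symmetric] by (simp_all add: field_simps)
  then have nz: "u \<noteq> 0" "v \<noteq> 0" by auto
  have ne: "u \<noteq> v" unfolding u_def v_def of_real_eq_iff by simp
  have f: "z ^ 10 + 11 * z ^ 5 - 1 = (z ^ 5 - u) * (z ^ 5 - v)" for z :: complex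
  proof -
    have "(z ^ 5 - u) * (z ^ 5 - v) = z ^ 10 - (u + v) * z ^ 5 + u * v"
      by (simp add: algebra_simps flip: power_add)
    then show ?thesis by (simp add: uv)
  qed
  have eq: "{z. poly K12 z = 0} = {0} \<union> ({z. z ^ 5 = u} \<union> {z. z ^ 5 = v})"
    by (auto simp: poly_K12 f)
  have c: "card {z. z ^ 5 = u} = 5" "card {z. z ^ 5 = v} = 5"
    using card_nth_roots nz by auto
  then have fin: "finite {z. z ^ 5 = u}" "finite {z. z ^ 5 = v}"
    by (metis card.infinite zero_neq_numeral)+
  have "card ({z. z ^ 5 = u} \<union> {z. z ^ 5 = v}) = 10"
    using c fin ne by (subst card_Un_disjoint) auto
  then show "card {z. poly K12 z = 0} = 11"
    unfolding eq using fin nz by (subst card_Un_disjoint) auto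
  show "finite {z. poly K12 z = 0}"
    unfolding eq using fin by simp
qed

lemma prod_linear_dvd:
  fixes p :: "complex poly"
  assumes "finite A" "\<And>a. a \<in> A \<Longrightarrow> poly p a = 0"
  shows "(\<Prod>a\<in>A. [:- a, 1:]) dvd p"
  using assms
proof (induction A rule: finite_induct)
  case (insert a A)
  then obtain q where q: "p = (\<Prod>a\<in>A. [:- a, 1:]) * q" by auto
  have "poly (\<Prod>a\<in>A. [:- a, 1:]) a \<noteq> 0"
    using insert.hyps by (auto simp: poly_prod)
  then have "poly q a = 0"
    using insert.prems[of a] q by auto
  then obtain r where "q = [:- a, 1:] * r"
    by (auto simp: poly_eq_0_iff_dvd)
  then have "p = (\<Prod>a\<in>insert a A. [:- a, 1:]) * r"
    unfolding prod.insert[OF insert.hyps] q by (simp only: mult_ac)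
  then show ?case by (rule dvdI)
qed simp

text \<open>All eleven roots are simple, so \<open>K12\<close> is a constant multiple of the product
  of its linear factors.\<close>

lemma K12_dvd:
  assumes "\<And>z. poly K12 z = 0 \<Longrightarrow> poly p z = 0"
  shows "K12 dvd p"
proof -
  define P where "P = (\<Prod>a\<in>{z. poly K12 z = 0}. [:- a, 1:])"
  have dP: "degree P = 11"
    unfolding P_def using card_roots_K12 by (subst degree_prod_eq_sum_degree) auto
  obtain c where c: "K12 = P * c"
    using prod_linear_dvd[OF card_roots_K12(2), of K12] unfolding P_def[symmetric] by auto
  have "K12 \<noteq> 0" using degree_K12 by auto
  then have "P \<noteq> 0" "c \<noteq> 0" using c by (metis mult_zero_left, metis mult_zero_right)
  then have "degree K12 = degree P + degree c"
    using c degree_mult_eq[of P c] by metis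
  then have "degree c = 0" using dP degree_K12 by simp
  then obtain e where e: "c = [:e:]" by (metis degree_eq_zeroE)
  then have "e \<noteq> 0" using c \<open>K12 \<noteq> 0\<close> by auto
  have "P dvd p"
    unfolding P_def using prod_linear_dvd[OF card_roots_K12(2)] assms by auto
  then show ?thesis
    using \<open>e \<noteq> 0\<close> unfolding c e by (simp add: smult_dvd_iff)
qed

definition pt :: "complex option \<Rightarrow> C2pt" where
  "pt w = (case w of None \<Rightarrow> (1, 0) | Some z \<Rightarrow> (z, 1))"

lemma V_I_iff: "w \<in> V_I \<longleftrightarrow> I12 (pt w) = 0"
proof (cases w)
  case None
  then show ?thesis by (simp add: V_I_def pt_def I12_def)
next
  case (Some z)
  have "I12 (z, 1) = z * (z ^ 10 + 11 * z ^ 5 - 1)"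
    using hom_at_1[OF degree_K(1), of z] by (simp add: I_hom poly_K12)
  then show ?thesis using Some by (auto simp: V_I_def pt_def)
qed

text \<open>The finite vertices give divisibility by \<open>K12\<close>, of degree 11; the vertex
  \<infinity> gives \<open>degree q < k\<close> and thus the twelfth degree that the quotient
  loses.\<close>

lemma vertices_vanish_imp_factor:
  assumes "degree q \<le> k" "\<And>w. w \<in> V_I \<Longrightarrow> hom q k (pt w) = 0" "q \<noteq> 0"
  obtains r where "12 \<le> k" "degree r \<le> k - 12" "q = K12 * r"
proof -
  have "hom q k (1, 0) = 0"
    using assms(2)[of None] by (simp add: V_I_def pt_def)
  then have "coeff q k = 0" by (simp add: hom_1_0)
  then have "degree q \<noteq> k" using assms(3) by auto
  then have lt: "degree q < k" using assms(1) by simp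
  have "K12 dvd q"
  proof (rule K12_dvd)
    fix z assume "poly K12 z = 0"
    then have "Some z \<in> V_I"
      using hom_at_1[OF degree_K(1), of z] by (simp add: V_I_iff I_hom pt_def)
    from assms(2)[OF this] show "poly q z = 0"
      by (simp add: pt_def hom_at_1[OF assms(1)])
  qed
  then obtain r where r: "q = K12 * r" by auto
  then have "degree q = 11 + degree r"
    using assms(3) degree_mult_eq[of K12 r] by (auto simp: degree_K12)
  with lt have "12 \<le> k" "degree r \<le> k - 12" by simp_all
  then show ?thesis
    using that r by blast
qed

subsection \<open>The binary icosahedral group\<close>

lemma SU2_form:
  assumes "(a, b, c, d) \<in> SU2"
  shows "d = cnj a" "b = - cnj c" "a * d - b * c = 1" "cnj a * a + cnj c * c = 1"
proof -
  have 1: "(cmod a)^2 + (cmod c)^2 = 1" "cnj a * b + cnj c * d = 0" and det: "a * d - b * c = 1"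
    using assms by (auto simp: SU2_def)
  have "complex_of_real ((cmod a)^2 + (cmod c)^2) = 1" using 1 by simp
  then have n: "cnj a * a + cnj c * c = 1"
    by (simp only: of_real_add complex_norm_square mult.commute)
  show "a * d - b * c = 1" by (rule det)
  show "cnj a * a + cnj c * c = 1" by (rule n)
  have "cnj a = d" "cnj c = - b"
    using 1(2) det n by algebra+
  then show "d = cnj a" "b = - cnj c" by auto
qed

lemma SU2_I:
  assumes "cnj a * a + cnj c * c = 1"
  shows "(a, - cnj c, c, cnj a) \<in> SU2"
proof -
  have "complex_of_real ((cmod a)^2 + (cmod c)^2) = 1"
    using assms by (simp only: of_real_add complex_norm_square mult.commute)
  then have "(cmod a)^2 + (cmod c)^2 = 1"
    by (simp only: of_real_eq_1_iff)
  then show ?thesis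
    using assms by (simp add: SU2_def algebra_simps)
qed

lemma mat_inv2_SU2: "g \<in> SU2 \<Longrightarrow> mat_inv2 g \<in> SU2"
proof -
  assume "g \<in> SU2"
  moreover obtain a b c d where g: "g = (a, b, c, d)" by (cases g) auto
  ultimately have f: "d = cnj a" "b = - cnj c" "cnj a * a + cnj c * c = 1"
    using SU2_form by blast+
  then have "(d, - cnj (- c), - c, cnj d) \<in> SU2"
    by (intro SU2_I) (simp add: mult.commute)
  then show ?thesis
    using f by (simp add: g mat_inv2_def)
qed

lemma mat_act_inv:
  assumes "g \<in> SU2"
  shows "mat_act g (mat_act (mat_inv2 g) p) = p" "mat_act (mat_inv2 g) (mat_act g p) = p"
proof -
  obtain a b c d where g: "g = (a, b, c, d)" by (cases g) auto
  have det: "a * d - b * c = 1" using assms SU2_form(3) g by blast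
  have "a * (d * x - b * y) + b * (a * y - c * x) = x" "c * (d * x - b * y) + d * (a * y - c * x) = y"
    "d * (a * x + b * y) - b * (c * x + d * y) = x" "a * (c * x + d * y) - c * (a * x + b * y) = y" for x y
    using det by algebra+
  then show "mat_act g (mat_act (mat_inv2 g) p) = p" "mat_act (mat_inv2 g) (mat_act g p) = p"
    by (simp_all add: g mat_inv2_def mat_act_def prod_eq_iff)
qed

lemma mat_act_S3:
  assumes "g \<in> SU2" "x \<in> S3"
  shows "mat_act g x \<in> S3"
proof -
  obtain a b c d where g: "g = (a, b, c, d)" by (cases g) auto
  have f: "d = cnj a" "b = - cnj c" "cnj a * a + cnj c * c = 1"
    using assms SU2_form g by blast+
  have "complex_of_real ((cmod (fst (mat_act g x)))^2 + (cmod (snd (mat_act g x)))^2)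
     = (cnj a * a + cnj c * c) * (cnj (fst x) * fst x + cnj (snd x) * snd x)"
    unfolding of_real_add complex_norm_square by (simp add: g mat_act_def f(1,2) algebra_simps)
  also have "\<dots> = 1" using f(3) S3_cnj[OF assms(2)] by simp
  finally show ?thesis
    unfolding S3_def by (simp only: of_real_eq_1_iff mem_Collect_eq)
qed

text \<open>The linear action covers the Moebius action up to a scalar, which is nonzero because the
  determinant is 1.\<close>

lemma mat_act_pt:
  assumes "g \<in> SU2"
  obtains s where "s \<noteq> 0" "mat_act g (pt w) = (s * fst (pt (mobius g w)), s * snd (pt (mobius g w)))"
proof -
  obtain a b c d where g: "g = (a, b, c, d)" by (cases g) auto
  have det: "a * d - b * c = 1" using assms SU2_form(3) g by blast
  show ?thesis
  proof (cases w)
    case None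
    show ?thesis
    proof (cases "c = 0")
      case True
      then have "a \<noteq> 0" using det by auto
      then show ?thesis
        using that[of a] None True by (simp add: g mat_act_def pt_def mobius_def)
    next
      case False
      then show ?thesis
        using that[of c] None by (simp add: g mat_act_def pt_def mobius_def)
    qed
  next
    case (Some z)
    show ?thesis
    proof (cases "c * z + d = 0")
      case True
      have "a * z + b \<noteq> 0"
      proof
        assume "a * z + b = 0"
        then have "a * d - b * c = 0" using True by algebra
        then show False using det by simp
      qed
      then show ?thesis
        using that[of "a * z + b"] Some True by (simp add: g mat_act_def pt_def mobius_def)
    next
      case False
      then show ?thesis
        using that[of "c * z + d"] Some by (simp add: g mat_act_def pt_def mobius_def)
    qed
  qed
qed

lemma pt_proportional: "s \<noteq> 0 \<Longrightarrow> pt v = (s * fst (pt w), s * snd (pt w)) \<Longrightarrow> v = w"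
  by (cases v; cases w) (auto simp: pt_def)

lemma mobius_inv:
  assumes "g \<in> SU2"
  shows "mobius g (mobius (mat_inv2 g) w) = w"
proof -
  let ?v = "mobius (mat_inv2 g) w"
  obtain s where s: "s \<noteq> 0" "mat_act (mat_inv2 g) (pt w) = (s * fst (pt ?v), s * snd (pt ?v))"
    using mat_act_pt[OF mat_inv2_SU2[OF assms]] by blast
  obtain t where t: "t \<noteq> 0" "mat_act g (pt ?v) = (t * fst (pt (mobius g ?v)), t * snd (pt (mobius g ?v)))"
    using mat_act_pt[OF assms] by blast
  have sc: "mat_act g (s * fst p, s * snd p) = (s * fst (mat_act g p), s * snd (mat_act g p))" for p
    by (cases g) (simp add: mat_act_def algebra_simps)
  have "pt w = mat_act g (s * fst (pt ?v), s * snd (pt ?v))"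
    using mat_act_inv(1)[OF assms, of "pt w"] unfolding s(2) by simp
  then have "pt w = ((s * t) * fst (pt (mobius g ?v)), (s * t) * snd (pt (mobius g ?v)))"
    unfolding sc t(2) by simp
  then show ?thesis
    using pt_proportional s t by (metis mult_eq_0_iff)
qed

text \<open>The vertices are the zeros of \<open>I12\<close>, so membership in \<open>Istar\<close>
  reduces to a polynomial identity; the inverse matrix shows that every vertex is attained.\<close>

lemma Istar_I:
  assumes "g \<in> SU2" "\<And>p. I12 (mat_act g p) = I12 p"
  shows "g \<in> Istar"
proof -
  have iff: "mobius g w \<in> V_I \<longleftrightarrow> w \<in> V_I" for w
  proof -
    obtain s where s: "s \<noteq> 0" "mat_act g (pt w) = (s * fst (pt (mobius g w)), s * snd (pt (mobius g w)))"
      using mat_act_pt[OF assms(1)] by blast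
    have "I12 (pt w) = s ^ 12 * I12 (pt (mobius g w))"
      using assms(2)[of "pt w"] unfolding s(2) I_hom hom_scale by simp
    then show ?thesis using s(1) by (simp add: V_I_iff)
  qed
  have "w \<in> mobius g ` V_I" if "w \<in> V_I" for w
    using iff[of "mobius (mat_inv2 g) w"] mobius_inv[OF assms(1), of w] that by (metis imageI)
  then have "mobius g ` V_I = V_I"
    using iff by auto
  then show ?thesis using assms(1) by (simp add: Istar_def)
qed

lemma Istar_SU2: "g \<in> Istar \<Longrightarrow> g \<in> SU2"
  by (simp add: Istar_def)

text \<open>The transformed form again vanishes at all twelve vertices, so it is \<open>I12\<close>
  times a form of degree 0.\<close>

lemma I12_semiinvariant:
  assumes "g \<in> Istar"
  obtains \<kappa> where "\<And>p. I12 (mat_act g p) = \<kappa> * I12 p"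
proof -
  obtain r where r: "degree r \<le> 12" "\<And>p. hom r 12 p = I12 (mat_act g p)"
    using hom_mat_act[OF degree_K(1), of g] unfolding I_hom by blast
  have van: "hom r 12 (pt w) = 0" if "w \<in> V_I" for w
  proof -
    obtain s where s: "mat_act g (pt w) = (s * fst (pt (mobius g w)), s * snd (pt (mobius g w)))"
      using mat_act_pt[OF Istar_SU2[OF assms]] by blast
    have "mobius g w \<in> V_I" using assms that by (auto simp: Istar_def)
    then have "I12 (pt (mobius g w)) = 0" by (simp add: V_I_iff)
    then show ?thesis
      unfolding r(2) s unfolding I_hom hom_scale by simp
  qed
  show ?thesis
  proof (cases "r = 0")
    case True
    then show ?thesis using that[of 0] r(2) by (simp add: hom_def)
  next
    case False
    obtain t where t: "degree t \<le> 12 - 12" "r = K12 * t"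
      using vertices_vanish_imp_factor[OF r(1) van False] by blast
    then obtain e where "t = [:e:]" by (auto elim: degree_eq_zeroE)
    then have "r = smult e K12" using t by simp
    then show ?thesis using that[of e] r(2) by (simp add: hom_smult I_hom)
  qed
qed

section \<open>Covariants of \<open>I12\<close> and invariance of the three forms\<close>

definition has_partials :: "(C2pt \<Rightarrow> complex) \<Rightarrow> (C2pt \<Rightarrow> complex) \<Rightarrow> (C2pt \<Rightarrow> complex) \<Rightarrow> bool" where
  "has_partials f f1 f2 \<longleftrightarrow> (\<forall>p. (f has_derivative (\<lambda>h. f1 p * fst h + f2 p * snd h)) (at p))"

lemma has_partialsD: "has_partials f f1 f2 \<Longrightarrow> (f has_derivative (\<lambda>h. f1 p * fst h + f2 p * snd h)) (at p)"
  unfolding has_partials_def by blast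

lemma has_partials_linear_comb:
  "has_partials f f1 f2 \<Longrightarrow> has_partials g g1 g2 \<Longrightarrow>
   has_partials (\<lambda>p. a * f p + c * g p) (\<lambda>p. a * f1 p + c * g1 p) (\<lambda>p. a * f2 p + c * g2 p)"
  unfolding has_partials_def
  by (auto intro!: has_derivative_eq_rhs[OF has_derivative_add[OF has_derivative_mult_right has_derivative_mult_right]]
      simp: fun_eq_iff algebra_simps)

text \<open>The gradient transforms by the transposed matrix. Applied again to combinations of first
  partials, this yields the rule for the Hessian.\<close>

lemma partials_mat_act:
  assumes f: "has_partials f f1 f2" and h: "has_partials h h1 h2"
    and eq: "\<And>p. f (mat_act (a, b, c, d) p) = \<kappa> * h p"
  shows "a * f1 (mat_act (a, b, c, d) p) + c * f2 (mat_act (a, b, c, d) p) = \<kappa> * h1 p"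
    "b * f1 (mat_act (a, b, c, d) p) + d * f2 (mat_act (a, b, c, d) p) = \<kappa> * h2 p"
proof -
  let ?g = "mat_act (a, b, c, d)"
  have "(?g has_derivative ?g) (at p)"
    unfolding mat_act_def[abs_def] by (auto intro!: derivative_eq_intros)
  from has_derivative_compose[OF this has_partialsD[OF f]]
  have "((\<lambda>p. f (?g p)) has_derivative (\<lambda>v. f1 (?g p) * fst (?g v) + f2 (?g p) * snd (?g v))) (at p)"
    .
  moreover have "((\<lambda>p. \<kappa> * h p) has_derivative (\<lambda>v. \<kappa> * (h1 p * fst v + h2 p * snd v))) (at p)"
    by (intro has_derivative_mult_right has_partialsD[OF h])
  ultimately have D: "(\<lambda>v. f1 (?g p) * fst (?g v) + f2 (?g p) * snd (?g v)) = (\<lambda>v. \<kappa> * (h1 p * fst v + h2 p * snd v))"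
    unfolding eq by (rule has_derivative_unique)
  show "a * f1 (?g p) + c * f2 (?g p) = \<kappa> * h1 p" "b * f1 (?g p) + d * f2 (?g p) = \<kappa> * h2 p"
    using fun_cong[OF D, of "(1, 0)"] fun_cong[OF D, of "(0, 1)"] by (simp_all add: mat_act_def mult.commute)
qed

definition I12_x :: "C2pt \<Rightarrow> complex" where
  "I12_x p = 11 * fst p ^ 10 * snd p + 66 * fst p ^ 5 * snd p ^ 6 - snd p ^ 11"
definition I12_y :: "C2pt \<Rightarrow> complex" where
  "I12_y p = fst p ^ 11 + 66 * fst p ^ 6 * snd p ^ 5 - 11 * fst p * snd p ^ 10"
definition I12_xx :: "C2pt \<Rightarrow> complex" where
  "I12_xx p = 110 * fst p ^ 9 * snd p + 330 * fst p ^ 4 * snd p ^ 6"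
definition I12_xy :: "C2pt \<Rightarrow> complex" where
  "I12_xy p = 11 * fst p ^ 10 + 396 * fst p ^ 5 * snd p ^ 5 - 11 * snd p ^ 10"
definition I12_yy :: "C2pt \<Rightarrow> complex" where
  "I12_yy p = 330 * fst p ^ 6 * snd p ^ 4 - 110 * fst p * snd p ^ 9"
definition I20_x :: "C2pt \<Rightarrow> complex" where
  "I20_x p = 20 * fst p ^ 19 - 3420 * fst p ^ 14 * snd p ^ 5 + 4940 * fst p ^ 9 * snd p ^ 10 + 1140 * fst p ^ 4 * snd p ^ 15"
definition I20_y :: "C2pt \<Rightarrow> complex" where
  "I20_y p = - 1140 * fst p ^ 15 * snd p ^ 4 + 4940 * fst p ^ 10 * snd p ^ 9 + 3420 * fst p ^ 5 * snd p ^ 14 + 20 * snd p ^ 19"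

lemma has_partials_I:
  "has_partials I12 I12_x I12_y" "has_partials I12_x I12_xx I12_xy" "has_partials I12_y I12_xy I12_yy" "has_partials I20 I20_x I20_y"
  unfolding has_partials_def I12_def[abs_def] I20_def[abs_def] I12_x_def[abs_def] I12_y_def[abs_def]
    I12_xx_def I12_xy_def I12_yy_def I20_x_def I20_y_def Let_def
  by (auto intro!: derivative_eq_intros simp: fun_eq_iff algebra_simps)

text \<open>Klein's covariants: \<open>I20\<close> is the Hessian of \<open>I12\<close>, and \<open>I30\<close> is the Jacobian of \<open>I12\<close> and \<open>I20\<close>.\<close>

lemma I20_hessian: "I12_xx p * I12_yy p - I12_xy p * I12_xy p = - 121 * I20 p"
  unfolding I12_xx_def I12_yy_def I12_xy_def I20_def Let_def by algebra

lemma I30_jacobian: "I12_x p * I20_y p - I12_y p * I20_x p = - 20 * I30 p"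
  unfolding I12_x_def I12_y_def I20_x_def I20_y_def I30_def Let_def by algebra

lemma klein_syzygy: "I30 p ^ 2 - I20 p ^ 3 = 1728 * I12 p ^ 5"
proof -
  \<comment> \<open>\<open>I20\<close>, \<open>I30\<close> and the fifth power of \<open>I12\<close>
    depend only on fifth powers of the coordinates, which lowers the identity from degree 60 to
    degree 12.\<close>
  define x y where "x = fst p ^ 5" and "y = snd p ^ 5"
  have pw: "a ^ 30 = (a ^ 5) ^ 6" "a ^ 25 = (a ^ 5) ^ 5" "a ^ 20 = (a ^ 5) ^ 4" "a ^ 15 = (a ^ 5) ^ 3" "a ^ 10 = (a ^ 5) ^ 2"
    for a :: complex
    by (simp_all flip: power_mult)
  have "I12 p = fst p * snd p * (fst p ^ 10 + 11 * fst p ^ 5 * snd p ^ 5 - snd p ^ 10)"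
    unfolding I12_def Let_def by algebra
  then have "I12 p ^ 5 = (fst p * snd p * (fst p ^ 10 + 11 * fst p ^ 5 * snd p ^ 5 - snd p ^ 10)) ^ 5"
    by simp
  also have "\<dots> = x * y * (x ^ 2 + 11 * x * y - y ^ 2) ^ 5"
    unfolding power_mult_distrib pw x_def y_def ..
  finally have f: "I12 p ^ 5 = x * y * (x ^ 2 + 11 * x * y - y ^ 2) ^ 5" .
  have h: "I20 p = x ^ 4 - 228 * x ^ 3 * y + 494 * x ^ 2 * y ^ 2 + 228 * x * y ^ 3 + y ^ 4"
    unfolding I20_def Let_def pw x_def y_def ..
  have t: "I30 p = x ^ 6 + 522 * x ^ 5 * y - 10005 * x ^ 4 * y ^ 2 - 10005 * x ^ 2 * y ^ 4 - 522 * x * y ^ 5 + y ^ 6"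
    unfolding I30_def Let_def pw x_def y_def ..
  show ?thesis unfolding f h t by algebra
qed

text \<open>The multiplier \<open>\<kappa>\<close> of \<open>I12\<close> under a group element satisfies \<open>\<kappa> ^ 6 = \<kappa> ^ 5\<close> by the syzygy.\<close>

theorem I_invariant:
  assumes "g \<in> Istar"
  shows "I12 (mat_act g p) = I12 p" "I20 (mat_act g p) = I20 p" "I30 (mat_act g p) = I30 p"
proof -
  obtain \<kappa> where k: "\<And>p. I12 (mat_act g p) = \<kappa> * I12 p"
    using I12_semiinvariant[OF assms] by blast
  obtain a b c d where g: "g = (a, b, c, d)" by (cases g) auto
  have SU: "(a, b, c, d) \<in> SU2" using Istar_SU2[OF assms] g by simp
  have det: "a * d - b * c = 1" using SU2_form(3)[OF SU] .
  let ?g = "mat_act (a, b, c, d)"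
  have k': "I12 (?g p) = \<kappa> * I12 p" for p using k g by simp
  note d1 = partials_mat_act[OF has_partials_I(1) has_partials_I(1) k']
  note d11 = partials_mat_act[OF has_partials_linear_comb[OF has_partials_I(2,3)] has_partials_I(2) d1(1)]
  note d22 = partials_mat_act[OF has_partials_linear_comb[OF has_partials_I(2,3)] has_partials_I(3) d1(2)]
  \<comment> \<open>The Hessian determinant acquires the square of the determinant of the matrix,
    which is 1, while each entry carries one factor \<kappa>.\<close>
  have h20: "I20 (?g p) = \<kappa>^2 * I20 p" for p
  proof -
    have "(a * d - b * c)^2 * (I12_xx (?g p) * I12_yy (?g p) - I12_xy (?g p) * I12_xy (?g p))
       = (a * (a * I12_xx (?g p) + c * I12_xy (?g p)) + c * (a * I12_xy (?g p) + c * I12_yy (?g p)))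
         * (b * (b * I12_xx (?g p) + d * I12_xy (?g p)) + d * (b * I12_xy (?g p) + d * I12_yy (?g p)))
       - (b * (a * I12_xx (?g p) + c * I12_xy (?g p)) + d * (a * I12_xy (?g p) + c * I12_yy (?g p)))^2"
      by algebra
    also have "\<dots> = (\<kappa> * I12_xx p) * (\<kappa> * I12_yy p) - (\<kappa> * I12_xy p)^2"
      unfolding d11 d22 ..
    also have "\<dots> = \<kappa>^2 * (I12_xx p * I12_yy p - I12_xy p * I12_xy p)" by algebra
    finally show ?thesis
      unfolding det I20_hessian by simp
  qed
  note e = partials_mat_act[OF has_partials_I(4) has_partials_I(4) h20]
  \<comment> \<open>The Jacobian acquires the determinant 1 and the product of the multipliers
    \<kappa> and \<kappa>^2.\<close>
  have h30: "I30 (?g p) = \<kappa>^3 * I30 p" for p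
  proof -
    have "(a * d - b * c) * (I12_x (?g p) * I20_y (?g p) - I12_y (?g p) * I20_x (?g p))
      = (a * I12_x (?g p) + c * I12_y (?g p)) * (b * I20_x (?g p) + d * I20_y (?g p))
      - (b * I12_x (?g p) + d * I12_y (?g p)) * (a * I20_x (?g p) + c * I20_y (?g p))"
      by algebra
    also have "\<dots> = (\<kappa> * I12_x p) * (\<kappa>^2 * I20_y p) - (\<kappa> * I12_y p) * (\<kappa>^2 * I20_x p)"
      unfolding d1 e ..
    also have "\<dots> = \<kappa>^3 * (I12_x p * I20_y p - I12_y p * I20_x p)" by algebra
    finally show ?thesis
      unfolding det I30_jacobian by simp
  qed
  \<comment> \<open>A point where \<open>I12\<close> is nonzero: it allows cancellation in the
    syzygy and also excludes \<kappa> = 0.\<close>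
  let ?o = "(1, 1) :: C2pt"
  have o: "I12 ?o = 11" by (simp add: I12_def)
  have "1728 * (\<kappa> * I12 ?o)^5 = (\<kappa>^3 * I30 ?o)^2 - (\<kappa>^2 * I20 ?o)^3"
    using klein_syzygy[of "?g ?o"] unfolding k' h20 h30 by simp
  also have "\<dots> = \<kappa>^6 * (1728 * I12 ?o ^ 5)"
    unfolding klein_syzygy[symmetric] by algebra
  finally have "\<kappa>^5 = \<kappa>^6"
    unfolding o by (simp add: power_mult_distrib)
  moreover have "\<kappa> \<noteq> 0"
    using k[of "mat_act (mat_inv2 g) ?o"] mat_act_inv(1)[OF Istar_SU2[OF assms]] o by auto
  ultimately have "\<kappa> = 1"
    by (simp add: numeral_eq_Suc)
  then show "I12 (mat_act g p) = I12 p" "I20 (mat_act g p) = I20 p" "I30 (mat_act g p) = I30 p"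
    using k' h20 h30 g by simp_all
qed

section \<open>Explicit elements of the group\<close>

lemma diag_Istar:
  assumes "z ^ 10 = 1"
  shows "(z, 0, 0, cnj z) \<in> Istar"
proof (rule Istar_I)
  have "cmod z ^ 10 = 1" using assms by (metis norm_one norm_power)
  then have "cmod z = 1" using power_eq_1_iff[of "cmod z" 10] by simp
  then have zz: "cnj z * z = 1"
    by (simp add: mult.commute[of "cnj _"] complex_norm_square[symmetric])
  then show "(z, 0, 0, cnj z) \<in> SU2"
    using SU2_I[of z 0] by simp
  have c10: "cnj z ^ 10 = 1"
    using arg_cong[OF assms, of cnj] by simp
  have e: "(z * x) ^ 11 * (cnj z * y) = z ^ 10 * (cnj z * z) * (x ^ 11 * y)"
     "(z * x) ^ 6 * (cnj z * y) ^ 6 = (cnj z * z) ^ 6 * (x ^ 6 * y ^ 6)"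
     "(z * x) * (cnj z * y) ^ 11 = cnj z ^ 10 * (cnj z * z) * (x * y ^ 11)" for x y
    by (simp_all add: power_mult_distrib numeral_eq_Suc mult_ac)
  have "I12 (z * x, cnj z * y) = I12 (x, y)" for x y
    unfolding I12_def Let_def fst_conv snd_conv
    by (simp only: mult.assoc[of 11] e zz assms c10 mult_1_left mult_1_right power_one)
  then show "I12 (mat_act (z, 0, 0, cnj z) p) = I12 p" for p
    by (cases p) (simp add: mat_act_def)
qed

text \<open>This matrix lifts w \<mapsto> -1/w and so exchanges the vertices 0 and \<infinity>; the
  diagonal ones lift w \<mapsto> z^2 w and fix both.\<close>

lemma flip_Istar: "(0, - 1, 1, 0) \<in> Istar"
  by (rule Istar_I) (simp_all add: SU2_def I12_def mat_act_def Let_def algebra_simps)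

text \<open>The golden ratio; \<open>sig\<close> is the factor that makes \<open>sgen\<close>
  unitary.\<close>

definition phi :: complex where "phi = of_real ((1 + sqrt 5) / 2)"
definition sig :: complex where "sig = of_real (1 / sqrt (1 + ((1 + sqrt 5) / 2)\<^sup>2))"

lemma phi_sq: "phi ^ 2 = phi + 1"
proof -
  have "((1 + sqrt 5) / 2)\<^sup>2 = (1 + sqrt 5) / 2 + 1"
    by (simp add: power2_eq_square field_simps)
  from arg_cong[OF this, of complex_of_real] show ?thesis
    by (simp only: phi_def of_real_power of_real_add of_real_1)
qed

lemma sig_sq: "sig ^ 2 * (1 + phi ^ 2) = 1"
proof -
  have "1 + ((1 + sqrt 5) / 2)\<^sup>2 > 0" by (simp add: add_pos_nonneg)
  then have "(1 / sqrt (1 + ((1 + sqrt 5) / 2)\<^sup>2))\<^sup>2 * (1 + ((1 + sqrt 5) / 2)\<^sup>2) = 1"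
    by (simp add: power_divide)
  from arg_cong[OF this, of complex_of_real] show ?thesis
    by (simp only: phi_def sig_def of_real_power of_real_add of_real_1 of_real_mult)
qed

lemma cnj_phi_sig: "cnj phi = phi" "cnj sig = sig"
  by (simp_all add: phi_def sig_def)

text \<open>A half-turn, since the trace is 0. It takes \<infinity> to the vertex
  \<open>- phi\<close> and so links the poles with the other ten vertices.\<close>

definition sgen :: mat2 where
  "sgen = (- \<i> * phi * sig, \<i> * sig, \<i> * sig, \<i> * phi * sig)"

text \<open>Over \<open>\<rat>(\<surd>5)\<close>, which contains \<open>phi\<close>, the form \<open>I12\<close> splits into six quadratic factors,
  which \<open>sgen\<close> permutes up to scalars.\<close>

lemma I12_factor:
  "I12 (x, y) = (x * y) * (x^2 + x*y - y^2)
     * ((x^2 + x*y + phi^2*y^2) * (x^2 + x*y + (2 - phi)*y^2))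
     * ((x^2 - phi^2*x*y + phi^2*y^2) * (x^2 - (2 - phi)*x*y + (2 - phi)*y^2))"
proof -
  have "(x^2 + x*y + phi^2*y^2) * (x^2 + x*y + (2 - phi)*y^2) = x^4 + 2*x^3*y + 4*x^2*y^2 + 3*x*y^3 + y^4"
    using phi_sq by algebra
  moreover have "(x^2 - phi^2*x*y + phi^2*y^2) * (x^2 - (2 - phi)*x*y + (2 - phi)*y^2)
     = x^4 - 3*x^3*y + 4*x^2*y^2 - 2*x*y^3 + y^4"
    using phi_sq by algebra
  moreover have "I12 (x, y) = (x * y) * (x^2 + x*y - y^2) * (x^4 + 2*x^3*y + 4*x^2*y^2 + 3*x*y^3 + y^4)
     * (x^4 - 3*x^3*y + 4*x^2*y^2 - 2*x*y^3 + y^4)"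
    unfolding I12_def Let_def fst_conv snd_conv by algebra
  ultimately show ?thesis by (simp only:)
qed

lemma sgen_Istar: "sgen \<in> Istar"
proof (rule Istar_I)
  have "cnj (- \<i> * phi * sig) * (- \<i> * phi * sig) + cnj (\<i> * sig) * (\<i> * sig) = 1"
  proof -
    have "cnj (- \<i> * phi * sig) * (- \<i> * phi * sig) + cnj (\<i> * sig) * (\<i> * sig)
        = - (\<i> * \<i>) * (sig ^ 2 * (1 + phi ^ 2))"
      unfolding complex_cnj_mult complex_cnj_minus complex_cnj_i cnj_phi_sig by algebra
    then show ?thesis by (simp add: sig_sq)
  qed
  from SU2_I[OF this] show "sgen \<in> SU2"
    by (simp add: sgen_def cnj_phi_sig)
  fix p :: C2pt
  obtain x y where p: "p = (x, y)" by (cases p)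
  let ?X = "- phi * x + y" and ?Y = "x + phi * y"
  \<comment> \<open>The first two factors of \<open>I12\<close> are exchanged, and so are the fourth
    and the fifth; the third and the sixth are fixed, all up to scalars.\<close>
  have q1: "?X * ?Y = - phi * (x^2 + x*y - y^2)"
    using phi_sq by algebra
  have q2: "?X^2 + ?X*?Y - ?Y^2 = - 5 * phi * (x * y)"
    using phi_sq by algebra
  have q3: "?X^2 + ?X*?Y + phi^2*?Y^2 = (2 + phi) * (x^2 + x*y + phi^2*y^2)"
    using phi_sq by algebra
  have q4: "?X^2 + ?X*?Y + (2 - phi)*?Y^2 = (3 - phi) * (x^2 - phi^2*x*y + phi^2*y^2)"
    using phi_sq by algebra
  have q5: "?X^2 - phi^2*?X*?Y + phi^2*?Y^2 = (3 + 4 * phi) * (x^2 + x*y + (2 - phi)*y^2)"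
    using phi_sq by algebra
  have q6: "?X^2 - (2 - phi)*?X*?Y + (2 - phi)*?Y^2 = (2 + phi) * (x^2 - (2 - phi)*x*y + (2 - phi)*y^2)"
    using phi_sq by algebra
  have c: "(2 + phi)^2 = 5 * phi^2" "(3 - phi) * (3 + 4 * phi) = 5 * phi^2"
    using phi_sq by algebra+
  \<comment> \<open>The scalars combine to \<open>(1 + phi^2)^6\<close>, which the twelfth power of
    \<open>\<i> * sig\<close> cancels by \<open>sig_sq\<close>.\<close>
  have s2: "5 * phi^2 = (1 + phi^2)^2"
    using phi_sq by algebra
  have "I12 (?X, ?Y) = (5 * phi^2)^3 * I12 (x, y)"
  proof -
    have "I12 (?X, ?Y) = (5 * phi^2) * (2 + phi)^2 * ((3 - phi) * (3 + 4 * phi)) * I12 (x, y)"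
      unfolding I12_factor[of ?X ?Y] q2 q3 q4 q5 q6 unfolding q1 I12_factor[of x y]
      by (simp only: power2_eq_square mult_ac minus_mult_minus mult_minus_left mult_minus_right minus_minus)
    then show ?thesis
      unfolding c by (simp only: power3_eq_cube)
  qed
  then have X: "I12 (?X, ?Y) = (1 + phi^2)^6 * I12 (x, y)"
    unfolding s2 by (simp flip: power_mult)
  have "mat_act sgen p = ((\<i> * sig) * fst (?X, ?Y), (\<i> * sig) * snd (?X, ?Y))"
    by (simp add: sgen_def mat_act_def p algebra_simps)
  then have "I12 (mat_act sgen p) = (\<i> * sig)^12 * I12 (?X, ?Y)"
    by (simp only: I_hom hom_scale)
  also have "\<dots> = (sig ^ 2 * (1 + phi ^ 2))^6 * I12 (x, y)"
    unfolding X by (simp add: power_mult_distrib i_even_power flip: power_mult)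
  finally show "I12 (mat_act sgen p) = I12 p"
    by (simp add: sig_sq p)
qed

subsection \<open>Klein's theorem on icosahedral invariants\<close>

definition invariant_form :: "complex poly \<Rightarrow> nat \<Rightarrow> bool" where
  "invariant_form q k \<longleftrightarrow> (\<forall>g\<in>Istar. \<forall>p. hom q k (mat_act g p) = hom q k p)"

lemma invariant_formD:
  "invariant_form q k \<Longrightarrow> g \<in> Istar \<Longrightarrow> hom q k (mat_act g p) = hom q k p"
  by (simp only: invariant_form_def)

lemma odd_invariant_form_zero:
  assumes "degree q \<le> k" "invariant_form q k" "odd k"
  shows "q = 0"
proof -
  have "(- 1, 0, 0, cnj (- 1)) \<in> Istar" by (rule diag_Istar) simp
  then have "hom q k p = hom q k (- 1 * fst p, - 1 * snd p)" for p
    using invariant_formD[OF assms(2), of "(- 1, 0, 0, cnj (- 1))" p] by (simp add: mat_act_def)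
  then have "hom q k p = hom 0 k p" for p
    unfolding hom_scale using assms(3) by (simp add: hom_def[of 0])
  then show ?thesis
    using hom_inj[OF assms(1), of 0] by simp
qed

text \<open>This is transitivity on the vertices: \<open>sgen\<close> leads from \<infinity> to
  \<open>- phi\<close>, rotations to the five points with z^5 = -phi^5, and the flip to the other
  five and to 0.\<close>

lemma vertex_vanish_imp_all:
  assumes inv: "invariant_form q k" and zero: "hom q k (1, 0) = 0" and "w \<in> V_I"
  shows "hom q k (pt w) = 0"
proof -
  have phi0: "phi \<noteq> 0" and sig0: "sig \<noteq> 0"
    using phi_sq sig_sq by auto
  have flip: "hom q k (- y, x) = hom q k (x, y)" for x y
    using invariant_formD[OF inv flip_Istar, of "(x, y)"] by (simp add: mat_act_def)
  have phi: "hom q k (- phi, 1) = 0"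
  proof -
    have "mat_act sgen (1, 0) = ((\<i> * sig) * fst ((- phi, 1) :: C2pt), (\<i> * sig) * snd ((- phi, 1) :: C2pt))"
      by (simp add: sgen_def mat_act_def mult_ac)
    then have "(\<i> * sig) ^ k * hom q k (- phi, 1) = hom q k (1, 0)"
      using invariant_formD[OF inv sgen_Istar, of "(1, 0)"] by (simp only: hom_scale)
    then show ?thesis using zero sig0 by simp
  qed
  have orbit: "hom q k (z, 1) = 0" if "z ^ 5 = - (phi ^ 5)" for z
  proof -
    define \<omega> where "\<omega> = z / - phi"
    have w5: "\<omega> ^ 5 = 1"
      using that phi0 by (simp add: \<omega>_def power_divide)
    \<comment> \<open>A square root of \<omega>, since \<omega>^6 = \<omega>; the diagonal matrix of
      \<zeta> rotates by \<zeta>^2.\<close>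
    define \<zeta> where "\<zeta> = \<omega> ^ 3"
    have "\<zeta> ^ 10 = (\<omega> ^ 5) ^ 6" by (simp add: \<zeta>_def flip: power_mult)
    then have z10: "\<zeta> ^ 10 = 1" by (simp add: w5)
    have "\<zeta> ^ 2 = \<omega> ^ 5 * \<omega>" by (simp add: \<zeta>_def numeral_eq_Suc)
    then have z2: "\<zeta> ^ 2 = \<omega>" by (simp add: w5)
    have "cmod \<zeta> ^ 10 = 1" using z10 by (metis norm_one norm_power)
    then have "cmod \<zeta> = 1" using power_eq_1_iff[of "cmod \<zeta>" 10] by simp
    then have zz: "cnj \<zeta> * \<zeta> = 1"
      by (simp add: mult.commute[of "cnj _"] complex_norm_square[symmetric])
    have "\<zeta> * - phi = cnj \<zeta> * z"
    proof -
      have "cnj \<zeta> * z = cnj \<zeta> * (\<zeta> ^ 2 * - phi)"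
        using phi0 by (simp add: z2 \<omega>_def)
      also have "\<dots> = (cnj \<zeta> * \<zeta>) * (\<zeta> * - phi)"
        by (simp add: power2_eq_square)
      finally show ?thesis by (simp add: zz)
    qed
    then have "mat_act (\<zeta>, 0, 0, cnj \<zeta>) (- phi, 1) = (cnj \<zeta> * fst ((z, 1) :: C2pt), cnj \<zeta> * snd ((z, 1) :: C2pt))"
      by (simp add: mat_act_def)
    then have "cnj \<zeta> ^ k * hom q k (z, 1) = hom q k (- phi, 1)"
      using invariant_formD[OF inv diag_Istar[OF z10], of "(- phi, 1)"] by (simp only: hom_scale)
    moreover have "cnj \<zeta> \<noteq> 0" using zz by auto
    ultimately show ?thesis using phi by simp
  qed
  show ?thesis
  proof (cases w)
    case None
    then show ?thesis using zero by (simp add: pt_def)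
  next
    case (Some z)
    then consider "z = 0" | "z ^ 10 + 11 * z ^ 5 - 1 = 0"
      using assms(3) by (auto simp: V_I_def)
    then show ?thesis
    proof cases
      case 1
      then show ?thesis using Some zero flip[of 0 1] flip[of 1 0] by (simp add: pt_def)
    next
      case 2
      then have z0: "z \<noteq> 0" by auto
      \<comment> \<open>Consequently z^5 is -phi^5 or 1/phi^5 at the remaining ten vertices, and the
        flip maps the second five into the first.\<close>
      have p5: "phi ^ 10 = 11 * phi ^ 5 + 1"
        using phi_sq by algebra
      have "(z ^ 5 + phi ^ 5) * (phi ^ 5 * z ^ 5 - 1) = phi ^ 5 * (z ^ 10 + 11 * z ^ 5 - 1)"
        using p5 by algebra
      then have "z ^ 5 + phi ^ 5 = 0 \<or> phi ^ 5 * z ^ 5 - 1 = 0"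
        using 2 by simp
      then show ?thesis
      proof
        assume "z ^ 5 + phi ^ 5 = 0"
        then have "z ^ 5 = - (phi ^ 5)" by (simp add: eq_neg_iff_add_eq_0)
        then show ?thesis using orbit Some by (simp add: pt_def)
      next
        assume "phi ^ 5 * z ^ 5 - 1 = 0"
        then have "phi ^ 5 = 1 / z ^ 5" using z0 by (simp add: field_simps)
        then have "(- 1 / z) ^ 5 = - (phi ^ 5)"
          by (simp add: power_divide)
        from orbit[OF this] have "hom q k (- 1 / z, 1) = 0" .
        moreover have "hom q k (- 1, z) = z ^ k * hom q k (- 1 / z, 1)"
          using hom_scale[of q k z "(- 1 / z, 1)"] z0 by simp
        ultimately show ?thesis
          using flip[of 1 z] Some by (simp add: pt_def)
      qed
    qed
  qed
qed

text \<open>A primitive tenth root of unity scales the value at (1, 0) by \<zeta>^k. In degree 10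
  the rotations and the flip leave only multiples of \<alpha>^10 + \<beta>^10, and
  \<open>sgen\<close> would require a negative real number to equal 1.\<close>

lemma nonvanishing_degree:
  assumes inv: "invariant_form q k" and nz: "hom q k (1, 0) \<noteq> 0" and dq: "degree q \<le> k"
  shows "10 dvd k" "k \<noteq> 10"
proof -
  define \<zeta> where "\<zeta> = exp (2 * of_real pi * \<i> * of_nat 1 / of_nat 10)"
  have pow: "\<zeta> ^ n = exp (2 * of_real pi * \<i> * of_nat n / of_nat 10)" for n
    unfolding \<zeta>_def by (simp add: mult_ac flip: exp_of_nat_mult)
  have root: "\<zeta> ^ n = 1 \<longleftrightarrow> 10 dvd n" for n
    unfolding pow by (rule complex_root_unity_eq_1) simp
  then have z10: "\<zeta> ^ 10 = 1" by simp
  have "mat_act (\<zeta>, 0, 0, cnj \<zeta>) (1, 0) = (\<zeta> * fst ((1, 0) :: C2pt), \<zeta> * snd ((1, 0) :: C2pt))"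
    by (simp add: mat_act_def)
  then have "\<zeta> ^ k * hom q k (1, 0) = hom q k (1, 0)"
    using invariant_formD[OF inv diag_Istar[OF z10], of "(1, 0)"] by (simp only: hom_scale)
  then show "10 dvd k" using nz root by simp
  show "k \<noteq> 10"
  proof
    assume k: "k = 10"
    have "cmod \<zeta> ^ 10 = 1" using z10 by (metis norm_one norm_power)
    then have "cmod \<zeta> = 1" using power_eq_1_iff[of "cmod \<zeta>" 10] by simp
    then have zz: "cnj \<zeta> * \<zeta> = 1"
      by (simp add: mult.commute[of "cnj _"] complex_norm_square[symmetric])
    \<comment> \<open>In degree 10 the factor \<open>cnj \<zeta> ^ k\<close> is 1, so
      \<open>q\<close> is fixed by z \<mapsto> \<zeta>^2 z; hence only exponents divisible by 5
      survive.\<close>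
    have "poly (pcompose q [:0, \<zeta> ^ 2:]) z = poly q z" for z
    proof -
      have "cnj \<zeta> * (\<zeta> ^ 2 * z) = (cnj \<zeta> * \<zeta>) * (\<zeta> * z)" by (simp add: power2_eq_square)
      then have "mat_act (\<zeta>, 0, 0, cnj \<zeta>) (z, 1) = (cnj \<zeta> * fst ((\<zeta> ^ 2 * z, 1) :: C2pt), cnj \<zeta> * snd ((\<zeta> ^ 2 * z, 1) :: C2pt))"
        by (auto simp: mat_act_def zz)
      then have "cnj \<zeta> ^ k * hom q k (\<zeta> ^ 2 * z, 1) = hom q k (z, 1)"
        using invariant_formD[OF inv diag_Istar[OF z10], of "(z, 1)"] by (simp only: hom_scale)
      moreover have "cnj \<zeta> ^ k = 1"
        using arg_cong[OF z10, of cnj] k by simp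
      ultimately show ?thesis
        using hom_at_1[OF dq] by (simp add: poly_pcompose mult.commute)
    qed
    then have "pcompose q [:0, \<zeta> ^ 2:] = q"
      by (metis poly_eq_poly_eq_iff ext)
    then have "(\<zeta> ^ 2) ^ i * coeff q i = coeff q i" for i
      by (metis coeff_pcompose_linear)
    then have "coeff q i = 0 \<or> \<zeta> ^ (2 * i) = 1" for i
      by (metis mult_cancel_right1 power_mult)
    then have c: "coeff q i = 0" if "\<not> 5 dvd i" for i
      using that root[of "2 * i"] by auto
    have h: "hom q k (x, y) = coeff q 0 * y ^ 10 + coeff q 5 * (x ^ 5 * y ^ 5) + coeff q 10 * x ^ 10" for x y
    proof -
      have "hom q k (x, y) = (\<Sum>i\<in>{0, 5, 10}. coeff q i * (x ^ i * y ^ (10 - i)))"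
        unfolding hom_def k fst_conv snd_conv
      proof (rule sum.mono_neutral_right)
        have "i = 0 \<or> i = 5 \<or> i = 10" if "i \<le> 10" "5 dvd i" for i :: nat
          using that by presburger
        then show "\<forall>i\<in>{..10} - {0, 5, 10}. coeff q i * (x ^ i * y ^ (10 - i)) = 0"
          using c by auto
      qed auto
      then show ?thesis by simp
    qed
    have flip: "hom q k (- y, x) = hom q k (x, y)" for x y
      using invariant_formD[OF inv flip_Istar, of "(x, y)"] by (simp add: mat_act_def)
    have c5: "coeff q 5 = 0" and c0: "coeff q 0 = coeff q 10"
      using flip[of 1 1] flip[of 1 0] by (simp_all add: h)
    define r where "r = 1 / sqrt (1 + ((1 + sqrt 5) / 2)\<^sup>2)"
    define t where "t = (1 + sqrt 5) / 2"
    have "mat_act sgen (1, 0) = (- \<i> * phi * sig, \<i> * sig)"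
      by (simp add: sgen_def mat_act_def)
    then have "coeff q 10 * ((\<i> * sig) ^ 10 + (- \<i> * phi * sig) ^ 10) = coeff q 10"
      using invariant_formD[OF inv sgen_Istar, of "(1, 0)"] by (simp add: h c5 c0 distrib_left)
    moreover have "coeff q 10 \<noteq> 0" using nz by (simp add: hom_1_0 k)
    ultimately have "(\<i> * sig) ^ 10 + (- \<i> * phi * sig) ^ 10 = 1" by simp
    moreover have "(\<i> * sig) ^ 10 + (- \<i> * phi * sig) ^ 10 = of_real (- (r ^ 10) - t ^ 10 * r ^ 10)"
    proof -
      have "\<i> ^ 10 = (\<i> ^ 2) ^ 5" by (simp flip: power_mult)
      then have i10: "\<i> ^ 10 = - 1" by simp
      have "(- \<i> * phi * sig) ^ 10 = \<i> ^ 10 * phi ^ 10 * sig ^ 10"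
        by (simp add: power_mult_distrib)
      then show ?thesis
        unfolding power_mult_distrib[of \<i> sig] i10 by (simp add: phi_def sig_def t_def r_def)
    qed
    ultimately have "- (r ^ 10) - t ^ 10 * r ^ 10 = 1"
      by (metis of_real_eq_1_iff)
    moreover have "r ^ 10 \<ge> 0" "t ^ 10 * r ^ 10 \<ge> 0"
      by (simp_all add: zero_le_even_power)
    ultimately show False by linarith
  qed
qed

inductive ispan :: "nat \<Rightarrow> (C2pt \<Rightarrow> complex) \<Rightarrow> bool" where
  zero: "ispan k (\<lambda>p. 0)"
| monomial: "12 * a + 20 * b + 30 * c = k \<Longrightarrow> c \<le> 1 \<Longrightarrow> ispan k (\<lambda>p. I12 p ^ a * I20 p ^ b * I30 p ^ c)"
| add: "ispan k f \<Longrightarrow> ispan k g \<Longrightarrow> ispan k (\<lambda>p. f p + g p)"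
| scale: "ispan k f \<Longrightarrow> ispan k (\<lambda>p. x * f p)"

lemma ispan_mult_I12: "ispan k f \<Longrightarrow> ispan (k + 12) (\<lambda>p. I12 p * f p)"
proof (induction rule: ispan.induct)
  case (zero k)
  then show ?case using ispan.zero by simp
next
  case (monomial a b c k)
  then show ?case
    using ispan.monomial[of "Suc a" b c "k + 12"] by (simp add: mult.assoc)
next
  case (add k f g)
  from ispan.add[OF add.IH] show ?case by (simp add: distrib_left)
next
  case (scale k f x)
  from ispan.scale[OF scale.IH, of x] show ?case by (simp add: mult.left_commute)
qed

definition mono_form :: "nat \<Rightarrow> nat \<Rightarrow> nat \<Rightarrow> complex poly" where
  "mono_form a b c = K12 ^ a * K20 ^ b * K30 ^ c"

lemma degree_mono_form: "degree (mono_form a b c) \<le> 12 * a + 20 * b + 30 * c"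
  unfolding mono_form_def
  using degree_mult_le[of "K12 ^ a * K20 ^ b" "K30 ^ c"] degree_mult_le[of "K12 ^ a" "K20 ^ b"]
    degree_power_le'[OF degree_K(1), of a] degree_power_le'[OF degree_K(2), of b] degree_power_le'[OF degree_K(3), of c]
  by linarith

lemma hom_mono_form: "hom (mono_form a b c) (12 * a + 20 * b + 30 * c) p = I12 p ^ a * I20 p ^ b * I30 p ^ c"
proof -
  have d: "degree (K12 ^ a * K20 ^ b) \<le> 12 * a + 20 * b"
    using degree_mult_le[of "K12 ^ a" "K20 ^ b"]
      degree_power_le'[OF degree_K(1), of a] degree_power_le'[OF degree_K(2), of b] by linarith
  show ?thesis
    unfolding mono_form_def
    by (simp only: hom_mult[OF d degree_power_le'[OF degree_K(3)]]
        hom_mult[OF degree_power_le'[OF degree_K(1)] degree_power_le'[OF degree_K(2)]]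
        hom_power[OF degree_K(1)] hom_power[OF degree_K(2)] hom_power[OF degree_K(3)] I_hom)
qed

text \<open>\<open>I12\<close> is invariant without any character, so it can be cancelled.
  Cancelling in the polynomial ring handles the zeros of \<open>I12\<close> too.\<close>

lemma invariant_factor:
  assumes "degree r \<le> l" "invariant_form (K12 * r) (12 + l)"
  shows "invariant_form r l"
  unfolding invariant_form_def
proof (intro ballI allI)
  fix g p assume g: "g \<in> Istar"
  obtain r' where r': "degree r' \<le> l" "\<And>p. hom r' l p = hom r l (mat_act g p)"
    using hom_mat_act[OF assms(1)] by blast
  have h: "hom (K12 * s) (12 + l) p = I12 p * hom s l p" if "degree s \<le> l" for s p
    using hom_mult[OF degree_K(1) that] by (simp add: I_hom)
  have "hom (K12 * r') (12 + l) p = hom (K12 * r) (12 + l) p" for p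
  proof -
    have "hom (K12 * r') (12 + l) p = I12 (mat_act g p) * hom r l (mat_act g p)"
      using h[OF r'(1)] r'(2) I_invariant(1)[OF g] by simp
    also have "\<dots> = hom (K12 * r) (12 + l) p"
      using h[OF assms(1)] invariant_formD[OF assms(2) g] by simp
    finally show ?thesis .
  qed
  moreover have "degree (K12 * s) \<le> 12 + l" if "degree s \<le> l" for s
    using degree_mult_le[of K12 s] degree_K(1) that by linarith
  ultimately have "K12 * r' = K12 * r"
    using hom_inj[of "K12 * r'" "12 + l" "K12 * r"] r'(1) assms(1) by blast
  moreover have "K12 \<noteq> 0" using degree_K12 by auto
  ultimately have "r' = r" by simp
  then show "hom r l (mat_act g p) = hom r l p"
    using r'(2) by simp
qed

theorem klein_invariants:
  assumes "degree q \<le> k" "invariant_form q k"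
  shows "ispan k (hom q k)"
  using assms
proof (induction k arbitrary: q rule: less_induct)
  case (less k)
  \<comment> \<open>Stated for every form of degree \<open>k\<close>, since it is also applied to
    the given form minus a multiple of \<open>?M\<close>.\<close>
  have vanishing: "ispan k (hom q k)"
    if dq: "degree q \<le> k" and inv: "invariant_form q k" and zero: "hom q k (1, 0) = 0" for q
  proof (cases "q = 0")
    case True
    then show ?thesis
      using ispan.zero by (simp add: hom_def[abs_def])
  next
    case False
    obtain r where r: "12 \<le> k" "degree r \<le> k - 12" "q = K12 * r"
      using vertices_vanish_imp_factor[OF dq vertex_vanish_imp_all[OF inv zero] False] by blast
    define l where "l = k - 12"
    have k: "k = 12 + l" and lk: "l < k" and dl: "degree r \<le> l"
      using r(1,2) by (simp_all add: l_def)
    have "invariant_form r l"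
      by (rule invariant_factor[OF dl inv[unfolded r(3) k]])
    then have "ispan l (hom r l)"
      by (rule less.IH[OF lk dl])
    moreover have "hom q k = (\<lambda>p. I12 p * hom r l p)"
    proof
      fix p
      show "hom q k p = I12 p * hom r l p"
        unfolding r(3) k I_hom(1) by (rule hom_mult[OF degree_K(1) dl])
    qed
    ultimately show ?thesis
      using ispan_mult_I12[of l "hom r l"] unfolding k add.commute[of 12 l] by simp
  qed
  show ?case
  proof (cases "hom q k (1, 0) = 0")
    case True
    then show ?thesis using vanishing less.prems by blast
  next
    case False
    from nonvanishing_degree[OF less.prems(2) False less.prems(1)]
    obtain n where n: "k = 10 * n" "n \<noteq> 1" by auto
    \<comment> \<open>Here \<open>c \<le> 1\<close> arises: an even n takes c = 0, an odd n takes c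
      = 1 and must be at least 3.\<close>
    obtain b c where bc: "n = 2 * b + 3 * c" "c \<le> 1"
    proof (cases "even n")
      case True
      then show ?thesis using that[of "n div 2" 0] by simp
    next
      case False
      then show ?thesis using that[of "(n - 3) div 2" 1] n(2) by (auto elim!: oddE)
    qed
    have k: "12 * 0 + 20 * b + 30 * c = k" using n bc by simp
    let ?M = "mono_form 0 b c"
    have M: "hom ?M k p = I20 p ^ b * I30 p ^ c" for p
      using hom_mono_form[of 0 b c p] unfolding k by simp
    have M1: "hom ?M k (1, 0) = 1"
      unfolding M by (simp add: I20_def I30_def)
    define x where "x = hom q k (1, 0)"
    have "ispan k (hom (q - smult x ?M) k)"
    proof (rule vanishing)
      show "degree (q - smult x ?M) \<le> k"
        using less.prems(1) degree_mono_form[of 0 b c] unfolding k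
        by (intro degree_diff_le order_trans[OF degree_smult_le])
      show "invariant_form (q - smult x ?M) k"
        using less.prems(2) I_invariant unfolding invariant_form_def by (simp add: hom_diff hom_smult M)
      show "hom (q - smult x ?M) k (1, 0) = 0"
        by (simp add: hom_diff hom_smult M1 x_def)
    qed
    moreover have "ispan k (\<lambda>p. x * (I12 p ^ 0 * I20 p ^ b * I30 p ^ c))"
      by (intro ispan.scale ispan.monomial k bc(2))
    ultimately have "ispan k (\<lambda>p. hom (q - smult x ?M) k p + x * (I12 p ^ 0 * I20 p ^ b * I30 p ^ c))"
      by (rule ispan.add)
    also have "(\<lambda>p. hom (q - smult x ?M) k p + x * (I12 p ^ 0 * I20 p ^ b * I30 p ^ c)) = hom q k"
      by (auto simp: hom_diff hom_smult M)
    finally show ?thesis .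
  qed
qed

subsection \<open>Siblings\<close>

definition sib_poly :: "complex poly \<Rightarrow> nat \<Rightarrow> C2pt \<Rightarrow> complex poly" where
  "sib_poly q k p = (\<Sum>a\<le>k. smult (coeff q a) (PE a (k - a) p))"

text \<open>The coefficient of t^j in the form evaluated at p + t J p, that is, the j-th sibling
  divided by \<open>fact j\<close>.\<close>

definition sib :: "complex poly \<Rightarrow> nat \<Rightarrow> nat \<Rightarrow> C2pt \<Rightarrow> complex" where
  "sib q k j p = (\<Sum>a\<le>k. coeff q a * wig a (k - a) j p)"

lemma coeff_sib_poly: "coeff (sib_poly q k p) j = sib q k j p"
  by (simp add: sib_poly_def sib_def wig_def coeff_sum)

lemma poly_sib_poly:
  "poly (sib_poly q k p) t = hom q k (fst p - t * cnj (snd p), snd p + t * cnj (fst p))"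
  by (simp add: sib_poly_def poly_sum hom_def PE_def poly_mult poly_power xi_def eta_def)

lemma twist_minus_hom: "(twist_minus ^^ j) (hom q k) = (\<lambda>p. fact j * sib q k j p)"
proof -
  have "wig a b 0 p = fst p ^ a * snd p ^ b" for a b p
    by (simp add: wig_def PE_def coeff_mult coeff_0_power xi_def eta_def)
  then have "hom q k = (\<lambda>p. \<Sum>a\<le>k. coeff q a * wig a (k - a) 0 p)"
    by (simp add: hom_def[abs_def])
  then show ?thesis
    using twist_minus_funpow_sum_wig[of "{..k}" j "coeff q" k] by (simp add: sib_def)
qed

text \<open>Elements of \<open>SU2\<close> commute with the antilinear map \<open>(\<alpha>, \<beta>) \<mapsto> (- cnj \<beta>, cnj \<alpha>)\<close>.\<close>

lemma sib_mat_act: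
  assumes "g \<in> SU2" "\<And>p. hom q' k p = hom q k (mat_act g p)"
  shows "sib q k j (mat_act g p) = sib q' k j p"
proof -
  obtain a b c d where g: "g = (a, b, c, d)" by (cases g) auto
  have f: "d = cnj a" "b = - cnj c"
    using assms(1) SU2_form g by blast+
  have "poly (sib_poly q k (mat_act g p)) t = poly (sib_poly q' k p) t" for t
    unfolding poly_sib_poly assms(2) by (simp add: g mat_act_def f algebra_simps)
  then have "sib_poly q k (mat_act g p) = sib_poly q' k p"
    by (metis poly_eq_poly_eq_iff ext)
  then show ?thesis
    using coeff_sib_poly by metis
qed

text \<open>Independence over both indices at once: a function on the sphere determines the form
  attached to each \<open>j\<close> separately.\<close>

lemma sib_independent:
  assumes "\<And>x. x \<in> S3 \<Longrightarrow> (\<Sum>j\<le>k. sib (q j) k j x) = 0"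
    and "\<And>j. j \<le> k \<Longrightarrow> degree (q j) \<le> k" "j \<le> k"
  shows "q j = 0"
proof -
  have "(\<Sum>a\<le>k. \<Sum>j\<le>k. coeff (q j) a * wig a (k - a) j x) = 0" if "x \<in> S3" for x
    using assms(1)[OF that] unfolding sib_def by (subst sum.swap)
  then have "coeff (q j) a = 0" if "a \<le> k" for a
    by (rule wig_independent[where c = "\<lambda>a j. coeff (q j) a"]) (use that assms(3) in blast)+
  then show ?thesis
    using assms(2)[OF assms(3)] by (metis le_trans coeff_eq_0 not_le poly_eqI coeff_0)
qed

lemma sib_diff: "sib (q - r) k j x = sib q k j x - sib r k j x"
  by (simp add: sib_def algebra_simps sum_subtractf)

lemma sib_sum_smult: "sib (\<Sum>i\<in>A. smult (c i) (q i)) k j x = (\<Sum>i\<in>A. c i * sib (q i) k j x)"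
proof -
  have "sib (\<Sum>i\<in>A. smult (c i) (q i)) k j x = (\<Sum>a\<le>k. \<Sum>i\<in>A. c i * (coeff (q i) a * wig a (k - a) j x))"
    by (simp add: sib_def coeff_sum sum_distrib_right mult.assoc)
  then show ?thesis
    unfolding sib_def by (subst (asm) sum.swap) (simp add: sum_distrib_left)
qed

section \<open>Modes as sums of siblings of invariant forms\<close>

lemma eigenfun_add:
  assumes "eigenfun k F" "eigenfun k G"
  shows "eigenfun k (\<lambda>x. F x + G x)"
proof -
  obtain D1 D2 E1 E2 where J: "has_jet (ext0 F) D1 D2 (- {0})" "has_jet (ext0 G) E1 E2 (- {0})"
    using assms unfolding eigenfun_def C2_on_iff_jet by blast
  have e: "ext0 (\<lambda>x. F x + G x) = (\<lambda>x. ext0 F x + ext0 G x)"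
    by (simp add: ext0_def[abs_def])
  note J' = has_jet_add[OF J, folded e]
  note o = open_Compl[OF closed_singleton]
  have "lapS3 (\<lambda>x. F x + G x) x = - of_nat (k * (k + 2)) * (F x + G x)" if "x \<in> S3" for x
  proof -
    have x: "x \<in> - {0}" using that by (auto simp: S3_iff_norm)
    have "lapS3 (\<lambda>x. F x + G x) x = lapS3 F x + lapS3 G x"
      unfolding lapS3_def lapR4_eq_jet[OF J' o x] lapR4_eq_jet[OF J(1) o x] lapR4_eq_jet[OF J(2) o x]
      by (simp add: sum.distrib)
    also have "\<dots> = - of_nat (k * (k + 2)) * F x + - of_nat (k * (k + 2)) * G x"
      using assms that by (simp add: eigenfun_def)
    finally show ?thesis by (simp only: distrib_left)
  qed
  then show ?thesis
    using J' unfolding eigenfun_def C2_on_iff_jet by blast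
qed

lemma eigenfun_scale:
  assumes "eigenfun k F"
  shows "eigenfun k (\<lambda>x. c * F x)"
proof -
  obtain D1 D2 where J: "has_jet (ext0 F) D1 D2 (- {0})"
    using assms unfolding eigenfun_def C2_on_iff_jet by blast
  have e: "ext0 (\<lambda>x. c * F x) = (\<lambda>x. c * ext0 F x)"
    by (simp add: ext0_def[abs_def])
  note J' = has_jet_scale[OF J, of c, folded e]
  note o = open_Compl[OF closed_singleton]
  have "lapS3 (\<lambda>x. c * F x) x = - of_nat (k * (k + 2)) * (c * F x)" if "x \<in> S3" for x
  proof -
    have x: "x \<in> - {0}" using that by (auto simp: S3_iff_norm)
    have "lapS3 (\<lambda>x. c * F x) x = c * lapS3 F x"
      unfolding lapS3_def lapR4_eq_jet[OF J' o x] lapR4_eq_jet[OF J o x]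
      by (simp add: sum_distrib_left)
    also have "\<dots> = c * (- of_nat (k * (k + 2)) * F x)"
      using assms that by (simp add: eigenfun_def)
    finally show ?thesis by (simp only: mult.left_commute)
  qed
  then show ?thesis
    using J' unfolding eigenfun_def C2_on_iff_jet by blast
qed

lemma eigenfun_sib: "eigenfun k (restrS3 (sib q k j))"
proof -
  have "eigenfun k (\<lambda>x. \<Sum>a\<in>A. coeff q a * restrS3 (wig a (k - a) j) x)" if "finite A" "A \<subseteq> {..k}" for A
    using that
  proof (induction A rule: finite_induct)
    case empty
    show ?case
      using eigenfun_scale[OF eigenfun_wig[of k 0 j], of 0] by simp
  next
    case (insert a A)
    then show ?case
      using eigenfun_add[OF eigenfun_scale[OF eigenfun_wig[of a "k - a" j], of "coeff q a"]] by simp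
  qed
  from this[of "{..k}"] have "eigenfun k (\<lambda>x. \<Sum>a\<le>k. coeff q a * restrS3 (wig a (k - a) j) x)"
    by simp
  also have "(\<lambda>x. \<Sum>a\<le>k. coeff q a * restrS3 (wig a (k - a) j) x) = restrS3 (sib q k j)"
    by (auto simp: fun_eq_iff restrS3_def sib_def)
  finally show ?thesis .
qed

lemma modes_iff:
  "F \<in> modes \<Gamma> k \<longleftrightarrow> (\<forall>x. x \<notin> S3 \<longrightarrow> F x = 0) \<and> eigenfun k F
     \<and> (\<forall>g\<in>\<Gamma>. \<forall>x\<in>S3. F (mat_act (mat_inv2 g) x) = F x)"
  unfolding modes_def eigenfun_def by blast

lemma sib_in_modes:
  assumes "invariant_form q k"
  shows "restrS3 (\<lambda>x. c * sib q k j x) \<in> modes Istar k"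
proof -
  have r: "restrS3 (\<lambda>x. c * sib q k j x) = (\<lambda>x. c * restrS3 (sib q k j) x)"
    by (simp add: restrS3_def fun_eq_iff)
  have "sib q k j (mat_act (mat_inv2 g) x) = sib q k j x" if g: "g \<in> Istar" for g x
  proof -
    have "sib q k j (mat_act g (mat_act (mat_inv2 g) x)) = sib q k j (mat_act (mat_inv2 g) x)"
      by (rule sib_mat_act[OF Istar_SU2[OF g]]) (simp add: invariant_formD[OF assms g])
    then show ?thesis by (simp add: mat_act_inv(1)[OF Istar_SU2[OF g]])
  qed
  then show ?thesis
    unfolding modes_iff r using eigenfun_scale[OF eigenfun_sib]
      mat_act_S3[OF mat_inv2_SU2[OF Istar_SU2]] by (auto simp: restrS3_def simp del: split_paired_All)
qed

text \<open>Moving the argument by g replaces each form \<open>q j\<close> by its transform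
  \<open>r j\<close> at the same \<open>j\<close>. The mode itself does not change, so uniqueness
  forces \<open>r j = q j\<close>.\<close>

lemma modes_expansion:
  assumes "F \<in> modes Istar k"
  obtains q where "\<And>j. degree (q j) \<le> k" "\<And>j. j \<le> k \<Longrightarrow> invariant_form (q j) k"
    "\<And>x. x \<in> S3 \<Longrightarrow> F x = (\<Sum>j\<le>k. sib (q j) k j x)"
proof -
  have F: "eigenfun k F" "\<forall>g\<in>Istar. \<forall>x\<in>S3. F (mat_act (mat_inv2 g) x) = F x"
    using assms modes_iff by blast+
  obtain c where c: "\<forall>x\<in>S3. F x = (\<Sum>a\<le>k. \<Sum>j\<le>k. c a j * wig a (k - a) j x)"
    using eigenfun_expansion[OF F(1)] by blast
  define q where "q j = (\<Sum>a\<le>k. monom (c a j) a)" for j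
  have dq: "degree (q j) \<le> k" for j
    unfolding q_def by (intro degree_sum_le) (auto intro: order_trans[OF degree_monom_le])
  have "coeff (q j) a = c a j" if "a \<le> k" for a j
    using that by (simp add: q_def coeff_sum)
  then have exp: "F x = (\<Sum>j\<le>k. sib (q j) k j x)" if "x \<in> S3" for x
    using c that unfolding sib_def by (subst sum.swap) simp
  have "invariant_form (q j) k" if j: "j \<le> k" for j
    unfolding invariant_form_def
  proof (intro ballI allI)
    fix g p assume g: "g \<in> Istar"
    note SU = Istar_SU2[OF g]
    have "\<exists>r. degree r \<le> k \<and> (\<forall>p. hom r k p = hom (q j) k (mat_act g p))" for j
      using hom_mat_act[OF dq] by metis
    then obtain r where r: "\<And>j. degree (r j) \<le> k" "\<And>j p. hom (r j) k p = hom (q j) k (mat_act g p)"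
      by metis
    have "(\<Sum>j\<le>k. sib (r j - q j) k j x) = 0" if x: "x \<in> S3" for x
    proof -
      have "(\<Sum>j\<le>k. sib (r j) k j x) = F (mat_act g x)"
        using exp[OF mat_act_S3[OF SU x]] sib_mat_act[OF SU r(2)] by simp
      also have "\<dots> = F x"
        using F(2) g mat_act_S3[OF SU x] mat_act_inv(2)[OF SU, of x] by metis
      finally show ?thesis
        using exp[OF x] by (simp add: sib_diff sum_subtractf)
    qed
    then have "r j - q j = 0"
      by (rule sib_independent) (use dq r(1) j in \<open>auto intro: degree_diff_le\<close>)
    then show "hom (q j) k (mat_act g p) = hom (q j) k p"
      using r(2)[of j p] by simp
  qed
  then show ?thesis using that dq exp by blast
qed

subsection \<open>The basis\<close>

text \<open>From k/2 = 6a + 10b + 15c one reads off c modulo 2, b modulo 3 and a modulo 5, as 15, 10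
  and 6 are 1 modulo 2, 3 and 5. The three floors add up to k/2 plus the quotients of a by 5 and b
  by 3, so the monomial is the member of the family with index \<open>a div 5\<close>.\<close>

lemma monomial_exponents:
  fixes a b c k m :: nat
  assumes "12 * a + 20 * b + 30 * c = k" "c \<le> 1"
  defines "m \<equiv> k div 2"
  shows "m mod 2 = c" "5 * (a div 5) + m mod 5 = a" "ktilde k = int (a div 5 + b div 3)"
    "3 * (b div 3) + m mod 3 = b"
proof -
  have m: "m = 6 * a + 10 * b + 15 * c" using assms by simp
  have m2: "m = c + 2 * (3 * a + 5 * b + 7 * c)" and m3: "m = b + 3 * (2 * a + 3 * b + 5 * c)"
    and m5: "m = a + 5 * (a + 2 * b + 3 * c)"
    using m by simp_all
  have r2: "m mod 2 = c" "m div 2 = 3 * a + 5 * b + 7 * c"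
  proof -
    have "(c + 2 * n) mod 2 = c" "(c + 2 * n) div 2 = n" for n
      using assms(2) by simp_all
    then show "m mod 2 = c" "m div 2 = 3 * a + 5 * b + 7 * c"
      unfolding m2 by blast+
  qed
  have r3: "m mod 3 = b mod 3" "m div 3 = b div 3 + (2 * a + 3 * b + 5 * c)"
    and r5: "m mod 5 = a mod 5" "m div 5 = a div 5 + (a + 2 * b + 3 * c)"
  proof -
    have *: "(x + n * y) mod n = x mod n" "n \<noteq> 0 \<Longrightarrow> (x + n * y) div n = x div n + y" for x y n :: nat
      by simp_all
    show "m mod 3 = b mod 3" "m div 3 = b div 3 + (2 * a + 3 * b + 5 * c)"
      unfolding m3 by (rule *, rule * , simp)
    show "m mod 5 = a mod 5" "m div 5 = a div 5 + (a + 2 * b + 3 * c)"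
      unfolding m5 by (rule *, rule * , simp)
  qed
  show "m mod 2 = c" "5 * (a div 5) + m mod 5 = a" "3 * (b div 3) + m mod 3 = b"
    unfolding r2 r3 r5 by simp_all
  have "m div 2 + m div 3 + m div 5 = m + a div 5 + b div 3"
    unfolding r2 r3 r5 using m by simp
  then show "ktilde k = int (a div 5 + b div 3)"
    unfolding ktilde_def Let_def m_def[symmetric] by linarith
qed

lemma ispan_imp_Bpoly_sum:
  assumes "ispan k f"
  shows "\<exists>c. \<forall>p. f p = (\<Sum>i<nat (ktilde k + 1). c i * Bpoly k i p)"
  using assms
proof induction
  case (zero k)
  show ?case by (rule exI[of _ "\<lambda>_. 0"]) simp
next
  case (monomial a b c k)
  note e = monomial_exponents[OF monomial]
  let ?i = "a div 5"
  have i: "?i < nat (ktilde k + 1)" and n: "nat (ktilde k) - ?i = b div 3"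
    using e(3) by simp_all
  have "Bpoly k ?i p = I12 p ^ a * I20 p ^ b * I30 p ^ c" for p
    unfolding Bpoly_def Let_def n e(1,2,4) ..
  then have "I12 p ^ a * I20 p ^ b * I30 p ^ c = (\<Sum>i<nat (ktilde k + 1). (if i = ?i then 1 else 0) * Bpoly k i p)" for p
    using i by (simp add: if_distrib[of "\<lambda>x. x * _"] cong: if_cong)
  then show ?case by (intro exI[of _ "\<lambda>i. if i = ?i then 1 else 0"]) blast
next
  case (add k f g)
  then obtain c d where "\<forall>p. f p = (\<Sum>i<nat (ktilde k + 1). c i * Bpoly k i p)"
    "\<forall>p. g p = (\<Sum>i<nat (ktilde k + 1). d i * Bpoly k i p)" by blast
  then have "f p + g p = (\<Sum>i<nat (ktilde k + 1). (c i + d i) * Bpoly k i p)" for p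
    by (simp add: distrib_right sum.distrib del: split_paired_All)
  then show ?case by (intro exI[of _ "\<lambda>i. c i + d i"]) blast
next
  case (scale k f x)
  then obtain c where "\<forall>p. f p = (\<Sum>i<nat (ktilde k + 1). c i * Bpoly k i p)" by blast
  then have "x * f p = (\<Sum>i<nat (ktilde k + 1). (x * c i) * Bpoly k i p)" for p
    by (simp add: sum_distrib_left mult.assoc del: split_paired_All)
  then show ?case by (intro exI[of _ "\<lambda>i. x * c i"]) blast
qed

definition bform :: "nat \<Rightarrow> nat \<Rightarrow> complex poly" where
  "bform k i = (let m = k div 2 in
     mono_form (5 * i + m mod 5) (3 * (nat (ktilde k) - i) + m mod 3) (m mod 2))"

lemma bform_degree:
  assumes "even k" "i < nat (ktilde k + 1)"
  shows "12 * (5 * i + (k div 2) mod 5) + 20 * (3 * (nat (ktilde k) - i) + (k div 2) mod 3) + 30 * ((k div 2) mod 2) = k"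
proof -
  define m where "m = k div 2"
  have k: "k = 2 * m" using assms(1) by (simp add: m_def)
  have kt: "ktilde k = int (m div 2) + int (m div 3) + int (m div 5) - int m"
    by (simp add: ktilde_def m_def Let_def)
  define l where "l = nat (ktilde k)"
  have l: "ktilde k = int l" "i \<le> l"
    using assms(2) by (simp_all add: l_def)
  have "m div 2 + m div 3 + m div 5 = m + l" using kt l by linarith
  moreover have "2 * (m div 2) + m mod 2 = m" "3 * (m div 3) + m mod 3 = m" "5 * (m div 5) + m mod 5 = m"
    by simp_all
  \<comment> \<open>The definition of \<open>ktilde\<close> multiplied by 30, with each floor
    expressed through its remainder.\<close>
  ultimately have "30 * l + 6 * (m mod 5) + 10 * (m mod 3) + 15 * (m mod 2) = m"
    by linarith
  then have "6 * (5 * i + m mod 5) + 10 * (3 * (l - i) + m mod 3) + 15 * (m mod 2) = m"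
    using l(2) by (simp add: diff_mult_distrib2)
  then show ?thesis
    unfolding m_def[symmetric] l(1) nat_int using k by linarith
qed

lemma Bpoly_hom:
  assumes "even k" "i < nat (ktilde k + 1)"
  shows "Bpoly k i = hom (bform k i) k" "degree (bform k i) \<le> k" "invariant_form (bform k i) k"
proof -
  note e = bform_degree[OF assms]
  have h: "hom (bform k i) k p = Bpoly k i p" for p
    using hom_mono_form[of "5 * i + (k div 2) mod 5" "3 * (nat (ktilde k) - i) + (k div 2) mod 3" "(k div 2) mod 2" p]
    unfolding e bform_def Bpoly_def Let_def .
  then show "Bpoly k i = hom (bform k i) k" by auto
  show "degree (bform k i) \<le> k"
    using degree_mono_form[of "5 * i + (k div 2) mod 5" "3 * (nat (ktilde k) - i) + (k div 2) mod 3" "(k div 2) mod 2"]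
    unfolding e bform_def Let_def .
  show "invariant_form (bform k i) k"
    unfolding invariant_form_def h by (simp add: Bpoly_def I_invariant)
qed

lemma sibling_eq_sib:
  assumes "even k" "i < nat (ktilde k + 1)"
  shows "sibling k i j = restrS3 (\<lambda>x. fact j * sib (bform k i) k j x)"
  unfolding sibling_def Bpoly_hom(1)[OF assms] twist_minus_hom ..

text \<open>The forms \<open>bform k i\<close> have pairwise distinct orders of vanishing at 0.\<close>

lemma coeff_mono_form:
  shows "n < a \<Longrightarrow> coeff (mono_form a b c) n = 0" and "coeff (mono_form a b c) a \<noteq> 0"
proof -
  define L where "L = monom 1 10 + monom 11 5 - (1 :: complex poly)"
  have K: "K12 = monom 1 1 * L"
    unfolding K12_def L_def distrib_left right_diff_distrib mult_monom by simp
  have "mono_form a b c = monom 1 a * (L ^ a * K20 ^ b * K30 ^ c)"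
    unfolding mono_form_def K by (simp add: power_mult_distrib monom_power mult.assoc)
  then have co: "coeff (mono_form a b c) n = (if n < a then 0 else coeff (L ^ a * K20 ^ b * K30 ^ c) (n - a))" for n
    by (simp add: coeff_monom_mult)
  show "n < a \<Longrightarrow> coeff (mono_form a b c) n = 0"
    by (simp add: co)
  have "coeff (L ^ a * K20 ^ b * K30 ^ c) 0 = (- 1) ^ a"
    by (simp add: coeff_mult coeff_0_power L_def K20_def K30_def)
  then show "coeff (mono_form a b c) a \<noteq> 0"
    by (simp add: co)
qed

lemma bform_independent:
  assumes "(\<Sum>i<N. smult (c i) (bform k i)) = 0" "i < N"
  shows "c i = 0"
proof (rule ccontr)
  assume "c i \<noteq> 0"
  define i0 where "i0 = (LEAST i. i < N \<and> c i \<noteq> 0)"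
  have i0: "i0 < N" "c i0 \<noteq> 0"
    using LeastI[of "\<lambda>i. i < N \<and> c i \<noteq> 0" i] assms(2) \<open>c i \<noteq> 0\<close> by (auto simp: i0_def)
  have lt: "c l = 0" if "l < i0" for l
    using not_less_Least[of l "\<lambda>i. i < N \<and> c i \<noteq> 0"] that i0 by (auto simp: i0_def)
  \<comment> \<open>The order of vanishing at 0 of the form with the least active index: smaller
    indices have coefficient 0, larger ones vanish to higher order.\<close>
  define n where "n = 5 * i0 + (k div 2) mod 5"
  have "0 = coeff (\<Sum>i<N. smult (c i) (bform k i)) n"
    using assms(1) by simp
  also have "\<dots> = (\<Sum>l<N. if l = i0 then c i0 * coeff (bform k i0) n else 0)"
    unfolding coeff_sum coeff_smult
  proof (rule sum.cong[OF refl])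
    fix l
    consider "l < i0" | "l = i0" | "i0 < l" by linarith
    then show "c l * coeff (bform k l) n = (if l = i0 then c i0 * coeff (bform k i0) n else 0)"
      by cases (auto simp: lt bform_def Let_def n_def intro!: coeff_mono_form(1))
  qed
  also have "\<dots> = c i0 * coeff (bform k i0) n"
    using i0(1) by simp
  also have "\<dots> \<noteq> 0"
    using i0(2) coeff_mono_form(2) by (simp add: bform_def Let_def n_def)
  finally show False by simp
qed

theorem theorem10p5:
  fixes k :: nat
  shows "(odd k \<longrightarrow> modes Istar k = {\<lambda>_. 0}) \<and>
         (even k \<longrightarrow>
            (\<forall>i < nat (ktilde k + 1). \<forall>j \<le> k. sibling k i j \<in> modes Istar k) \<and>
            (\<forall>c :: nat \<Rightarrow> nat \<Rightarrow> complex.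
               (\<forall>x. (\<Sum>i < nat (ktilde k + 1). \<Sum>j \<le> k. c i j * sibling k i j x) = 0)
               \<longrightarrow> (\<forall>i < nat (ktilde k + 1). \<forall>j \<le> k. c i j = 0)) \<and>
            (\<forall>F \<in> modes Istar k. \<exists>c :: nat \<Rightarrow> nat \<Rightarrow> complex.
               F = (\<lambda>x. \<Sum>i < nat (ktilde k + 1). \<Sum>j \<le> k. c i j * sibling k i j x)))"
proof (intro conjI impI)
  assume k: "odd k"
  have "F = (\<lambda>_. 0)" if F: "F \<in> modes Istar k" for F
  proof
    fix x
    obtain q where q: "\<And>j. degree (q j) \<le> k" "\<And>j. j \<le> k \<Longrightarrow> invariant_form (q j) k"
      "\<And>x. x \<in> S3 \<Longrightarrow> F x = (\<Sum>j\<le>k. sib (q j) k j x)"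
      using modes_expansion[OF F] by blast
    have "q j = 0" if "j \<le> k" for j
      using odd_invariant_form_zero[OF q(1) q(2)[OF that] k] .
    then show "F x = 0"
    proof (cases "x \<in> S3")
      case True
      then show ?thesis using q(3)[OF True] \<open>\<And>j. j \<le> k \<Longrightarrow> q j = 0\<close> by (simp add: sib_def)
    next
      case False
      then show ?thesis using F modes_iff by blast
    qed
  qed
  moreover have "(\<lambda>_. 0) \<in> modes Istar k"
    using sib_in_modes[of 0 k 0 0] by (simp add: invariant_form_def hom_def restrS3_def[abs_def])
  ultimately show "modes Istar k = {\<lambda>_. 0}" by blast
next
  assume k: "even k"
  \<comment> \<open>For negative \<open>ktilde k\<close> this is 0 and all sums over
    \<open>i\<close> are empty.\<close>
  let ?N = "nat (ktilde k + 1)"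
  show "\<forall>i<?N. \<forall>j\<le>k. sibling k i j \<in> modes Istar k"
    using sibling_eq_sib[OF k] sib_in_modes[OF Bpoly_hom(3)[OF k]] by simp
  \<comment> \<open>Grouping by \<open>j\<close> turns a combination of siblings into one form per
    \<open>j\<close>, to which \<open>sib_independent\<close> applies.\<close>
  have sum_sib: "(\<Sum>i<?N. \<Sum>j\<le>k. c i j * sibling k i j x)
      = (\<Sum>j\<le>k. sib (\<Sum>i<?N. smult (c i j * fact j) (bform k i)) k j x)" if "x \<in> S3" for c x
  proof -
    have "(\<Sum>i<?N. \<Sum>j\<le>k. c i j * sibling k i j x) = (\<Sum>i<?N. \<Sum>j\<le>k. c i j * fact j * sib (bform k i) k j x)"
      using that by (intro sum.cong) (auto simp: sibling_eq_sib[OF k] restrS3_def)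
    also have "\<dots> = (\<Sum>j\<le>k. \<Sum>i<?N. c i j * fact j * sib (bform k i) k j x)"
      by (rule sum.swap)
    finally show ?thesis by (simp only: sib_sum_smult)
  qed
  show "\<forall>c. (\<forall>x. (\<Sum>i<?N. \<Sum>j\<le>k. c i j * sibling k i j x) = 0) \<longrightarrow> (\<forall>i<?N. \<forall>j\<le>k. c i j = 0)"
  proof (intro allI impI)
    fix c :: "nat \<Rightarrow> nat \<Rightarrow> complex" and i j
    assume 0: "\<forall>x. (\<Sum>i<?N. \<Sum>j\<le>k. c i j * sibling k i j x) = 0" and i: "i < ?N" and j: "j \<le> k"
    have "(\<Sum>i<?N. smult (c i j * fact j) (bform k i)) = 0"
    proof (rule sib_independent[where q = "\<lambda>j. \<Sum>i<?N. smult (c i j * fact j) (bform k i)"])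
      show "(\<Sum>j\<le>k. sib (\<Sum>i<?N. smult (c i j * fact j) (bform k i)) k j x) = 0" if "x \<in> S3" for x
        using 0 sum_sib[OF that] by metis
      show "degree (\<Sum>i<?N. smult (c i j * fact j) (bform k i)) \<le> k" for j
        by (intro degree_sum_le) (auto intro!: order_trans[OF degree_smult_le] Bpoly_hom(2)[OF k])
    qed (rule j)
    from bform_independent[OF this i] show "c i j = 0" by simp
  qed
  show "\<forall>F\<in>modes Istar k. \<exists>c. F = (\<lambda>x. \<Sum>i<?N. \<Sum>j\<le>k. c i j * sibling k i j x)"
  proof
    fix F assume F: "F \<in> modes Istar k"
    obtain q where q: "\<And>j. degree (q j) \<le> k" "\<And>j. j \<le> k \<Longrightarrow> invariant_form (q j) k"
      "\<And>x. x \<in> S3 \<Longrightarrow> F x = (\<Sum>j\<le>k. sib (q j) k j x)"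
      using modes_expansion[OF F] by blast
    have "\<exists>c. \<forall>p. hom (q j) k p = (\<Sum>i<?N. c i * Bpoly k i p)" if "j \<le> k" for j
      using ispan_imp_Bpoly_sum[OF klein_invariants[OF q(1) q(2)[OF that]]] .
    then obtain d where d: "\<And>j p. j \<le> k \<Longrightarrow> hom (q j) k p = (\<Sum>i<?N. d j i * Bpoly k i p)"
      by metis
    \<comment> \<open>The division offsets the \<open>fact j\<close> by which a sibling exceeds
      \<open>sib\<close>.\<close>
    define c where "c i j = d j i / fact j" for i j
    have qj: "q j = (\<Sum>i<?N. smult (c i j * fact j) (bform k i))" if "j \<le> k" for j
    proof (rule hom_inj[OF q(1)])
      show "degree (\<Sum>i<?N. smult (c i j * fact j) (bform k i)) \<le> k"
        by (intro degree_sum_le) (auto intro!: order_trans[OF degree_smult_le] Bpoly_hom(2)[OF k])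
      show "hom (q j) k p = hom (\<Sum>i<?N. smult (c i j * fact j) (bform k i)) k p" for p
        by (simp add: d[OF that] hom_sum hom_smult c_def Bpoly_hom(1)[OF k])
    qed
    have "F x = (\<Sum>i<?N. \<Sum>j\<le>k. c i j * sibling k i j x)" for x
    proof (cases "x \<in> S3")
      case True
      have "(\<Sum>j\<le>k. sib (q j) k j x) = (\<Sum>j\<le>k. sib (\<Sum>i<?N. smult (c i j * fact j) (bform k i)) k j x)"
        by (intro sum.cong refl) (simp only: qj[symmetric] atMost_iff)
      then show ?thesis
        using q(3)[OF True] sum_sib[OF True, of c] by simp
    next
      case False
      then have "F x = 0" using F modes_iff by blast
      then show ?thesis
        using False by (simp add: sibling_def restrS3_def)
    qed
    then show "\<exists>c. F = (\<lambda>x. \<Sum>i<?N. \<Sum>j\<le>k. c i j * sibling k i j x)"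
      by blast
  qed
qed

end
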